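(* Let $k>0$, $\mu_0=k(n-1)$, $\mu\in\mathbb C$ with $\mathrm{Re}\,\mu>\mu_0$, and $z\in H_n(0)=\{z\in\mathbb C^n:\mathrm{Re}\,z_i>0\ \forall i\}$. Then $$\int_{\mathbb R_+^n}E_k^A(-x,z)D(x)^{\mu-\mu_0-1}\omega_k(x)\,dx=d_n(k)\Gamma_n(\mu;k)\cdot D(z)^{-\mu},$$ where $D(z)^a:=\prod_{j=1}^nz_j^a$ and $\zeta\mapsto\zeta^a$ is the principal branch of the power function on $\mathbb C\setminus]-\infty,0]$ with $1^a=1$.
   Context: $D(x)=\prod_{i=1}^nx_i$, $\omega_k(x)=\prod_{1\le i<j\le n}|x_i-x_j|^{2k}$, $\mathbb R_+=]0,\infty[$, $d_n(k)=\prod_{j=1}^n\frac{\Gamma(1+jk)}{\Gamma(1+k)}$, $\Gamma_n(\mu;k)=\prod_{j=1}^n\Gamma(\mu-k(j-1))$. Dunkl operators: $T_i(k)=\frac{\partial}{\partial x_i}+k\sum_{j\ne i}\frac{1}{x_i-x_j}(1-\sigma_{ij})$, $\sigma_{ij}$ exchanging $x_i,x_j$. Dunkl kernel $E_k^A$: for $y\in\mathbb C^n$, $E_k^A(\cdot,y)$ is the unique analytic $f$ on $\mathbb R^n$ with $T_i(k)f=y_if$, $f(0)=1$, extended holomorphically to $\mathbb C^n\times\mathbb C^n$. *)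

theory Defs
  imports "HOL-Analysis.Analysis"
begin

definition D_real :: "real ^ 'n \<Rightarrow> real" where
  "D_real x = (\<Prod>i\<in>UNIV. x $ i)"

definition omega_k :: "real \<Rightarrow> real ^ ('n::{finite,linorder}) \<Rightarrow> real" where
  "omega_k k x = (\<Prod>(i,j)\<in>{(i,j). i < j}. \<bar>x $ i - x $ j\<bar> powr (2 * k))"

definition d_n :: "nat \<Rightarrow> real \<Rightarrow> real" where
  "d_n n k = (\<Prod>j=1..n. Gamma (1 + real j * k) / Gamma (1 + k))"

definition Gamma_n :: "nat \<Rightarrow> complex \<Rightarrow> real \<Rightarrow> complex" where
  "Gamma_n n \<mu> k = (\<Prod>j=1..n. Gamma (\<mu> - of_real (k * (real j - 1))))"

definition D_cpow :: "complex ^ 'n \<Rightarrow> complex \<Rightarrow> complex" where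
  "D_cpow z a = (\<Prod>j\<in>UNIV. (z $ j) powr a)"

definition real_analytic_on :: "(real ^ 'n) set \<Rightarrow> (real ^ 'n \<Rightarrow> complex) \<Rightarrow> bool" where
  "real_analytic_on S f \<longleftrightarrow> (\<forall>a\<in>S. \<exists>r>0. \<exists>c :: ('n \<Rightarrow> nat) \<Rightarrow> complex.
      \<forall>x\<in>ball a r. ((\<lambda>\<alpha>. c \<alpha> * (\<Prod>i\<in>UNIV. of_real ((x $ i - a $ i) ^ \<alpha> i))) has_sum f x) UNIV)"

definition swap_coords :: "'n \<Rightarrow> 'n \<Rightarrow> real ^ 'n \<Rightarrow> real ^ 'n" where
  "swap_coords i j x = (\<chi> l. if l = i then x $ j else if l = j then x $ i else x $ l)"

definition partial_i :: "'n \<Rightarrow> (real ^ 'n \<Rightarrow> complex) \<Rightarrow> real ^ 'n \<Rightarrow> complex" where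
  "partial_i i f x = vector_derivative (\<lambda>t. f (x + t *\<^sub>R axis i 1)) (at 0)"

text \<open>Dunkl operator of type A_{n-1}, evaluated at points with pairwise distinct coordinates.\<close>
definition dunkl_op :: "real \<Rightarrow> 'n \<Rightarrow> (real ^ 'n \<Rightarrow> complex) \<Rightarrow> real ^ 'n \<Rightarrow> complex" where
  "dunkl_op k i f x = partial_i i f x
     + of_real k * (\<Sum>j\<in>UNIV - {i}. (f x - f (swap_coords i j x)) / of_real (x $ i - x $ j))"

definition distinct_coords :: "real ^ 'n \<Rightarrow> bool" where
  "distinct_coords x \<longleftrightarrow> (\<forall>i j. i \<noteq> j \<longrightarrow> x $ i \<noteq> x $ j)"

text \<open>Dunkl kernel E_k^A(x,y) for real x and complex y: the unique analytic f on R^n with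
  T_i(k) f = y_i f and f(0) = 1 (the identity T_i f = y_i f is required on the dense open set
  of points with pairwise distinct coordinates, where the difference terms are literally defined;
  by continuity this is equivalent to the identity on all of R^n).\<close>
definition dunkl_kernel_A :: "real \<Rightarrow> real ^ 'n \<Rightarrow> complex ^ 'n \<Rightarrow> complex" where
  "dunkl_kernel_A k x y =
     (THE f. real_analytic_on UNIV f \<and> f 0 = 1 \<and>
        (\<forall>i. \<forall>u. distinct_coords u \<longrightarrow> dunkl_op k i f u = y $ i * f u)) x"

end

theory Submission
  imports Defs "HOL-Complex_Analysis.Complex_Analysis"
begin

text \<open>
  With \<open>L\<close> the sum of the operators \<open>1 - \<sigma>\<close> over all transpositions, the homogeneous parts \<open>p\<^sub>m\<close> of the
  Dunkl kernel satisfy \<open>(m + k L) p\<^sub>m = \<langle>x, y\<rangle> p\<^sub>m\<^sub>-\<^sub>1\<close>. The operator \<open>m + k L\<close> is invertible by a maximum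
  principle on orbits, so this recursion constructs the kernel, and the relation \<open>T\<^sub>j p\<^sub>m\<^sub>+\<^sub>1 = y\<^sub>j p\<^sub>m\<close>
  follows by induction: its defect is annihilated by an invertible operator of the same shape.
  Commutativity of the Dunkl operators is not needed. An energy estimate over the symmetric group
  gives both uniqueness of the kernel and its exponential decay.

  Let \<open>F(z)\<close> be the Laplace integral and \<open>M\<^sub>i(z)\<close> its moment with the extra factor \<open>x\<^sub>i\<close>. Integration by
  parts gives \<open>z\<^sub>i M\<^sub>i = \<mu> F\<close>. As \<open>F\<close> is symmetric, the Dunkl operators in \<open>z\<close> act on it as partial derivatives, so
  \<open>dF = - \<Sum> M\<^sub>i dz\<^sub>i\<close>, whence \<open>F(z) D(z)\<^sup>\<mu>\<close> is constant. At \<open>z = (1, \<dots>, 1)\<close> the kernel is an exponential and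
  the constant is the Laguerre form of Selberg's integral; it is found from its recursion in the
  exponent and log-convexity, as in the Bohr--Mollerup theorem, together with induction on the
  dimension. The case of complex \<open>\<mu>\<close> follows by analytic continuation.
\<close>

section \<open>Homogeneous parts of the Dunkl kernel\<close>

text \<open>Multiplying the equations T_i f = y_i f by x_i and summing gives the Euler operator plus
  k L, because x_i / (x_i - x_j) + x_j / (x_j - x_i) = 1; in degree m this is the recursion. The
  converse is the difficulty: one scalar equation has to imply n equations, and difference quotients
  are meaningful only where coordinates are distinct. Such identities are therefore proved for
  injective x, on finite orbits, and reach collisions by limits along lines.

  Integration by parts uses x_i D^(a-1) times the kernel, with a = mu - mu_0. For a >= 1 this
  vanishes on the face x_i = 0 and the power grows polynomially, while the n - 1 reflections turn a
  into a + k (n - 1) = mu. This explains both the factor mu and the detour through real a >= 1. For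
  a = 1 without the factor x_i the face term survives and is a Selberg integral in one variable
  fewer, which drives the induction on the dimension. The formula for dF is derived off the
  diagonals only, so paths in z are chosen to meet them finitely often.\<close>

abbreviation swp :: "'a \<Rightarrow> 'a \<Rightarrow> 'a \<Rightarrow> 'a" where
  "swp \<equiv> Transposition.transpose"

section \<open>Transpositions and maximum principles on finite orbits\<close>

lemma transpose_swap_index:
  "swp a b \<circ> swp c d = swp c d \<circ> swp (swp c d a) (swp c d b)"
  by (auto simp: fun_eq_iff Transposition.transpose_def)

lemma bij_transpose_prod:
  "bij (\<lambda>(a, b). (swp c d a, swp c d b))"
  by (rule o_bij[where g = "\<lambda>(a, b). (swp c d a, swp c d b)"]) (auto simp: fun_eq_iff)

lemma sum_reindex_transpose:
  fixes f :: "'n::finite \<Rightarrow> 'b::comm_monoid_add"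
  shows "(\<Sum>a\<in>UNIV. f (swp c d a)) = sum f UNIV"
  by (rule sum.reindex_bij_betw) simp

text \<open>At a point y where the norm of h attains its maximum M, the equation gives (m + k * card
  A) M <= k * card A * M, so m M <= 0. The set \<open>X\<close> is abstract because three orbits
  occur: self-maps of the index type, points, and pairs of an index and a point.\<close>

lemma max_principle_zero:
  fixes h :: "'a \<Rightarrow> 'v::real_normed_vector"
  assumes "finite X" "finite A" and cl: "\<And>x a. x \<in> X \<Longrightarrow> a \<in> A \<Longrightarrow> s a x \<in> X"
    and "m > 0" "k \<ge> 0"
    and eq: "\<And>x. x \<in> X \<Longrightarrow> m *\<^sub>R h x + k *\<^sub>R (\<Sum>a\<in>A. h x - h (s a x)) = 0"
    and "x \<in> X"
  shows "h x = 0"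
proof -
  define M where "M = Max ((\<lambda>x. norm (h x)) ` X)"
  have le: "norm (h y) \<le> M" if "y \<in> X" for y
    unfolding M_def using that assms(1) by auto
  have "M \<in> (\<lambda>x. norm (h x)) ` X" unfolding M_def
    using assms(1,7) by (intro Max_in) auto
  then obtain y where y: "y \<in> X" "norm (h y) = M" by auto
  have "(m + k * card A) *\<^sub>R h y = k *\<^sub>R (\<Sum>a\<in>A. h (s a y))"
    using eq[OF y(1)]
    by (simp add: sum_subtractf algebra_simps sum_constant_scaleR)
  then have "norm ((m + k * card A) *\<^sub>R h y) = norm (k *\<^sub>R (\<Sum>a\<in>A. h (s a y)))" by simp
  then have "(m + k * card A) * M = k * norm (\<Sum>a\<in>A. h (s a y))"
    using y(2) assms(4,5) by simp
  also have "\<dots> \<le> k * (\<Sum>a\<in>A. M)"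
    by (intro mult_left_mono sum_norm_le le cl y assms)
  finally have "m * M \<le> 0" by (simp add: algebra_simps)
  then have "M \<le> 0" using \<open>m > 0\<close> by (simp add: mult_le_0_iff)
  then show ?thesis using le[OF \<open>x \<in> X\<close>] by (meson norm_le_zero_iff order_trans)
qed

text \<open>At a minimum y every difference h(y) - h(s a y) is at most 0, so m times the minimum is
  already nonnegative. This yields the sign of the resolvent coefficients.\<close>

lemma min_principle_nonneg:
  fixes h :: "'a \<Rightarrow> real"
  assumes "finite X" "finite A" and cl: "\<And>x a. x \<in> X \<Longrightarrow> a \<in> A \<Longrightarrow> s a x \<in> X"
    and "m > 0" "k \<ge> 0"
    and ge: "\<And>x. x \<in> X \<Longrightarrow> m * h x + k * (\<Sum>a\<in>A. h x - h (s a x)) \<ge> 0"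
    and "x \<in> X"
  shows "h x \<ge> 0"
proof -
  define M where "M = Min (h ` X)"
  have le: "M \<le> h y" if "y \<in> X" for y
    unfolding M_def using that assms(1) by auto
  have "M \<in> h ` X" unfolding M_def
    using assms(1,7) by (intro Min_in) auto
  then obtain y where y: "y \<in> X" "h y = M" by auto
  have "(\<Sum>a\<in>A. h y - h (s a y)) \<le> (\<Sum>a\<in>A. 0)"
    using le[OF cl[OF y(1)]] y(2) by (intro sum_mono) auto
  then have "k * (\<Sum>a\<in>A. h y - h (s a y)) \<le> 0"
    using \<open>k \<ge> 0\<close> by (simp add: mult_nonneg_nonpos)
  then have "m * M \<ge> 0" using ge[OF y(1)] unfolding y(2) by linarith
  then have "M \<ge> 0" using \<open>m > 0\<close> by (simp add: zero_le_mult_iff)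
  then show ?thesis using le[OF \<open>x \<in> X\<close>] by simp
qed

text \<open>The weights c invert m + k L as a convolution. The linear map \<open>T\<close> is
  injective by the maximum principle, hence surjective in finite dimension, and c is the preimage of
  the unit mass at \<open>id\<close>. All self-maps of the index type serve as index set: they form
  a finite type stable under composition with transpositions.\<close>

lemma ex_resolvent_coeffs:
  fixes m k :: real
  assumes "m > 0" "k \<ge> 0"
  shows "\<exists>c :: ('n::finite \<Rightarrow> 'n) \<Rightarrow> real.
    (\<forall>\<pi>. c \<pi> \<ge> 0) \<and>
    (\<forall>\<pi>. m * c \<pi> + k * (\<Sum>(a,b)\<in>UNIV. c \<pi> - c (swp a b \<circ> \<pi>)) = (if \<pi> = id then 1 else 0))"
proof -
  define T :: "real ^ ('n \<Rightarrow> 'n) \<Rightarrow> real ^ ('n \<Rightarrow> 'n)" where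
    "T c = (\<chi> \<pi>. m * c $ \<pi> + k * (\<Sum>(a,b)\<in>UNIV. c $ \<pi> - c $ (swp a b \<circ> \<pi>)))" for c
  have lin: "linear T"
    unfolding T_def
    by (rule linearI)
       (auto simp: vec_eq_iff algebra_simps sum.distrib sum_subtractf sum_distrib_left case_prod_unfold)
  have "inj T"
    unfolding linear_injective_0[OF lin]
  proof (intro allI impI)
    fix c assume "T c = 0"
    then have z: "m * c $ \<pi> + k * (\<Sum>(a,b)\<in>UNIV. c $ \<pi> - c $ (swp a b \<circ> \<pi>)) = 0" for \<pi>
      by (simp add: T_def vec_eq_iff)
    have "c $ \<pi> = 0" for \<pi>
      by (rule max_principle_zero[where X = UNIV and A = UNIV and m = m and k = k
            and s = "\<lambda>(a,b) \<pi>. swp a b \<circ> \<pi>" and h = "\<lambda>\<pi>. c $ \<pi>"])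
         (use z assms in \<open>auto simp: case_prod_unfold\<close>)
    then show "c = 0" by (simp add: vec_eq_iff)
  qed
  then have "surj T" by (intro linear_injective_imp_surjective[OF lin]) auto
  then obtain c where c: "T c = (\<chi> \<pi>. if \<pi> = id then 1 else 0)" by (metis surjD)
  then have eq: "m * c $ \<pi> + k * (\<Sum>(a,b)\<in>UNIV. c $ \<pi> - c $ (swp a b \<circ> \<pi>)) = (if \<pi> = id then 1 else 0)" for \<pi>
    by (simp add: T_def vec_eq_iff)
  have "c $ \<pi> \<ge> 0" for \<pi>
    by (rule min_principle_nonneg[where X = UNIV and A = UNIV and m = m and k = k
            and s = "\<lambda>(a,b) \<pi>. swp a b \<circ> \<pi>" and h = "\<lambda>\<pi>. c $ \<pi>"])
       (use eq assms in \<open>auto simp: case_prod_unfold\<close>)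
  then show ?thesis using eq by (intro exI[of _ "\<lambda>\<pi>. c $ \<pi>"]) auto
qed

definition resolvent_coeff :: "real \<Rightarrow> real \<Rightarrow> ('n::finite \<Rightarrow> 'n) \<Rightarrow> real" where
  "resolvent_coeff k m = (SOME c. (\<forall>\<pi>. c \<pi> \<ge> 0) \<and>
    (\<forall>\<pi>. m * c \<pi> + k * (\<Sum>(a,b)\<in>UNIV. c \<pi> - c (swp a b \<circ> \<pi>)) = (if \<pi> = id then 1 else 0)))"

lemma
  fixes \<pi> :: "'n::finite \<Rightarrow> 'n"
  assumes "m > 0" "k \<ge> 0"
  shows resolvent_coeff_nonneg: "resolvent_coeff k m \<pi> \<ge> 0"
    and resolvent_coeff_eq: "m * resolvent_coeff k m \<pi>
       + k * (\<Sum>(a,b)\<in>UNIV. resolvent_coeff k m \<pi> - resolvent_coeff k m (swp a b \<circ> \<pi>))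
       = (if \<pi> = id then 1 else 0)"
proof -
  have "(\<forall>\<pi>::'n\<Rightarrow>'n. resolvent_coeff k m \<pi> \<ge> 0) \<and>
    (\<forall>\<pi>::'n\<Rightarrow>'n. m * resolvent_coeff k m \<pi>
       + k * (\<Sum>(a,b)\<in>UNIV. resolvent_coeff k m \<pi> - resolvent_coeff k m (swp a b \<circ> \<pi>))
       = (if \<pi> = id then 1 else 0))"
    unfolding resolvent_coeff_def by (rule someI_ex[OF ex_resolvent_coeffs[OF assms]])
  then show "resolvent_coeff k m \<pi> \<ge> 0"
    and "m * resolvent_coeff k m \<pi>
       + k * (\<Sum>(a,b)\<in>UNIV. resolvent_coeff k m \<pi> - resolvent_coeff k m (swp a b \<circ> \<pi>))
       = (if \<pi> = id then 1 else 0)" by blast+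
qed

lemma bij_comp_transpose: "bij (\<lambda>\<pi>. swp a b \<circ> \<pi>)"
  by (rule o_bij[where g = "\<lambda>\<pi>. swp a b \<circ> \<pi>"]) (auto simp: fun_eq_iff)

text \<open>Summed over all self-maps the differences cancel, because composition with a
  transposition is a bijection. Together with nonnegativity, 1 / m bounds the inverse operator in
  the supremum norm; it is the source of the factorials in the later estimates.\<close>

lemma sum_resolvent_coeff:
  assumes "m > 0" "k \<ge> 0"
  shows "(\<Sum>\<pi>\<in>UNIV. resolvent_coeff k m (\<pi> :: 'n::finite \<Rightarrow> 'n)) = 1 / m"
proof -
  let ?c = "resolvent_coeff k m :: ('n \<Rightarrow> 'n) \<Rightarrow> real"
  have z: "(\<Sum>\<pi>\<in>UNIV. ?c \<pi> - ?c (swp a b \<circ> \<pi>)) = 0" for a b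
    using sum.reindex_bij_betw[OF bij_comp_transpose, of ?c a b]
    by (simp add: sum_subtractf)
  have "(\<Sum>\<pi>\<in>UNIV. m * ?c \<pi> + k * (\<Sum>(a,b)\<in>UNIV. ?c \<pi> - ?c (swp a b \<circ> \<pi>))) =
        (\<Sum>\<pi>\<in>(UNIV::('n\<Rightarrow>'n) set). if \<pi> = id then 1 else 0)"
    by (intro sum.cong refl resolvent_coeff_eq[OF assms])
  also have "\<dots> = 1" by simp
  finally have "m * (\<Sum>\<pi>\<in>UNIV. ?c \<pi>) + k * (\<Sum>\<pi>\<in>UNIV. \<Sum>(a,b)\<in>UNIV. ?c \<pi> - ?c (swp a b \<circ> \<pi>)) = 1"
    by (simp add: sum.distrib sum_distrib_left)
  also have "(\<Sum>\<pi>\<in>UNIV. \<Sum>(a,b)\<in>UNIV. ?c \<pi> - ?c (swp a b \<circ> \<pi>)) = 0"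
    by (subst sum.swap) (simp add: case_prod_unfold z)
  finally show ?thesis using assms by (simp add: field_simps)
qed

definition laplacian :: "(('n::finite \<Rightarrow> 'a) \<Rightarrow> 'b::ab_group_add) \<Rightarrow> ('n \<Rightarrow> 'a) \<Rightarrow> 'b" where
  "laplacian f x = (\<Sum>(a,b)\<in>UNIV. f x - f (x \<circ> swp a b))"

text \<open>A swap of x is moved onto the coefficients by the substitution
  \<open>\<pi> \<mapsto> swp a b \<circ> \<pi>\<close>. The operator then acts on c alone, where it
  produces the unit mass at \<open>id\<close>.\<close>

lemma laplacian_resolvent:
  fixes g :: "('n::finite \<Rightarrow> complex) \<Rightarrow> complex"
  assumes "m > 0" "k \<ge> 0"
  defines "f \<equiv> (\<lambda>x. \<Sum>\<pi>\<in>UNIV. resolvent_coeff k m \<pi> * g (x \<circ> \<pi>))"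
  shows "m * f x + k * laplacian f x = g x"
proof -
  let ?c = "resolvent_coeff k m :: ('n \<Rightarrow> 'n) \<Rightarrow> real"
  have f': "f (x \<circ> swp a b) = (\<Sum>\<pi>\<in>UNIV. ?c (swp a b \<circ> \<pi>) * g (x \<circ> \<pi>))" for a b
  proof -
    have "f (x \<circ> swp a b) = (\<Sum>\<pi>\<in>UNIV. ?c \<pi> * g (x \<circ> (swp a b \<circ> \<pi>)))"
      by (simp add: f_def o_assoc)
    also have "\<dots> = (\<Sum>\<pi>\<in>UNIV. (\<lambda>\<pi>. ?c (swp a b \<circ> \<pi>) * g (x \<circ> \<pi>)) (swp a b \<circ> \<pi>))"
      by (simp add: o_assoc flip: comp_assoc)
    also have "\<dots> = (\<Sum>\<pi>\<in>UNIV. ?c (swp a b \<circ> \<pi>) * g (x \<circ> \<pi>))"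
      by (rule sum.reindex_bij_betw[OF bij_comp_transpose])
    finally show ?thesis .
  qed
  have "laplacian f x = (\<Sum>ab\<in>UNIV. \<Sum>\<pi>\<in>UNIV. (?c \<pi> - ?c (swp (fst ab) (snd ab) \<circ> \<pi>)) * g (x \<circ> \<pi>))"
    unfolding laplacian_def f' by (simp add: f_def case_prod_unfold sum_subtractf algebra_simps)
  also have "\<dots> = (\<Sum>\<pi>\<in>UNIV. (\<Sum>(a,b)\<in>UNIV. ?c \<pi> - ?c (swp a b \<circ> \<pi>)) * g (x \<circ> \<pi>))"
    by (subst sum.swap) (simp add: sum_distrib_right case_prod_unfold)
  finally have "m * f x + k * laplacian f x =
     (\<Sum>\<pi>\<in>UNIV. of_real (m * ?c \<pi> + k * (\<Sum>(a,b)\<in>UNIV. ?c \<pi> - ?c (swp a b \<circ> \<pi>))) * g (x \<circ> \<pi>))"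
    by (simp add: f_def sum_distrib_left sum.distrib algebra_simps)
  also have "\<dots> = (\<Sum>\<pi>\<in>UNIV. if \<pi> = id then g (x \<circ> \<pi>) else 0)"
    unfolding resolvent_coeff_eq[OF assms(1,2)] by (intro sum.cong) auto
  also have "\<dots> = g x" by simp
  finally show ?thesis .
qed

text \<open>The maximum principle on the finite orbit of x asks for no regularity. The transposition
  rule, the symmetry and the value at (1, ..., 1) of \<open>hom_kernel\<close> are all obtained by
  checking that a candidate solves the same equation.\<close>

lemma laplacian_unique:
  fixes f g :: "('n::finite \<Rightarrow> 'a) \<Rightarrow> complex"
  assumes "m > 0" "k \<ge> 0"
    and eq: "\<And>x. of_real m * f x + of_real k * laplacian f x = of_real m * g x + of_real k * laplacian g x"
  shows "f x = g x"
proof -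
  have "f x - g x = 0"
  proof (rule max_principle_zero[where X = "range (\<lambda>\<pi>::'n\<Rightarrow>'n. x \<circ> \<pi>)" and A = UNIV and m = m and k = k
      and s = "\<lambda>(a,b) x. x \<circ> swp a b" and h = "\<lambda>x. f x - g x"])
    fix y assume "y \<in> range (\<lambda>\<pi>::'n\<Rightarrow>'n. x \<circ> \<pi>)"
    have L: "laplacian (\<lambda>x. f x - g x) y = laplacian f y - laplacian g y"
      unfolding laplacian_def case_prod_unfold sum_subtractf[symmetric]
      by (intro sum.cong) (auto simp: algebra_simps)
    have "of_real m * (f y - g y) + of_real k * laplacian (\<lambda>x. f x - g x) y = 0"
      unfolding L using eq[of y] by (simp add: algebra_simps)
    then show "m *\<^sub>R (f y - g y) + k *\<^sub>R (\<Sum>a\<in>UNIV. f y - g y - (f ((\<lambda>(a, b) x. x \<circ> swp a b) a y) - g ((\<lambda>(a, b) x. x \<circ> swp a b) a y))) = 0"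
      by (simp add: laplacian_def case_prod_unfold scaleR_conv_of_real)
  next
    show "x \<in> range (\<lambda>\<pi>::'n\<Rightarrow>'n. x \<circ> \<pi>)" by (rule range_eqI[of _ _ id]) simp
  qed (use assms in \<open>auto simp: comp_assoc\<close>)
  then show ?thesis by simp
qed

section \<open>The recursion for the homogeneous parts\<close>

definition pairing :: "('n::finite \<Rightarrow> complex) \<Rightarrow> ('n \<Rightarrow> complex) \<Rightarrow> complex" where
  "pairing x y = (\<Sum>i\<in>UNIV. x i * y i)"

lemma pairing_commute: "pairing x y = pairing y x"
  by (simp add: pairing_def mult.commute)

lemma pairing_transpose: "pairing (x \<circ> swp a b) (y \<circ> swp a b) = pairing x y"
  using sum_reindex_transpose[of "\<lambda>i. x i * y i" a b] by (simp add: pairing_def)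

lemma norm_pairing_le:
  fixes x y :: "'n::finite \<Rightarrow> complex" and X Y :: real
  assumes "\<And>i. norm (x i) \<le> X" "\<And>i. norm (y i) \<le> Y"
  shows "norm (pairing x y) \<le> CARD('n) * (X * Y)"
proof -
  have "X \<ge> 0" using assms(1)[of undefined] norm_ge_zero order_trans by blast
  then have "norm (pairing x y) \<le> (\<Sum>i\<in>(UNIV::'n set). X * Y)"
    unfolding pairing_def by (intro sum_norm_le) (auto simp: norm_mult intro!: mult_mono assms)
  then show ?thesis by simp
qed

text \<open>The coefficient k / 2 compensates for laplacian counting each reflection twice.\<close>

primrec hom_kernel :: "real \<Rightarrow> nat \<Rightarrow> ('n::finite \<Rightarrow> complex) \<Rightarrow> ('n \<Rightarrow> complex) \<Rightarrow> complex" where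
  "hom_kernel k 0 x y = 1"
| "hom_kernel k (Suc m) x y = (\<Sum>\<pi>\<in>UNIV. resolvent_coeff (k / 2) (Suc m) \<pi> *
      (pairing (x \<circ> \<pi>) y * hom_kernel k m (x \<circ> \<pi>) y))"

context
  fixes k :: real
  assumes k_pos: "k > 0"
begin

lemma hom_kernel_laplacian:
  "of_nat (Suc m) * hom_kernel k (Suc m) x y + of_real (k / 2) * laplacian (\<lambda>x. hom_kernel k (Suc m) x y) x
     = pairing x y * hom_kernel k m x y"
  using laplacian_resolvent[of "Suc m" "k/2" "\<lambda>x. pairing x y * hom_kernel k m x y" x] k_pos
  by simp

lemma hom_kernel_unique:
  assumes "\<And>x. of_nat (Suc m) * f x + of_real (k / 2) * laplacian f x = pairing x y * hom_kernel k m x y"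
  shows "f x = hom_kernel k (Suc m) x y"
  by (rule laplacian_unique[where m = "real (Suc m)" and k = "k / 2"])
     (use k_pos assms[symmetric] hom_kernel_laplacian[symmetric, where m = m and y = y] in \<open>simp_all add: of_nat_Suc del: hom_kernel.simps\<close>)

text \<open>The left side solves the recursion of the right side: conjugation by
  \<open>swp c d\<close> only permutes the pairs summed in \<open>laplacian\<close>, and the pairing
  is invariant under a simultaneous swap.\<close>

lemma hom_kernel_transpose:
  "hom_kernel k m (x \<circ> swp c d) (y \<circ> swp c d) = hom_kernel k m x y"
proof (induction m arbitrary: x)
  case (Suc m)
  let ?f = "\<lambda>x. hom_kernel k (Suc m) (x \<circ> swp c d) (y \<circ> swp c d)"
  have "?f x = hom_kernel k (Suc m) x y"
  proof (rule hom_kernel_unique)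
    fix x
    have "laplacian ?f x = (\<Sum>(a,b)\<in>UNIV. hom_kernel k (Suc m) (x \<circ> swp c d) (y \<circ> swp c d)
        - hom_kernel k (Suc m) (x \<circ> swp c d \<circ> swp (swp c d a) (swp c d b)) (y \<circ> swp c d))"
      unfolding laplacian_def
      by (simp add: comp_assoc transpose_swap_index[of _ _ c d] del: hom_kernel.simps)
    also have "\<dots> = laplacian (\<lambda>x. hom_kernel k (Suc m) x (y \<circ> swp c d)) (x \<circ> swp c d)"
      unfolding laplacian_def
      using sum.reindex_bij_betw[OF bij_transpose_prod, of "\<lambda>(a,b). hom_kernel k (Suc m) (x \<circ> swp c d) (y \<circ> swp c d)
        - hom_kernel k (Suc m) (x \<circ> swp c d \<circ> swp a b) (y \<circ> swp c d)" c d]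
      by (simp add: case_prod_unfold del: hom_kernel.simps)
    finally show "of_nat (Suc m) * ?f x + of_real (k / 2) * laplacian ?f x = pairing x y * hom_kernel k m x y"
      using hom_kernel_laplacian[where m = m and x = "x \<circ> swp c d" and y = "y \<circ> swp c d"]
      by (simp only: pairing_transpose Suc)
  qed
  then show ?case .
qed simp

lemma hom_kernel_transpose_left:
  "hom_kernel k m (x \<circ> swp c d) y = hom_kernel k m x (y \<circ> swp c d)"
  using hom_kernel_transpose[of m x c d "y \<circ> swp c d"] by (simp add: comp_assoc)

text \<open>Equivariance moves each swap from one variable to the other, so the Laplacian in x
  equals the Laplacian in y, and the kernel with exchanged arguments solves the recursion that
  determines the original one.\<close>

lemma hom_kernel_commute: "hom_kernel k m x y = hom_kernel k m y x"
proof (induction m arbitrary: x y)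
  case (Suc m)
  show ?case
  proof (rule hom_kernel_unique[symmetric])
    fix x
    have "laplacian (hom_kernel k (Suc m) y) x = laplacian (\<lambda>y. hom_kernel k (Suc m) y x) y"
      unfolding laplacian_def by (simp only: hom_kernel_transpose_left)
    then show "of_nat (Suc m) * hom_kernel k (Suc m) y x + of_real (k / 2) * laplacian (hom_kernel k (Suc m) y) x =
         pairing x y * hom_kernel k m x y"
      using hom_kernel_laplacian[where m = m and x = y and y = x] by (simp only: pairing_commute[of x y] Suc)
  qed
qed simp

lemma hom_kernel_scale: "hom_kernel k m (\<lambda>i. s * x i) y = s ^ m * hom_kernel k m x y"
proof (induction m arbitrary: x)
  case (Suc m)
  have "pairing ((\<lambda>i. s * x i) \<circ> \<pi>) y = s * pairing (x \<circ> \<pi>) y" for \<pi>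
    by (simp add: pairing_def sum_distrib_left mult.assoc)
  moreover have "hom_kernel k m ((\<lambda>i. s * x i) \<circ> \<pi>) y = s ^ m * hom_kernel k m (x \<circ> \<pi>) y" for \<pi>
    using Suc[of "x \<circ> \<pi>"] by (simp add: comp_def)
  ultimately show ?case by (simp add: sum_distrib_left algebra_simps)
qed simp

text \<open>Powers of the sum of the coordinates are invariant under swaps, so
  \<open>laplacian\<close> annihilates them and the recursion becomes that of the exponential
  series.\<close>

lemma hom_kernel_one: "hom_kernel k m x (\<lambda>_. 1) = (\<Sum>i\<in>UNIV. x i) ^ m / fact m"
proof (induction m arbitrary: x)
  case (Suc m)
  have "laplacian (\<lambda>x. (\<Sum>i\<in>UNIV. x i) ^ Suc m / fact (Suc m)) x = 0" for x :: "'a \<Rightarrow> complex"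
    using sum_reindex_transpose[of x] by (simp add: laplacian_def)
  then have "of_nat (Suc m) * ((\<Sum>i\<in>UNIV. x i) ^ Suc m / fact (Suc m))
      + of_real (k / 2) * laplacian (\<lambda>x. (\<Sum>i\<in>UNIV. x i) ^ Suc m / fact (Suc m)) x
      = pairing x (\<lambda>_. 1) * hom_kernel k m x (\<lambda>_. 1)" for x :: "'a \<Rightarrow> complex"
    unfolding Suc by (simp add: pairing_def divide_simps del: of_nat_Suc)
  from hom_kernel_unique[OF this] show ?case by simp
qed simp

text \<open>Nonnegative coefficients with sum 1 / (m + 1) average the previous bound over the points
  \<open>x \<circ> \<pi>\<close>, so each step multiplies the bound by n X Y / (m + 1).\<close>

lemma norm_hom_kernel_le:
  fixes x y :: "'n::finite \<Rightarrow> complex" and X Y :: real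
  assumes "\<And>i. norm (x i) \<le> X" "\<And>i. norm (y i) \<le> Y"
  shows "norm (hom_kernel k m x y) \<le> (CARD('n) * (X * Y)) ^ m / fact m"
  using assms(1)
proof (induction m arbitrary: x)
  case (Suc m)
  have "X \<ge> 0" "Y \<ge> 0" using Suc.prems[of undefined] assms(2)[of undefined] norm_ge_zero order_trans by blast+
  have "norm (hom_kernel k (Suc m) x y) \<le> (\<Sum>\<pi>\<in>(UNIV::('n\<Rightarrow>'n) set). resolvent_coeff (k/2) (Suc m) \<pi> *
     (CARD('n) * (X * Y) * ((CARD('n) * (X * Y)) ^ m / fact m)))"
    unfolding hom_kernel.simps
  proof (rule sum_norm_le)
    fix \<pi> :: "'n \<Rightarrow> 'n"
    have "norm (pairing (x \<circ> \<pi>) y * hom_kernel k m (x \<circ> \<pi>) y) \<le> CARD('n) * (X * Y) * ((CARD('n) * (X * Y)) ^ m / fact m)"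
      unfolding norm_mult by (intro mult_mono norm_pairing_le Suc assms) (use \<open>X \<ge> 0\<close> \<open>Y \<ge> 0\<close> Suc.prems in auto)
    moreover have "resolvent_coeff (k/2) (Suc m) \<pi> \<ge> 0"
      using resolvent_coeff_nonneg[of "Suc m" "k/2" \<pi>] k_pos by simp
    ultimately show "norm (of_real (resolvent_coeff (k/2) (Suc m) \<pi>) * (pairing (x \<circ> \<pi>) y * hom_kernel k m (x \<circ> \<pi>) y))
      \<le> resolvent_coeff (k/2) (Suc m) \<pi> * (CARD('n) * (X * Y) * ((CARD('n) * (X * Y)) ^ m / fact m))"
      unfolding norm_mult[of "of_real _"] norm_of_real by (simp only: abs_of_nonneg) (rule mult_left_mono)
  qed
  also have "\<dots> = (CARD('n) * (X * Y)) ^ Suc m / fact (Suc m)"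
    unfolding sum_distrib_right[symmetric]
    by (subst sum_resolvent_coeff) (use k_pos in \<open>auto simp: field_simps\<close>)
  finally show ?case .
qed simp

end

section \<open>Dunkl operators in complex coordinates and the eigenvalue relation\<close>

definition cpartial :: "'n \<Rightarrow> (('n \<Rightarrow> complex) \<Rightarrow> complex) \<Rightarrow> ('n \<Rightarrow> complex) \<Rightarrow> complex" where
  "cpartial i f x = deriv (\<lambda>t. f (x(i := t))) (x i)"

definition coordinate_differentiable :: "(('n \<Rightarrow> complex) \<Rightarrow> complex) \<Rightarrow> bool" where
  "coordinate_differentiable f \<longleftrightarrow> (\<forall>x i. (\<lambda>t. f (x(i := t))) field_differentiable at (x i))"

text \<open>The term j = i is 0 / 0, which is 0, so it is not excluded from the sum. At a point with
  equal coordinates further quotients default to 0 and the formula is no longer the Dunkl operator;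
  the eigenvalue relation therefore assumes \<open>inj x\<close>.\<close>

definition cdunkl :: "real \<Rightarrow> 'n::finite \<Rightarrow> (('n \<Rightarrow> complex) \<Rightarrow> complex) \<Rightarrow> ('n \<Rightarrow> complex) \<Rightarrow> complex" where
  "cdunkl k i f x = cpartial i f x + of_real k * (\<Sum>j\<in>UNIV. (f x - f (x \<circ> swp i j)) / (x i - x j))"

lemma fun_upd_swp: "(x(j := t)) \<circ> swp a b = (x \<circ> swp a b)(swp a b j := t)"
  by (auto simp: fun_eq_iff Transposition.transpose_def)

lemma coordinate_differentiableD:
  "coordinate_differentiable f \<Longrightarrow> ((\<lambda>t. f (x(i := t))) has_field_derivative cpartial i f x) (at (x i))"
  unfolding coordinate_differentiable_def cpartial_def
  using DERIV_deriv_iff_field_differentiable by blast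

lemma cpartial_swp: "cpartial j (\<lambda>x. f (x \<circ> swp a b)) x = cpartial (swp a b j) f (x \<circ> swp a b)"
  by (simp add: cpartial_def fun_upd_swp)

lemma coordinate_differentiable_swp:
  assumes "coordinate_differentiable f"
  shows "coordinate_differentiable (\<lambda>x. f (x \<circ> swp a b))"
  unfolding coordinate_differentiable_def
proof (intro allI)
  fix x i
  have "(\<lambda>t. f ((x \<circ> swp a b)(swp a b i := t))) field_differentiable at ((x \<circ> swp a b) (swp a b i))"
    using assms unfolding coordinate_differentiable_def by blast
  then show "(\<lambda>t. f (x(i := t) \<circ> swp a b)) field_differentiable at (x i)"
    by (simp add: fun_upd_swp)
qed

text \<open>A swap of the argument also moves the index of the operator, up to a reindexing of the
  difference terms. This is why the proof of the eigenvalue relation treats all indices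
  together.\<close>

lemma cdunkl_swp: "cdunkl k j (\<lambda>x. f (x \<circ> swp a b)) x = cdunkl k (swp a b j) f (x \<circ> swp a b)"
proof -
  have "(\<Sum>l\<in>UNIV. (f (x \<circ> swp a b) - f (x \<circ> swp j l \<circ> swp a b)) / (x j - x l))
     = (\<Sum>l\<in>UNIV. (\<lambda>l. (f (x \<circ> swp a b) - f (x \<circ> swp a b \<circ> swp (swp a b j) l)) / ((x \<circ> swp a b) (swp a b j) - (x \<circ> swp a b) l)) (swp a b l))"
    by (simp add: comp_assoc transpose_swap_index[of _ _ a b])
  also have "\<dots> = (\<Sum>l\<in>UNIV. (f (x \<circ> swp a b) - f (x \<circ> swp a b \<circ> swp (swp a b j) l)) / ((x \<circ> swp a b) (swp a b j) - (x \<circ> swp a b) l))"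
    by (rule sum_reindex_transpose)
  finally show ?thesis by (simp add: cdunkl_def cpartial_swp)
qed

lemma cdunkl_linear:
  assumes "coordinate_differentiable f" "finite A" "\<And>a. a \<in> A \<Longrightarrow> coordinate_differentiable (g a)"
  shows "coordinate_differentiable (\<lambda>x. c * f x + d * (\<Sum>a\<in>A. f x - g a x))" (is ?A)
    and "cdunkl k j (\<lambda>x. c * f x + d * (\<Sum>a\<in>A. f x - g a x)) x =
         c * cdunkl k j f x + d * (\<Sum>a\<in>A. cdunkl k j f x - cdunkl k j (g a) x)" (is ?B)
proof -
  have D: "((\<lambda>t. c * f (x(i:=t)) + d * (\<Sum>a\<in>A. f (x(i:=t)) - g a (x(i:=t)))) has_field_derivative
     (c * cpartial i f x + d * (\<Sum>a\<in>A. cpartial i f x - cpartial i (g a) x))) (at (x i))" for x i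
    by (intro DERIV_add DERIV_cmult DERIV_sum DERIV_diff coordinate_differentiableD assms)
  show ?A unfolding coordinate_differentiable_def field_differentiable_def using D by blast
  have "cpartial j (\<lambda>x. c * f x + d * (\<Sum>a\<in>A. f x - g a x)) x = c * cpartial j f x + d * (\<Sum>a\<in>A. cpartial j f x - cpartial j (g a) x)"
    unfolding cpartial_def[of j "\<lambda>x. c * f x + d * (\<Sum>a\<in>A. f x - g a x)"] by (rule DERIV_imp_deriv[OF D])
  moreover have "(\<Sum>l\<in>UNIV. (c * f x + d * (\<Sum>a\<in>A. f x - g a x)
          - (c * f (x \<circ> swp j l) + d * (\<Sum>a\<in>A. f (x \<circ> swp j l) - g a (x \<circ> swp j l)))) / (x j - x l))
      = c * (\<Sum>l\<in>UNIV. (f x - f (x \<circ> swp j l)) / (x j - x l))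
       + d * (\<Sum>l\<in>UNIV. \<Sum>a\<in>A. (f x - f (x \<circ> swp j l)) / (x j - x l) - (g a x - g a (x \<circ> swp j l)) / (x j - x l))"
    unfolding sum_distrib_left sum.distrib[symmetric]
  proof (rule sum.cong)
    fix l
    have *: "(\<Sum>a\<in>A. (f x - f (x \<circ> swp j l)) / (x j - x l) - (g a x - g a (x \<circ> swp j l)) / (x j - x l))
      = ((\<Sum>a\<in>A. f x - g a x) - (\<Sum>a\<in>A. f (x \<circ> swp j l) - g a (x \<circ> swp j l))) / (x j - x l)"
      unfolding sum_subtractf[symmetric] sum_divide_distrib by (intro sum.cong) (auto simp: divide_simps)
    show "(c * f x + (\<Sum>a\<in>A. d * (f x - g a x)) - (c * f (x \<circ> swp j l) + (\<Sum>a\<in>A. d * (f (x \<circ> swp j l) - g a (x \<circ> swp j l))))) / (x j - x l)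
      = c * ((f x - f (x \<circ> swp j l)) / (x j - x l))
        + (\<Sum>a\<in>A. d * ((f x - f (x \<circ> swp j l)) / (x j - x l) - (g a x - g a (x \<circ> swp j l)) / (x j - x l)))"
      unfolding sum_distrib_left[symmetric] * by (simp add: field_simps add_divide_distrib diff_divide_distrib)
  qed simp
  then have "(\<Sum>l\<in>UNIV. (c * f x + d * (\<Sum>a\<in>A. f x - g a x)
          - (c * f (x \<circ> swp j l) + d * (\<Sum>a\<in>A. f (x \<circ> swp j l) - g a (x \<circ> swp j l)))) / (x j - x l))
      = c * (\<Sum>l\<in>UNIV. (f x - f (x \<circ> swp j l)) / (x j - x l))
       + d * (\<Sum>a\<in>A. (\<Sum>l\<in>UNIV. (f x - f (x \<circ> swp j l)) / (x j - x l)) - (\<Sum>l\<in>UNIV. (g a x - g a (x \<circ> swp j l)) / (x j - x l)))"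
    by (subst (asm) sum.swap) (simp add: sum_subtractf)
  moreover have "(c * u + d * (\<Sum>a\<in>A. u - b a)) + K * (c * s + d * (\<Sum>a\<in>A. s - t a))
    = c * (u + K * s) + d * (\<Sum>a\<in>A. (u + K * s) - (b a + K * t a))" for u s K :: complex and b t
    by (simp add: sum_subtractf sum.distrib sum_distrib_left algebra_simps)
  ultimately show ?B unfolding cdunkl_def by simp
qed

lemma pairing_fun_upd: "pairing (x(i := t)) y = pairing x y + (t - x i) * y i"
proof -
  have "pairing (x(i := t)) y - pairing x y = (\<Sum>j\<in>UNIV. if j = i then (t - x i) * y i else 0)"
    unfolding pairing_def sum_subtractf[symmetric] by (intro sum.cong) (auto simp: algebra_simps)
  then show ?thesis by (simp add: algebra_simps)
qed

text \<open>The factor \<open>x a - x b\<close> is the denominator of the Dunkl quotient and cancels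
  against it in \<open>cdunkl_pairing_mult\<close>.\<close>

lemma pairing_swp: "pairing x y - pairing (x \<circ> swp a b) y = (x a - x b) * (y a - y b)"
proof (cases "a = b")
  case False
  have "x \<circ> swp a b = (x(a := x b))(b := x a)"
    using False by (auto simp: fun_eq_iff Transposition.transpose_def)
  then show ?thesis using False by (simp add: pairing_fun_upd algebra_simps)
qed simp

text \<open>The derivative obeys the product rule. The difference part misses it by (y_j - y_l)
  times the swapped value of p, by \<open>pairing_swp\<close>; distinct coordinates allow x_j - x_l
  to be cancelled.\<close>

lemma cdunkl_pairing_mult:
  assumes "coordinate_differentiable p" "inj x"
  shows "coordinate_differentiable (\<lambda>x. pairing x y * p x)" (is ?A)
    and "cdunkl k j (\<lambda>x. pairing x y * p x) x = pairing x y * cdunkl k j p x + y j * p x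
      + k * (\<Sum>l\<in>UNIV. (y j - y l) * p (x \<circ> swp j l))" (is ?B)
proof -
  have D: "((\<lambda>t. pairing (x(i := t)) y * p (x(i := t))) has_field_derivative (y i * p x + pairing x y * cpartial i p x)) (at (x i))" for x i
    unfolding pairing_fun_upd
    by (rule derivative_eq_intros coordinate_differentiableD[OF assms(1)] refl | simp)+
  show ?A unfolding coordinate_differentiable_def field_differentiable_def using D by blast
  have "cpartial j (\<lambda>x. pairing x y * p x) x = y j * p x + pairing x y * cpartial j p x"
    unfolding cpartial_def[of j "\<lambda>x. pairing x y * p x"] by (rule DERIV_imp_deriv[OF D])
  moreover have "(\<Sum>l\<in>UNIV. (pairing x y * p x - pairing (x \<circ> swp j l) y * p (x \<circ> swp j l)) / (x j - x l))
     = pairing x y * (\<Sum>l\<in>UNIV. (p x - p (x \<circ> swp j l)) / (x j - x l)) + (\<Sum>l\<in>UNIV. (y j - y l) * p (x \<circ> swp j l))"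
    unfolding sum_distrib_left sum.distrib[symmetric]
  proof (rule sum.cong)
    fix l
    show "(pairing x y * p x - pairing (x \<circ> swp j l) y * p (x \<circ> swp j l)) / (x j - x l)
      = pairing x y * ((p x - p (x \<circ> swp j l)) / (x j - x l)) + (y j - y l) * p (x \<circ> swp j l)"
    proof (cases "l = j")
      case False
      then have "x j - x l \<noteq> 0" using assms(2) by (auto dest: injD)
      moreover have "pairing (x \<circ> swp j l) y = pairing x y - (x j - x l) * (y j - y l)"
        using pairing_swp[of x y j l] by (simp add: algebra_simps)
      ultimately show ?thesis by (simp only:) (simp add: field_simps)
    qed simp
  qed simp
  ultimately show ?B
    by (simp only: cdunkl_def) (simp only: algebra_simps)
qed

text \<open>A pair contributes only if a = j or b = j, and the two kinds give equal sums.\<close>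

lemma sum_swp_index:
  fixes y :: "'n::finite \<Rightarrow> complex"
  shows "(\<Sum>(a,b)\<in>UNIV. (y j - y (swp a b j)) * q (swp a b)) = 2 * (\<Sum>l\<in>UNIV. (y j - y l) * q (swp j l))"
proof -
  have "(\<Sum>(a,b)\<in>UNIV. (y j - y (swp a b j)) * q (swp a b)) =
    (\<Sum>a\<in>UNIV. \<Sum>b\<in>UNIV. (if a = j then (y j - y b) * q (swp j b) else 0) + (if b = j then (y j - y a) * q (swp j a) else 0))"
    unfolding UNIV_Times_UNIV[symmetric] sum.cartesian_product[symmetric]
    by (intro sum.cong) (auto simp: Transposition.transpose_def transpose_commute)
  also have "\<dots> = (\<Sum>b\<in>UNIV. \<Sum>a\<in>UNIV. if a = j then (y j - y b) * q (swp j b) else 0) + (\<Sum>a\<in>UNIV. (y j - y a) * q (swp j a))"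
    unfolding sum.distrib by (subst (1) sum.swap) simp
  finally show ?thesis by simp
qed

context
  fixes k :: real
  assumes k_pos: "k > 0"
begin

text \<open>The recursion evaluates at \<open>x \<circ> \<pi>\<close>, where one coordinate of x may
  occur several times. Affine lines, unlike changes of a single coordinate, are preserved by this,
  so the induction runs over lines.\<close>

lemma hom_kernel_line_holomorphic:
  "(\<lambda>t. hom_kernel k m (\<lambda>i. a i + t * b i) y) holomorphic_on UNIV"
proof (induction m arbitrary: a b)
  case (Suc m)
  have "(\<lambda>t. hom_kernel k m ((\<lambda>i. a i + t * b i) \<circ> \<pi>) y) holomorphic_on UNIV" for \<pi>
    using Suc[of "a \<circ> \<pi>" "b \<circ> \<pi>"] by (simp add: comp_def)
  moreover have "(\<lambda>t. pairing ((\<lambda>i. a i + t * b i) \<circ> \<pi>) y) holomorphic_on UNIV" for \<pi>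
    unfolding pairing_def comp_def by (intro holomorphic_intros)
  ultimately show ?case unfolding hom_kernel.simps by (intro holomorphic_intros) auto
qed simp

lemma fun_upd_eq_line: "x(i := t) = (\<lambda>l. (x(i := 0)) l + t * (if l = i then 1 else 0))" for x :: "'n \<Rightarrow> complex"
  by (auto simp: fun_eq_iff)

lemma hom_kernel_coordinate_differentiable: "coordinate_differentiable (\<lambda>x. hom_kernel k m x y)"
  unfolding coordinate_differentiable_def
proof (intro allI)
  fix x i
  show "(\<lambda>t. hom_kernel k m (x(i := t)) y) field_differentiable at (x i)"
    using hom_kernel_line_holomorphic[of m "x(i := 0)" "\<lambda>l. if l = i then 1 else 0" y]
    unfolding fun_upd_eq_line[symmetric] by (auto simp: holomorphic_on_def)
qed

lemma cdunkl_laplacian: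
  assumes "coordinate_differentiable f"
  shows "cdunkl k j (\<lambda>x. c * f x + d * laplacian f x) x =
    c * cdunkl k j f x + d * (\<Sum>(a,b)\<in>UNIV. cdunkl k j f x - cdunkl k (swp a b j) f (x \<circ> swp a b))"
  using cdunkl_linear(2)[where f = f and A = UNIV and c = c and d = d and k = k and j = j and x = x and g = "\<lambda>ab x. f (x \<circ> swp (fst ab) (snd ab))"]
    assms coordinate_differentiable_swp[OF assms]
  by (simp add: laplacian_def case_prod_unfold cdunkl_swp)

text \<open>Let g(j, x) = T_j q - y_j p be the defect. Applying T_j to the recursion for q, and
  using the induction hypothesis and the recursion for p on the right, gives (m + 1) g plus k / 2
  times the sum of the differences g(j, x) - g(\<sigma> j, x \<sigma>), equal to 0. A swap carries
  T_j to another operator, so index and point must move together.\<close>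

lemma cdunkl_hom_kernel:
  fixes x y :: "'n::finite \<Rightarrow> complex"
  assumes "inj x"
  shows "cdunkl k j (\<lambda>x. hom_kernel k (Suc m) x y) x = y j * hom_kernel k m x y"
  using assms
proof (induction m arbitrary: x j rule: less_induct)
  case IH: (less m)
  define p q where "p = (\<lambda>x. hom_kernel k m x y)" and "q = (\<lambda>x. hom_kernel k (Suc m) x y)"
  \<comment> \<open>The induction hypothesis multiplied by the pairing, with the recursion for p
    inserted. For m = 0 both sides vanish.\<close>
  have IH': "pairing x y * cdunkl k j p x = y j * (of_nat m * p x + of_real (k/2) * laplacian p x)" if "inj x" for x j
  proof (cases m)
    case 0
    then have "p = (\<lambda>x. 1)" by (auto simp: p_def)
    then show ?thesis using 0 by (simp add: cdunkl_def cpartial_def laplacian_def)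
  next
    case (Suc m')
    have "cdunkl k j p x = y j * hom_kernel k m' x y"
      using IH.IH[of m' x j] Suc that by (simp add: p_def)
    then have "pairing x y * cdunkl k j p x = y j * (pairing x y * hom_kernel k m' x y)" by simp
    also have "\<dots> = y j * (of_nat m * p x + of_real (k/2) * laplacian p x)"
      using hom_kernel_laplacian[OF k_pos, where m = m' and x = x and y = y] by (simp only: p_def Suc)
    finally show ?thesis .
  qed
  have cd: "coordinate_differentiable p" "coordinate_differentiable q"
    unfolding p_def q_def by (intro hom_kernel_coordinate_differentiable)+
  have q_eq: "(\<lambda>x. of_nat (Suc m) * q x + of_real (k/2) * laplacian q x) = (\<lambda>x. pairing x y * p x)"
    unfolding p_def q_def fun_eq_iff using hom_kernel_laplacian[OF k_pos, where m = m and y = y] by blast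
  define g where "g = (\<lambda>(j, x). cdunkl k j q x - y j * p x)"
  let ?s = "\<lambda>(a :: 'n,b) (j, x :: 'n \<Rightarrow> complex). (swp a b j, x \<circ> swp a b)"
  have "g (j, x) = 0"
  proof (rule max_principle_zero[where X = "(UNIV :: 'n set) \<times> {x \<circ> \<pi> |\<pi> :: 'n \<Rightarrow> 'n. bij \<pi>}" and A = UNIV and m = "real (Suc m)" and k = "k/2"
      and s = ?s and h = g])
    fix jx assume jx: "jx \<in> (UNIV :: 'n set) \<times> {x \<circ> \<pi> |\<pi> :: 'n \<Rightarrow> 'n. bij \<pi>}"
    obtain j u where u: "jx = (j, u)" by (cases jx)
    then have "inj u" using jx IH.prems by (auto simp: bij_is_inj intro!: inj_compose)
    have "of_nat (Suc m) * cdunkl k j q u + of_real (k/2) * (\<Sum>(a,b)\<in>UNIV. cdunkl k j q u - cdunkl k (swp a b j) q (u \<circ> swp a b))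
      = cdunkl k j (\<lambda>x. pairing x y * p x) u"
      unfolding cdunkl_laplacian[OF cd(2), symmetric] q_eq ..
    also have "\<dots> = y j * (of_nat m * p u + of_real (k/2) * laplacian p u) + y j * p u
      + k * (\<Sum>l\<in>UNIV. (y j - y l) * p (u \<circ> swp j l))"
      unfolding cdunkl_pairing_mult(2)[OF cd(1) \<open>inj u\<close>] IH'[OF \<open>inj u\<close>] ..
    also have "k * (\<Sum>l\<in>UNIV. (y j - y l) * p (u \<circ> swp j l)) =
      of_real (k/2) * (\<Sum>(a,b)\<in>UNIV. (y j - y (swp a b j)) * p (u \<circ> swp a b))"
      using sum_swp_index[of y j "\<lambda>\<sigma>. p (u \<circ> \<sigma>)"] by simp
    finally have "of_nat (Suc m) * cdunkl k j q u + of_real (k/2) * (\<Sum>(a,b)\<in>UNIV. cdunkl k j q u - cdunkl k (swp a b j) q (u \<circ> swp a b))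
       = of_nat (Suc m) * (y j * p u) + of_real (k/2) * (y j * laplacian p u + (\<Sum>(a,b)\<in>UNIV. (y j - y (swp a b j)) * p (u \<circ> swp a b)))"
      by (simp only: of_nat_Suc mult_1_left algebra_simps)
    also have "y j * laplacian p u + (\<Sum>(a,b)\<in>UNIV. (y j - y (swp a b j)) * p (u \<circ> swp a b))
      = (\<Sum>(a,b)\<in>UNIV. y j * p u - y (swp a b j) * p (u \<circ> swp a b))"
      unfolding laplacian_def sum_distrib_left sum.distrib[symmetric] by (intro sum.cong) (auto simp: algebra_simps)
    finally have "of_nat (Suc m) * g (j,u) + of_real (k/2) *
        ((\<Sum>(a,b)\<in>UNIV. cdunkl k j q u - cdunkl k (swp a b j) q (u \<circ> swp a b)) -
         (\<Sum>(a,b)\<in>UNIV. y j * p u - y (swp a b j) * p (u \<circ> swp a b))) = 0"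
      by (simp only: g_def prod.case of_nat_Suc mult_1_left add_0_left algebra_simps)
    also have "(\<Sum>(a,b)\<in>UNIV. cdunkl k j q u - cdunkl k (swp a b j) q (u \<circ> swp a b)) -
         (\<Sum>(a,b)\<in>UNIV. y j * p u - y (swp a b j) * p (u \<circ> swp a b)) = (\<Sum>a\<in>UNIV. g (j,u) - g (?s a (j,u)))"
      unfolding sum_subtractf[symmetric] by (intro sum.cong) (auto simp: g_def algebra_simps)
    finally show "real (Suc m) *\<^sub>R g jx + (k/2) *\<^sub>R (\<Sum>a\<in>UNIV. g jx - g (?s a jx)) = 0"
      by (simp add: u scaleR_conv_of_real)
  next
    show "(j, x) \<in> (UNIV :: 'n set) \<times> {x \<circ> \<pi> |\<pi> :: 'n \<Rightarrow> 'n. bij \<pi>}" by (auto intro!: exI[of _ id])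
  next
    fix jx a assume "jx \<in> (UNIV :: 'n set) \<times> {x \<circ> \<pi> |\<pi> :: 'n \<Rightarrow> 'n. bij \<pi>}"
    then show "?s a jx \<in> (UNIV :: 'n set) \<times> {x \<circ> \<pi> |\<pi> :: 'n \<Rightarrow> 'n. bij \<pi>}"
      by (auto simp: case_prod_unfold comp_assoc) (rule exI, rule conjI[OF refl], intro bij_comp, auto)
  qed (use k_pos in auto)
  then show ?case by (simp add: g_def p_def q_def)
qed

end

section \<open>The Dunkl kernel\<close>

definition multi_power :: "('n::finite \<Rightarrow> complex) \<Rightarrow> ('n \<Rightarrow> nat) \<Rightarrow> complex" where
  "multi_power h \<alpha> = (\<Prod>i\<in>UNIV. h i ^ \<alpha> i)"

definition deg :: "('n::finite \<Rightarrow> nat) \<Rightarrow> nat" where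
  "deg \<alpha> = (\<Sum>i\<in>UNIV. \<alpha> i)"

lemma norm_multi_power_le:
  assumes "\<And>i. norm (h i) \<le> R"
  shows "norm (multi_power h \<alpha>) \<le> R ^ deg \<alpha>"
proof -
  have "R ^ deg \<alpha> = (\<Prod>i\<in>UNIV. R ^ \<alpha> i)" by (simp add: deg_def power_sum)
  then show ?thesis unfolding multi_power_def prod_norm[symmetric] norm_power
    using assms by (auto intro!: prod_mono power_mono)
qed

text \<open>A weighted l1 norm on coefficient families, tied to the sum of the series on the closed
  polydisc of radius R. Carrying the bound B through sums, multiples and multiplication by a
  coordinate is what later allows infinitely many homogeneous parts to be added.\<close>

definition power_series_bound :: "real \<Rightarrow> real \<Rightarrow> (('n::finite \<Rightarrow> complex) \<Rightarrow> complex) \<Rightarrow> (('n \<Rightarrow> nat) \<Rightarrow> complex) \<Rightarrow> bool" where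
  "power_series_bound R B f c \<longleftrightarrow>
     (\<lambda>\<alpha>. norm (c \<alpha>) * R ^ deg \<alpha>) summable_on UNIV \<and> infsum (\<lambda>\<alpha>. norm (c \<alpha>) * R ^ deg \<alpha>) UNIV \<le> B \<and>
     (\<forall>h. (\<forall>i. norm (h i) \<le> R) \<longrightarrow> ((\<lambda>\<alpha>. c \<alpha> * multi_power h \<alpha>) has_sum f h) UNIV)"

lemma power_series_bound_mono: "power_series_bound R B f c \<Longrightarrow> B \<le> B' \<Longrightarrow> power_series_bound R B' f c"
  by (auto simp: power_series_bound_def)

lemma power_series_bound_const:
  "power_series_bound R (norm a) (\<lambda>h. a) (\<lambda>\<alpha>. if \<alpha> = (\<lambda>_. 0) then a else 0)"
proof -
  let ?c = "\<lambda>\<alpha>. if \<alpha> = (\<lambda>_. 0) then a else 0"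
  have "((\<lambda>\<alpha>. norm (?c \<alpha>) * R ^ deg \<alpha>) has_sum norm a) UNIV"
    by (rule has_sum_finite_neutralI[of "{\<lambda>_. 0}"]) (auto simp: deg_def)
  moreover have "((\<lambda>\<alpha>. ?c \<alpha> * multi_power h \<alpha>) has_sum a) UNIV" for h
    by (rule has_sum_finite_neutralI[of "{\<lambda>_. 0}"]) (auto simp: multi_power_def)
  ultimately show ?thesis
    unfolding power_series_bound_def by (auto simp: infsumI summable_on_def)
qed

lemma power_series_bound_scale:
  assumes "power_series_bound R B f c"
  shows "power_series_bound R (norm a * B) (\<lambda>h. a * f h) (\<lambda>\<alpha>. a * c \<alpha>)"
  using assms unfolding power_series_bound_def norm_mult mult.assoc
  by (auto intro!: summable_on_cmult_right has_sum_cmult_right mult_left_mono simp: infsum_cmult_right)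

lemma power_series_bound_add:
  assumes f: "power_series_bound R B f c" and g: "power_series_bound R C g d" and "R \<ge> 0"
  shows "power_series_bound R (B + C) (\<lambda>h. f h + g h) (\<lambda>\<alpha>. c \<alpha> + d \<alpha>)"
proof -
  let ?F = "\<lambda>c \<alpha>. norm (c \<alpha>) * R ^ deg \<alpha>"
  have s: "(\<lambda>\<alpha>. ?F c \<alpha> + ?F d \<alpha>) summable_on UNIV"
    using f g unfolding power_series_bound_def by (auto intro!: summable_on_add)
  have le: "?F (\<lambda>\<alpha>. c \<alpha> + d \<alpha>) \<alpha> \<le> ?F c \<alpha> + ?F d \<alpha>" for \<alpha>
    using norm_triangle_ineq[of "c \<alpha>" "d \<alpha>"] \<open>R \<ge> 0\<close>
    by (simp add: mult_right_mono flip: distrib_right)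
  have s': "?F (\<lambda>\<alpha>. c \<alpha> + d \<alpha>) summable_on UNIV"
    by (rule summable_on_comparison_test[OF s]) (use le \<open>R \<ge> 0\<close> in auto)
  have "infsum (?F (\<lambda>\<alpha>. c \<alpha> + d \<alpha>)) UNIV \<le> infsum (\<lambda>\<alpha>. ?F c \<alpha> + ?F d \<alpha>) UNIV"
    by (rule infsum_mono[OF s' s]) (use le in auto)
  also have "\<dots> = infsum (?F c) UNIV + infsum (?F d) UNIV"
    using f g unfolding power_series_bound_def by (auto intro!: infsum_add)
  also have "\<dots> \<le> B + C" using f g unfolding power_series_bound_def by auto
  finally show ?thesis using s' f g unfolding power_series_bound_def
    by (auto simp: distrib_right intro!: has_sum_add)
qed

lemma power_series_bound_sum:
  assumes "finite A" "\<And>a. a \<in> A \<Longrightarrow> power_series_bound R (B a) (f a) (c a)" "R \<ge> 0"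
  shows "power_series_bound R (sum B A) (\<lambda>h. \<Sum>a\<in>A. f a h) (\<lambda>\<alpha>. \<Sum>a\<in>A. c a \<alpha>)"
  using assms
proof (induction A)
  case empty
  then show ?case using power_series_bound_const[of R 0] by simp
next
  case (insert a A)
  then show ?case by (simp add: power_series_bound_add)
qed

lemma power_series_bound_coordinate:
  fixes c :: "('n::finite \<Rightarrow> nat) \<Rightarrow> complex"
  assumes f: "power_series_bound R B f c" and "R \<ge> 0"
  shows "power_series_bound R (R * B) (\<lambda>h. h i * f h) (\<lambda>\<alpha>. if \<alpha> i = 0 then 0 else c (\<alpha>(i := \<alpha> i - 1)))"
    (is "power_series_bound _ _ _ ?c")
proof -
  \<comment> \<open>Multiplication by h_i shifts multi-indices by \<open>\<phi>\<close>; those with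
    exponent 0 at i lie outside its range and get coefficient 0.\<close>
  define \<phi> :: "('n \<Rightarrow> nat) \<Rightarrow> ('n \<Rightarrow> nat)" where "\<phi> = (\<lambda>\<alpha>. \<alpha>(i := Suc (\<alpha> i)))"
  have inj: "inj \<phi>" unfolding \<phi>_def by (rule injI) (metis fun_upd_apply fun_upd_triv fun_upd_upd nat.inject)
  have mem: "\<alpha> \<in> range \<phi>" if "\<alpha> i \<noteq> 0" for \<alpha>
    by (rule range_eqI[of _ _ "\<alpha>(i := \<alpha> i - 1)"]) (use that in \<open>auto simp: \<phi>_def\<close>)
  have range: "(g has_sum s) UNIV \<longleftrightarrow> (g \<circ> \<phi> has_sum s) UNIV" if "\<And>\<alpha>. \<alpha> i = 0 \<Longrightarrow> g \<alpha> = 0" for g s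
  proof -
    have "(g has_sum s) UNIV \<longleftrightarrow> (g has_sum s) (range \<phi>)"
      by (rule has_sum_cong_neutral) (use that mem in auto)
    then show ?thesis using has_sum_reindex[OF inj] by blast
  qed
  have deg: "deg (\<phi> \<alpha>) = Suc (deg \<alpha>)" for \<alpha>
    unfolding deg_def \<phi>_def by (subst (1 2) sum.remove[of _ i]) auto
  have mp: "multi_power h (\<phi> \<alpha>) = h i * multi_power h \<alpha>" for h \<alpha>
    unfolding multi_power_def \<phi>_def by (subst (1 2) prod.remove[of _ i]) auto
  have "((\<lambda>\<alpha>. norm (c \<alpha>) * R ^ deg \<alpha>) has_sum infsum (\<lambda>\<alpha>. norm (c \<alpha>) * R ^ deg \<alpha>) UNIV) UNIV"
    using f unfolding power_series_bound_def by (auto intro: has_sum_infsum)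
  then have "((\<lambda>\<alpha>. R * (norm (c \<alpha>) * R ^ deg \<alpha>)) has_sum R * infsum (\<lambda>\<alpha>. norm (c \<alpha>) * R ^ deg \<alpha>) UNIV) UNIV"
    by (rule has_sum_cmult_right)
  also have "(\<lambda>\<alpha>. R * (norm (c \<alpha>) * R ^ deg \<alpha>)) = (\<lambda>\<alpha>. norm (?c \<alpha>) * R ^ deg \<alpha>) \<circ> \<phi>"
    by (auto simp: fun_eq_iff deg) (auto simp: \<phi>_def)
  finally have "((\<lambda>\<alpha>. norm (?c \<alpha>) * R ^ deg \<alpha>) has_sum R * infsum (\<lambda>\<alpha>. norm (c \<alpha>) * R ^ deg \<alpha>) UNIV) UNIV"
    by (subst range) (simp_all add: comp_def)
  then have 1: "(\<lambda>\<alpha>. norm (?c \<alpha>) * R ^ deg \<alpha>) summable_on UNIV \<and> infsum (\<lambda>\<alpha>. norm (?c \<alpha>) * R ^ deg \<alpha>) UNIV \<le> R * B"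
    using f \<open>R \<ge> 0\<close> unfolding power_series_bound_def by (auto simp: summable_on_def infsumI intro!: mult_left_mono)
  have 2: "((\<lambda>\<alpha>. ?c \<alpha> * multi_power h \<alpha>) has_sum h i * f h) UNIV" if "\<forall>i. norm (h i) \<le> R" for h
  proof -
    have "((\<lambda>\<alpha>. h i * (c \<alpha> * multi_power h \<alpha>)) has_sum h i * f h) UNIV"
      using f that unfolding power_series_bound_def by (intro has_sum_cmult_right) auto
    also have "(\<lambda>\<alpha>. h i * (c \<alpha> * multi_power h \<alpha>)) = (\<lambda>\<alpha>. ?c \<alpha> * multi_power h \<alpha>) \<circ> \<phi>"
      by (auto simp: fun_eq_iff mp) (auto simp: \<phi>_def)
    finally show ?thesis by (subst range) (simp_all add: comp_def)
  qed
  show ?thesis unfolding power_series_bound_def using 1 2 by blast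
qed

text \<open>Coefficients are summed over m for each multi-index. The interchanges of summation rest
  on absolute summability of the double family over m and the multi-indices, whose total is at most
  the sum of the B m.\<close>

lemma power_series_bound_series:
  fixes f :: "nat \<Rightarrow> ('n::finite \<Rightarrow> complex) \<Rightarrow> complex"
  assumes f: "\<And>m. power_series_bound R (B m) (f m) (c m)" and B: "summable B" and "R \<ge> 0"
  shows "\<exists>c. power_series_bound R (suminf B) (\<lambda>h. \<Sum>m. f m h) c"
proof -
  let ?N = "\<lambda>m \<alpha>. norm (c m \<alpha>) * R ^ deg \<alpha>"
  have sm: "?N m summable_on UNIV" and im: "infsum (?N m) UNIV \<le> B m" and
     hs: "(\<forall>i. norm (h i) \<le> R) \<Longrightarrow> ((\<lambda>\<alpha>. c m \<alpha> * multi_power h \<alpha>) has_sum f m h) UNIV" for m h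
    using f[of m] unfolding power_series_bound_def by auto
  have B0: "B m \<ge> 0" for m using im[of m] infsum_nonneg[of UNIV "?N m"] \<open>R \<ge> 0\<close> by (auto intro: order_trans)
  have Bs: "(B has_sum suminf B) UNIV"
    using norm_summable_imp_has_sum[of B] B B0 by (auto simp: summable_sums)
  have iS: "(\<lambda>m. infsum (?N m) UNIV) summable_on UNIV"
    by (rule summable_on_comparison_test[of B]) (use Bs im \<open>R \<ge> 0\<close> in \<open>auto simp: summable_on_def intro!: infsum_nonneg\<close>)
  have S: "(\<lambda>(m, \<alpha>). ?N m \<alpha>) summable_on UNIV \<times> UNIV"
  proof -
    have "(\<lambda>p. norm ((\<lambda>(m, \<alpha>). ?N m \<alpha>) p)) summable_on UNIV \<times> UNIV"
      unfolding Infinite_Sum.abs_summable_on_Sigma_iff using sm iS \<open>R \<ge> 0\<close>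
      by (auto simp: infsum_nonneg)
    then show ?thesis using abs_summable_summable by blast
  qed
  have S2: "(\<lambda>(\<alpha>, m). ?N m \<alpha>) summable_on UNIV \<times> UNIV"
    using summable_on_swap[of "\<lambda>(m, \<alpha>). ?N m \<alpha>" UNIV UNIV] S by (simp add: case_prod_unfold comp_def)
  then have S3: "(\<lambda>\<alpha>. infsum (\<lambda>m. ?N m \<alpha>) UNIV) summable_on UNIV"
    and S4: "(\<lambda>m. ?N m \<alpha>) summable_on UNIV" for \<alpha>
    using summable_on_Sigma_banach[of "\<lambda>\<alpha> m. ?N m \<alpha>" UNIV "\<lambda>_. UNIV"]
      summable_on_SigmaD1[of "\<lambda>\<alpha> m. ?N m \<alpha>" UNIV "\<lambda>_. UNIV"] by auto
  \<comment> \<open>For R = 0 the majorants say nothing about coefficients of positive degree. They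
    are set to 0, which is harmless because h = 0 is then the only admissible point.\<close>
  define d where "d \<alpha> = (if R = 0 \<and> deg \<alpha> > 0 then 0 else infsum (\<lambda>m. c m \<alpha>) UNIV)" for \<alpha>
  have nd: "norm (d \<alpha>) * R ^ deg \<alpha> \<le> infsum (\<lambda>m. ?N m \<alpha>) UNIV" for \<alpha>
  proof (cases "R = 0 \<and> deg \<alpha> > 0")
    case True
    then show ?thesis by (simp add: d_def infsum_nonneg)
  next
    case False
    then have p: "R ^ deg \<alpha> > 0" using \<open>R \<ge> 0\<close> by (cases "R = 0") auto
    then have p': "R ^ deg \<alpha> \<noteq> 0" by (metis less_irrefl)
    have "(\<lambda>m. norm (c m \<alpha>)) summable_on UNIV"
      using S4[of \<alpha>] by (simp only: summable_on_cmult_left'[OF p'])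
    then have "norm (d \<alpha>) * R ^ deg \<alpha> \<le> infsum (\<lambda>m. norm (c m \<alpha>)) UNIV * R ^ deg \<alpha>"
      unfolding d_def if_not_P[OF False] using p by (intro mult_right_mono norm_infsum_bound) auto
    also have "\<dots> = infsum (\<lambda>m. ?N m \<alpha>) UNIV"
      using p by (subst infsum_cmult_left') auto
    finally show ?thesis .
  qed
  have sd: "(\<lambda>\<alpha>. norm (d \<alpha>) * R ^ deg \<alpha>) summable_on UNIV"
    by (rule summable_on_comparison_test[OF S3]) (use nd \<open>R \<ge> 0\<close> in auto)
  have "infsum (\<lambda>\<alpha>. norm (d \<alpha>) * R ^ deg \<alpha>) UNIV \<le> infsum (\<lambda>\<alpha>. infsum (\<lambda>m. ?N m \<alpha>) UNIV) UNIV"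
    by (rule infsum_mono[OF sd S3]) (use nd in auto)
  also have "\<dots> = infsum (\<lambda>m. infsum (?N m) UNIV) UNIV"
    by (rule infsum_swap_banach[OF S2])
  also have "\<dots> \<le> infsum B UNIV"
    by (rule infsum_mono[OF iS]) (use Bs im in \<open>auto simp: summable_on_def\<close>)
  also have "\<dots> = suminf B" using Bs by (rule infsumI)
  finally have id: "infsum (\<lambda>\<alpha>. norm (d \<alpha>) * R ^ deg \<alpha>) UNIV \<le> suminf B" .
  have "((\<lambda>\<alpha>. d \<alpha> * multi_power h \<alpha>) has_sum (\<Sum>m. f m h)) UNIV" if h: "\<forall>i. norm (h i) \<le> R" for h
  proof -
    have le: "norm (c m \<alpha> * multi_power h \<alpha>) \<le> ?N m \<alpha>" for m \<alpha>
      unfolding norm_mult using norm_multi_power_le[of h R] h by (intro mult_left_mono) auto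
    have "(\<lambda>p. norm ((\<lambda>(\<alpha>, m). c m \<alpha> * multi_power h \<alpha>) p)) summable_on UNIV \<times> UNIV"
      by (rule summable_on_comparison_test[OF S2]) (use le in auto)
    then have T: "(\<lambda>(\<alpha>, m). c m \<alpha> * multi_power h \<alpha>) summable_on UNIV \<times> UNIV"
      by (rule abs_summable_summable)
    have dm: "d \<alpha> * multi_power h \<alpha> = infsum (\<lambda>m. c m \<alpha> * multi_power h \<alpha>) UNIV" for \<alpha>
    proof (cases "R = 0 \<and> deg \<alpha> > 0")
      case True
      then have "multi_power h \<alpha> = 0" using norm_multi_power_le[of h R \<alpha>] h by (auto simp: power_0_left split: if_splits)
      then show ?thesis by simp
    next
      case False
      then show ?thesis by (cases "multi_power h \<alpha> = 0") (auto simp: d_def infsum_cmult_left')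
    qed
    have "(\<lambda>\<alpha>. d \<alpha> * multi_power h \<alpha>) summable_on UNIV"
      unfolding dm using summable_on_Sigma_banach[of "\<lambda>\<alpha> m. c m \<alpha> * multi_power h \<alpha>" UNIV "\<lambda>_. UNIV"] T by simp
    moreover have "infsum (\<lambda>\<alpha>. d \<alpha> * multi_power h \<alpha>) UNIV = (\<Sum>m. f m h)"
    proof -
      have fm: "norm (f m h) \<le> B m" for m
      proof -
        have 1: "f m h = infsum (\<lambda>\<alpha>. c m \<alpha> * multi_power h \<alpha>) UNIV" by (rule infsumI[OF hs[OF h], symmetric])
        have 2: "(\<lambda>\<alpha>. norm (c m \<alpha> * multi_power h \<alpha>)) summable_on UNIV"
          by (rule summable_on_comparison_test[OF sm[of m]]) (use le in auto)
        have "norm (f m h) \<le> infsum (?N m) UNIV"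
          unfolding 1 by (rule order_trans[OF norm_infsum_bound[OF 2]], rule infsum_mono[OF 2 sm]) (use le in auto)
        then show ?thesis using im[of m] by simp
      qed
      have ns: "summable (\<lambda>m. norm (f m h))" by (rule summable_comparison_test[OF _ B]) (use fm in auto)
      have "infsum (\<lambda>\<alpha>. d \<alpha> * multi_power h \<alpha>) UNIV = infsum (\<lambda>m. infsum (\<lambda>\<alpha>. c m \<alpha> * multi_power h \<alpha>) UNIV) UNIV"
        unfolding dm by (rule infsum_swap_banach[OF T])
      also have "\<dots> = infsum (\<lambda>m. f m h) UNIV" by (simp only: infsumI[OF hs[OF h]])
      also have "\<dots> = (\<Sum>m. f m h)"
        by (intro infsumI norm_summable_imp_has_sum ns summable_sums summable_norm_cancel[OF ns])
      finally show ?thesis .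
    qed
    ultimately show ?thesis by (simp add: has_sum_iff)
  qed
  then show ?thesis using sd id unfolding power_series_bound_def by blast
qed

text \<open>Terms of degree at least 2 gain a factor (s / R)^2 when the radius shrinks from R to s;
  the constant and linear terms, indexed by \<open>A\<close>, are split off. As d and K do not
  depend on h, this is a uniform first-order expansion, and it is how analyticity enters the
  directional derivatives below.\<close>

lemma power_series_quadratic:
  fixes c :: "('n::finite \<Rightarrow> nat) \<Rightarrow> complex"
  assumes "R > 0" and sm: "(\<lambda>\<alpha>. norm (c \<alpha>) * R ^ deg \<alpha>) summable_on UNIV"
  shows "\<exists>d K. \<forall>s h S. 0 \<le> s \<longrightarrow> s \<le> R \<longrightarrow> (\<forall>i. norm (h i) \<le> s) \<longrightarrow> ((\<lambda>\<alpha>. c \<alpha> * multi_power h \<alpha>) has_sum S) UNIV \<longrightarrow>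
      norm (S - c (\<lambda>_. 0) - (\<Sum>i\<in>UNIV. d i * h i)) \<le> K * s\<^sup>2"
proof -
  define e :: "'n \<Rightarrow> 'n \<Rightarrow> nat" where "e = (\<lambda>i. (\<lambda>_. 0)(i := 1))"
  have inj: "inj e" unfolding e_def by (rule injI) (metis fun_upd_apply zero_neq_one)
  define A where "A = insert (\<lambda>_. 0) (range e)"
  have deg2: "deg \<alpha> \<ge> 2" if "\<alpha> \<notin> A" for \<alpha>
  proof (rule ccontr)
    assume "\<not> deg \<alpha> \<ge> 2"
    then consider "deg \<alpha> = 0" | "deg \<alpha> = 1" by linarith
    then show False
    proof cases
      case 1
      then have "\<alpha> = (\<lambda>_. 0)" by (auto simp: deg_def fun_eq_iff)
      then show ?thesis using that by (auto simp: A_def)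
    next
      case 2
      then obtain i where i: "\<alpha> i = 1" "\<And>j. j \<noteq> i \<Longrightarrow> \<alpha> j = 0"
        using sum_eq_1_iff[of UNIV \<alpha>] unfolding deg_def by auto
      then have "\<alpha> = e i" by (auto simp: e_def fun_eq_iff)
      then show ?thesis using that by (auto simp: A_def)
    qed
  qed
  define K where "K = infsum (\<lambda>\<alpha>. norm (c \<alpha>) * R ^ deg \<alpha>) UNIV / R\<^sup>2"
  have mp: "multi_power h (e i) = h i" for h i
    unfolding multi_power_def e_def by (subst prod.remove[of _ i]) auto
  have "norm (S - c (\<lambda>_. 0) - (\<Sum>i\<in>UNIV. c (e i) * h i)) \<le> K * s\<^sup>2"
    if s: "0 \<le> s" "s \<le> R" and h: "\<forall>i. norm (h i) \<le> s" and S: "((\<lambda>\<alpha>. c \<alpha> * multi_power h \<alpha>) has_sum S) UNIV" for s h S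
  proof -
    have "(\<Sum>\<alpha>\<in>A. c \<alpha> * multi_power h \<alpha>) = c (\<lambda>_. 0) + (\<Sum>i\<in>UNIV. c (e i) * h i)"
    proof -
      have n: "(\<lambda>_. 0) \<noteq> e i" for i by (metis e_def fun_upd_same zero_neq_one)
      have z: "multi_power h (\<lambda>_. 0) = 1" by (simp add: multi_power_def)
      show ?thesis unfolding A_def using n by (subst sum.insert) (auto simp: sum.reindex[OF inj] mp z)
    qed
    moreover have "((\<lambda>\<alpha>. c \<alpha> * multi_power h \<alpha>) has_sum (S - (\<Sum>\<alpha>\<in>A. c \<alpha> * multi_power h \<alpha>))) (UNIV - A)"
      by (rule has_sum_Diff[OF S]) (auto simp: A_def intro!: has_sum_finite)
    ultimately have T: "((\<lambda>\<alpha>. c \<alpha> * multi_power h \<alpha>) has_sum (S - c (\<lambda>_. 0) - (\<Sum>i\<in>UNIV. c (e i) * h i))) (UNIV - A)"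
      by (simp add: algebra_simps)
    have le: "norm (c \<alpha> * multi_power h \<alpha>) \<le> (s\<^sup>2 / R\<^sup>2) * (norm (c \<alpha>) * R ^ deg \<alpha>)" if "\<alpha> \<in> UNIV - A" for \<alpha>
    proof -
      obtain p where p: "deg \<alpha> = 2 + p" using deg2[of \<alpha>] \<open>\<alpha> \<in> UNIV - A\<close> le_Suc_ex by blast
      have "norm (multi_power h \<alpha>) \<le> s\<^sup>2 * s ^ p" using norm_multi_power_le[of h s \<alpha>] h by (simp only: p power_add)
      also have "\<dots> \<le> s\<^sup>2 * R ^ p" using s by (intro mult_left_mono power_mono) auto
      also have "\<dots> = (s\<^sup>2 / R\<^sup>2) * R ^ deg \<alpha>" using \<open>R > 0\<close> by (simp only: p power_add) simp
      finally show ?thesis unfolding norm_mult by (metis mult.left_commute mult_left_mono norm_ge_zero)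
    qed
    have sm': "(\<lambda>\<alpha>. (s\<^sup>2 / R\<^sup>2) * (norm (c \<alpha>) * R ^ deg \<alpha>)) summable_on UNIV - A"
      by (intro summable_on_cmult_right summable_on_subset_banach[OF sm]) auto
    have ab: "(\<lambda>\<alpha>. norm (c \<alpha> * multi_power h \<alpha>)) summable_on (UNIV - A)"
      by (rule summable_on_comparison_test[OF sm']) (use le in auto)
    have "norm (S - c (\<lambda>_. 0) - (\<Sum>i\<in>UNIV. c (e i) * h i)) \<le> infsum (\<lambda>\<alpha>. norm (c \<alpha> * multi_power h \<alpha>)) (UNIV - A)"
      using norm_infsum_bound[OF ab] infsumI[OF T] by simp
    also have "\<dots> \<le> infsum (\<lambda>\<alpha>. (s\<^sup>2 / R\<^sup>2) * (norm (c \<alpha>) * R ^ deg \<alpha>)) (UNIV - A)"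
      by (rule infsum_mono[OF ab sm' le])
    also have "\<dots> \<le> infsum (\<lambda>\<alpha>. (s\<^sup>2 / R\<^sup>2) * (norm (c \<alpha>) * R ^ deg \<alpha>)) UNIV"
      by (rule infsum_mono_neutral[OF sm' summable_on_cmult_right[OF sm]]) (use \<open>R > 0\<close> s in auto)
    also have "\<dots> = K * s\<^sup>2" by (subst infsum_cmult_right') (simp add: K_def)
    finally show ?thesis .
  qed
  then show ?thesis by (intro exI[of _ "\<lambda>i. c (e i)"] exI[of _ K]) blast
qed

lemma has_derivative_at_0_quadratic:
  fixes F :: "'a::real_normed_vector \<Rightarrow> 'b::real_normed_vector"
  assumes "bounded_linear L" "\<delta> > 0" "\<And>t. norm t \<le> \<delta> \<Longrightarrow> norm (F t - F 0 - L t) \<le> K * (norm t)\<^sup>2"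
  shows "(F has_derivative L) (at 0)"
proof (rule has_derivativeI_sandwich[where e = \<delta> and H = "\<lambda>y. K * norm y"])
  fix y :: 'a assume "y \<noteq> 0" "dist y 0 < \<delta>"
  then show "norm (F y - F 0 - L (y - 0)) / norm (y - 0) \<le> K * norm y"
    using assms(3)[of y] by (simp add: divide_simps power2_eq_square)
qed (use assms in \<open>auto intro!: tendsto_eq_intros\<close>)

context
  fixes k :: real
  assumes k_pos: "k > 0"
begin

text \<open>The map \<open>\<tau>\<close> makes the induction possible: the recursion composes base
  point and increment with the same \<open>\<pi>\<close>. The bound is that of
  \<open>norm_hom_kernel_le\<close> with A + R in place of X.\<close>

lemma hom_kernel_power_series:
  fixes y :: "'n::finite \<Rightarrow> complex" and A R Y :: real
  assumes "R \<ge> 0" and y: "\<And>i. norm (y i) \<le> Y" and a: "\<And>i. norm (a i) \<le> A"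
  shows "\<exists>c. power_series_bound R ((CARD('n) * ((A + R) * Y)) ^ m / fact m) (\<lambda>h. hom_kernel k m (\<lambda>i. a i + h (\<tau> i)) y) c"
  using a
proof (induction m arbitrary: a \<tau>)
  case 0
  then show ?case using power_series_bound_const[of R 1] by auto
next
  case (Suc m)
  have Y: "Y \<ge> 0" and A: "A \<ge> 0" using y[of undefined] Suc.prems[of undefined] norm_ge_zero order_trans by blast+
  define B where "B = (CARD('n) * ((A + R) * Y)) ^ m / fact m"
  have B: "B \<ge> 0" using A Y \<open>R \<ge> 0\<close> by (simp add: B_def)
  define F where "F = (\<lambda>\<pi> :: 'n \<Rightarrow> 'n. \<lambda>h. hom_kernel k m (\<lambda>i. (a \<circ> \<pi>) i + h ((\<tau> \<circ> \<pi>) i)) y)"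
  have "\<exists>c. power_series_bound R B (F \<pi>) c" for \<pi>
    unfolding B_def F_def by (rule Suc.IH) (use Suc.prems in auto)
  then have "\<exists>c. \<forall>\<pi>. power_series_bound R B (F \<pi>) (c \<pi>)" by (intro choice allI)
  then obtain c where c': "\<forall>\<pi>. power_series_bound R B (F \<pi>) (c \<pi>)" by (elim exE)
  note c = c'[rule_format]
  have "\<exists>d. power_series_bound R (Y * (A * B + R * B)) (\<lambda>h. y i * (a (\<pi> i) * F \<pi> h + h (\<tau> (\<pi> i)) * F \<pi> h)) d" for \<pi> i
  proof -
    have "power_series_bound R (norm (y i) * (norm (a (\<pi> i)) * B + R * B))
      (\<lambda>h. y i * (a (\<pi> i) * F \<pi> h + h (\<tau> (\<pi> i)) * F \<pi> h))
      (\<lambda>\<alpha>. y i * (a (\<pi> i) * c \<pi> \<alpha> + (if \<alpha> (\<tau> (\<pi> i)) = 0 then 0 else c \<pi> (\<alpha>(\<tau> (\<pi> i) := \<alpha> (\<tau> (\<pi> i)) - 1)))))"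
      by (rule power_series_bound_scale, rule power_series_bound_add, rule power_series_bound_scale, rule c, rule power_series_bound_coordinate, rule c, (rule assms(1))+)
    moreover have "norm (y i) * (norm (a (\<pi> i)) * B + R * B) \<le> Y * (A * B + R * B)"
      using A B Y \<open>R \<ge> 0\<close> by (intro mult_mono add_mono y Suc.prems) auto
    ultimately show ?thesis using power_series_bound_mono by blast
  qed
  then have "\<exists>d. \<forall>p. power_series_bound R (Y * (A * B + R * B)) (\<lambda>h. y (snd p) * (a (fst p (snd p)) * F (fst p) h + h (\<tau> (fst p (snd p))) * F (fst p) h)) (d p)"
    by (intro choice allI)
  then obtain D where D: "\<forall>p. power_series_bound R (Y * (A * B + R * B)) (\<lambda>h. y (snd p) * (a (fst p (snd p)) * F (fst p) h + h (\<tau> (fst p (snd p))) * F (fst p) h)) (D p)"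
    by (elim exE)
  define d where "d \<pi> i = D (\<pi>, i)" for \<pi> i
  have d: "power_series_bound R (Y * (A * B + R * B)) (\<lambda>h. y i * (a (\<pi> i) * F \<pi> h + h (\<tau> (\<pi> i)) * F \<pi> h)) (d \<pi> i)" for \<pi> i
    using D[rule_format, of "(\<pi>, i)"] unfolding d_def fst_conv snd_conv .
  have ps: "power_series_bound R (\<Sum>\<pi>\<in>UNIV. norm (complex_of_real (resolvent_coeff (k/2) (Suc m) (\<pi> :: 'n \<Rightarrow> 'n))) * (\<Sum>i\<in>(UNIV :: 'n set). Y * (A * B + R * B)))
      (\<lambda>h. \<Sum>\<pi>\<in>UNIV. of_real (resolvent_coeff (k/2) (Suc m) \<pi>) * (\<Sum>i\<in>UNIV. y i * (a (\<pi> i) * F \<pi> h + h (\<tau> (\<pi> i)) * F \<pi> h)))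
      (\<lambda>\<alpha>. \<Sum>\<pi>\<in>UNIV. of_real (resolvent_coeff (k/2) (Suc m) \<pi>) * (\<Sum>i\<in>UNIV. d \<pi> i \<alpha>))"
    by (rule power_series_bound_sum[OF finite], rule power_series_bound_scale, rule power_series_bound_sum[OF finite], rule d, (rule assms(1))+)
  have eq: "(\<lambda>h. \<Sum>\<pi>\<in>UNIV. of_real (resolvent_coeff (k/2) (Suc m) \<pi>) * (\<Sum>i\<in>UNIV. y i * (a (\<pi> i) * F \<pi> h + h (\<tau> (\<pi> i)) * F \<pi> h)))
     = (\<lambda>h. hom_kernel k (Suc m) (\<lambda>i. a i + h (\<tau> i)) y)"
  proof
    fix h
    have "(\<Sum>i\<in>UNIV. y i * (a (\<pi> i) * F \<pi> h + h (\<tau> (\<pi> i)) * F \<pi> h))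
        = pairing ((\<lambda>i. a i + h (\<tau> i)) \<circ> \<pi>) y * hom_kernel k m ((\<lambda>i. a i + h (\<tau> i)) \<circ> \<pi>) y" for \<pi> :: "'n \<Rightarrow> 'n"
    proof -
      have "hom_kernel k m ((\<lambda>i. a i + h (\<tau> i)) \<circ> \<pi>) y = F \<pi> h" by (simp add: F_def comp_def)
      then show ?thesis unfolding pairing_def sum_distrib_right
        by (intro sum.cong) (simp_all add: algebra_simps)
    qed
    then show "(\<Sum>\<pi>\<in>UNIV. of_real (resolvent_coeff (k/2) (Suc m) \<pi>) * (\<Sum>i\<in>UNIV. y i * (a (\<pi> i) * F \<pi> h + h (\<tau> (\<pi> i)) * F \<pi> h)))
      = hom_kernel k (Suc m) (\<lambda>i. a i + h (\<tau> i)) y"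
      by (simp only: hom_kernel.simps)
  qed
  have "(\<Sum>\<pi>\<in>UNIV. norm (complex_of_real (resolvent_coeff (k/2) (Suc m) (\<pi> :: 'n \<Rightarrow> 'n))) * (\<Sum>i\<in>(UNIV :: 'n set). Y * (A * B + R * B)))
     = (\<Sum>\<pi>\<in>UNIV. resolvent_coeff (k/2) (Suc m) (\<pi> :: 'n \<Rightarrow> 'n)) * (CARD('n) * (Y * (A * B + R * B)))"
    unfolding sum_distrib_right
  proof (rule sum.cong)
    fix \<pi> :: "'n \<Rightarrow> 'n"
    have "resolvent_coeff (k/2) (Suc m) \<pi> \<ge> 0" using k_pos by (intro resolvent_coeff_nonneg) auto
    then show "norm (complex_of_real (resolvent_coeff (k/2) (Suc m) \<pi>)) * (\<Sum>i\<in>(UNIV :: 'n set). Y * (A * B + R * B))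
      = resolvent_coeff (k/2) (Suc m) \<pi> * (CARD('n) * (Y * (A * B + R * B)))"
      by (simp only: norm_of_real abs_of_nonneg sum_constant)
  qed simp
  also have "\<dots> = (1 / Suc m) * (CARD('n) * (Y * (A * B + R * B)))"
    by (subst sum_resolvent_coeff) (use k_pos in auto)
  also have "\<dots> = (1 / Suc m) * ((CARD('n) * ((A + R) * Y)) * B)" by (simp add: algebra_simps)
  also have "\<dots> = (CARD('n) * ((A + R) * Y)) ^ Suc m / fact (Suc m)"
    unfolding B_def power_Suc fact_Suc of_nat_mult of_nat_fact by (simp del: of_nat_Suc)
  finally show ?case using ps unfolding eq by (intro exI) (simp only:)
qed

end

section \<open>The kernel as the sum of its homogeneous parts\<close>

definition kernel :: "real \<Rightarrow> ('n::finite \<Rightarrow> complex) \<Rightarrow> ('n \<Rightarrow> complex) \<Rightarrow> complex" where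
  "kernel k x y = (\<Sum>m. hom_kernel k m x y)"

lemma summable_power_fact: "summable (\<lambda>m. (c :: real) ^ m / fact m)"
  using summable_exp[of c] by (simp add: field_simps)

lemma finite_bound_ex: "\<exists>A::real. \<forall>i::'n::finite. norm (a i) \<le> A"
  by (rule exI[of _ "\<Sum>i\<in>UNIV. norm (a i)"]) (auto intro: member_le_sum)

context
  fixes k :: real
  assumes k_pos: "k > 0"
begin

lemma kernel_sums:
  fixes x y :: "'n::finite \<Rightarrow> complex"
  shows "(\<lambda>m. hom_kernel k m x y) sums kernel k x y"
proof -
  obtain A B where A: "\<forall>i. norm (x i) \<le> A" and B: "\<forall>i. norm (y i) \<le> B"
    using finite_bound_ex[of x] finite_bound_ex[of y] by auto
  have "summable (\<lambda>m. hom_kernel k m x y)"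
    by (rule summable_comparison_test[OF _ summable_power_fact[of "CARD('n) * (A * B)"]])
       (use norm_hom_kernel_le[OF k_pos, of x A y B] A B in auto)
  then show ?thesis unfolding kernel_def by (rule summable_sums)
qed

lemma kernel_commute: "kernel k x y = kernel k y x"
  by (simp add: kernel_def hom_kernel_commute[OF k_pos, of _ x y])

lemma kernel_swp_left: "kernel k (x \<circ> swp a b) y = kernel k x (y \<circ> swp a b)"
  by (simp add: kernel_def hom_kernel_transpose_left[OF k_pos])

lemma kernel_minus_left: "kernel k (\<lambda>i. - x i) y = kernel k x (\<lambda>i. - y i)"
proof -
  have "hom_kernel k m (\<lambda>i. - x i) y = hom_kernel k m x (\<lambda>i. - y i)" for m
    using hom_kernel_scale[OF k_pos, of m "-1" x y] hom_kernel_scale[OF k_pos, of m "-1" y x]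
    by (simp add: hom_kernel_commute[OF k_pos, of m x])
  then show ?thesis by (simp add: kernel_def)
qed

lemma kernel_zero_left: "kernel k (\<lambda>i. 0) y = 1"
proof -
  have "hom_kernel k m (\<lambda>i. 0) y = (if m = 0 then 1 else 0)" for m
    using hom_kernel_scale[OF k_pos, of m 0 "\<lambda>i. 0" y] by (cases m) auto
  then have "(\<lambda>m. hom_kernel k m (\<lambda>i. 0) y) sums 1" using sums_single[of 0 "\<lambda>_. 1::complex"] by simp
  then show ?thesis using kernel_sums sums_unique2 by blast
qed

lemma kernel_const: "kernel k x (\<lambda>_. c) = exp (c * (\<Sum>i\<in>UNIV. x i))"
proof -
  have "hom_kernel k m x (\<lambda>_. c) = (c * (\<Sum>i\<in>UNIV. x i)) ^ m /\<^sub>R fact m" for m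
    using hom_kernel_scale[OF k_pos, of m c "\<lambda>_. 1" x] hom_kernel_one[OF k_pos, of m x]
    by (simp add: hom_kernel_commute[OF k_pos, of m x] power_mult_distrib scaleR_conv_of_real field_simps)
  then show ?thesis by (simp add: kernel_def exp_def)
qed

lemma kernel_power_series:
  fixes a y :: "'n::finite \<Rightarrow> complex"
  assumes "R \<ge> 0"
  shows "\<exists>B c. power_series_bound R B (\<lambda>h. kernel k (\<lambda>i. a i + h i) y) c"
proof -
  obtain A Y where A: "\<forall>i. norm (a i) \<le> A" and Y: "\<forall>i. norm (y i) \<le> Y"
    using finite_bound_ex[of a] finite_bound_ex[of y] by auto
  have "\<exists>c. power_series_bound R ((CARD('n) * ((A + R) * Y)) ^ m / fact m) (\<lambda>h. hom_kernel k m (\<lambda>i. a i + h i) y) c" for m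
    using hom_kernel_power_series[OF k_pos assms, where \<tau> = "\<lambda>i. i" and y = y and Y = Y and a = a and A = A] A Y by auto
  then have "\<forall>m. \<exists>c. power_series_bound R ((CARD('n) * ((A + R) * Y)) ^ m / fact m) (\<lambda>h. hom_kernel k m (\<lambda>i. a i + h i) y) c"
    by (rule allI)
  from choice[OF this] obtain c where c: "\<forall>m. power_series_bound R ((CARD('n) * ((A + R) * Y)) ^ m / fact m) (\<lambda>h. hom_kernel k m (\<lambda>i. a i + h i) y) (c m)"
    by (elim exE)
  show ?thesis
    unfolding kernel_def using power_series_bound_series[OF c[rule_format] summable_power_fact assms] by (rule exI)
qed

lemma kernel_quadratic:
  fixes a y :: "'n::finite \<Rightarrow> complex"
  shows "\<exists>d K. \<forall>h s. 0 \<le> s \<longrightarrow> s \<le> 1 \<longrightarrow> (\<forall>i. norm (h i) \<le> s) \<longrightarrow>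
    norm (kernel k (\<lambda>i. a i + h i) y - kernel k a y - (\<Sum>i\<in>UNIV. d i * h i)) \<le> K * s\<^sup>2"
proof -
  obtain B c where c: "power_series_bound 1 B (\<lambda>h. kernel k (\<lambda>i. a i + h i) y) c"
    using kernel_power_series[OF zero_le_one, of a y] by (elim exE)
  then have sm: "(\<lambda>\<alpha>. norm (c \<alpha>) * 1 ^ deg \<alpha>) summable_on UNIV" and
    hs: "\<And>h. (\<forall>i. norm (h i) \<le> 1) \<Longrightarrow> ((\<lambda>\<alpha>. c \<alpha> * multi_power h \<alpha>) has_sum kernel k (\<lambda>i. a i + h i) y) UNIV"
    unfolding power_series_bound_def by blast+
  obtain d K where dK: "\<And>s h S. 0 \<le> s \<Longrightarrow> s \<le> 1 \<Longrightarrow> (\<forall>i. norm (h i) \<le> s) \<Longrightarrow> ((\<lambda>\<alpha>. c \<alpha> * multi_power h \<alpha>) has_sum S) UNIV \<Longrightarrow>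
      norm (S - c (\<lambda>_. 0) - (\<Sum>i\<in>UNIV. d i * h i)) \<le> K * s\<^sup>2"
    using power_series_quadratic[OF zero_less_one sm] by blast
  have main: "norm (kernel k (\<lambda>i. a i + h i) y - c (\<lambda>_. 0) - (\<Sum>i\<in>UNIV. d i * h i)) \<le> K * s\<^sup>2"
    if "0 \<le> s" "s \<le> 1" "\<forall>i. norm (h i) \<le> s" for h s
    using that by (intro dK hs) (auto intro: order_trans)
  from main[of 0 "\<lambda>_. 0"] have "kernel k a y = c (\<lambda>_. 0)" by simp
  with main show ?thesis by (intro exI[of _ d] exI[of _ K]) auto
qed

text \<open>One vector d from \<open>kernel_quadratic\<close> serves all directions at once. This is
  total differentiability, so the chain rule along complex lines holds with the coordinate
  derivatives as coefficients.\<close>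

lemma kernel_coordinate_differentiable: "coordinate_differentiable (\<lambda>x. kernel k x y)"
  and kernel_line_derivative:
    "((\<lambda>t. kernel k (\<lambda>i. a i + t * v i) y) has_field_derivative (\<Sum>i\<in>UNIV. cpartial i (\<lambda>x. kernel k x y) (\<lambda>i. a i + t * v i) * v i)) (at t)"
    (is ?B)
proof -
  have ex: "\<exists>d. (\<forall>v. ((\<lambda>t. kernel k (\<lambda>i. a i + t * v i) y) has_field_derivative (\<Sum>i\<in>UNIV. d i * v i)) (at 0))" for a :: "'a \<Rightarrow> complex"
  proof -
    obtain d K where dK: "\<And>h s. 0 \<le> s \<Longrightarrow> s \<le> 1 \<Longrightarrow> (\<forall>i. norm (h i) \<le> s) \<Longrightarrow>
      norm (kernel k (\<lambda>i. a i + h i) y - kernel k a y - (\<Sum>i\<in>UNIV. d i * h i)) \<le> K * s\<^sup>2"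
      using kernel_quadratic[of a y] by blast
    have "((\<lambda>t. kernel k (\<lambda>i. a i + t * v i) y) has_derivative (\<lambda>t. (\<Sum>i\<in>UNIV. d i * v i) * t)) (at 0)" for v
    proof -
      obtain V where V: "\<forall>i. norm (v i) \<le> V" using finite_bound_ex by blast
      then have "V \<ge> 0" by (meson norm_ge_zero order_trans)
      show ?thesis
      proof (rule has_derivative_at_0_quadratic[where \<delta> = "1 / (V + 1)" and K = "K * V\<^sup>2"])
        fix t :: complex assume t: "norm t \<le> 1 / (V + 1)"
        have "norm t * V \<le> 1 / (V + 1) * V" using t \<open>V \<ge> 0\<close> by (rule mult_right_mono)
        also have "\<dots> \<le> 1" using \<open>V \<ge> 0\<close> by simp
        finally have "norm (kernel k (\<lambda>i. a i + t * v i) y - kernel k a y - (\<Sum>i\<in>UNIV. d i * (t * v i))) \<le> K * (norm t * V)\<^sup>2"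
          using V \<open>V \<ge> 0\<close> by (intro dK) (auto simp: norm_mult intro!: mult_left_mono)
        then show "norm (kernel k (\<lambda>i. a i + t * v i) y - kernel k (\<lambda>i. a i + 0 * v i) y - (\<Sum>i\<in>UNIV. d i * v i) * t) \<le> K * V\<^sup>2 * (norm t)\<^sup>2"
          by (simp add: sum_distrib_left sum_distrib_right power_mult_distrib algebra_simps)
      qed (use \<open>V \<ge> 0\<close> in \<open>auto intro: bounded_linear_mult_right\<close>)
    qed
    then show ?thesis unfolding has_field_derivative_def by blast
  qed
  have coord: "\<exists>d. (\<forall>i. ((\<lambda>t. kernel k (a(i := t)) y) has_field_derivative d i) (at (a i))) \<and>
     (\<forall>v. ((\<lambda>t. kernel k (\<lambda>i. a i + t * v i) y) has_field_derivative (\<Sum>i\<in>UNIV. d i * v i)) (at 0))" for a :: "'a \<Rightarrow> complex"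
  proof -
    obtain d where d: "\<And>v. ((\<lambda>t. kernel k (\<lambda>i. a i + t * v i) y) has_field_derivative (\<Sum>i\<in>UNIV. d i * v i)) (at 0)"
      using ex[of a] by blast
    have "((\<lambda>t. kernel k (a(i := t)) y) has_field_derivative d i) (at (a i))" for i
    proof -
      have "(\<lambda>l. a l + t * (if l = i then 1 else 0)) = a(i := t + a i)" for t by auto
      then have "((\<lambda>t. kernel k (a(i := t + a i)) y) has_field_derivative d i) (at 0)"
        using d[of "\<lambda>l. if l = i then 1 else 0"] by (simp add: if_distrib[of "(*) _"] cong: if_cong)
      then show ?thesis using DERIV_shift[of "\<lambda>t. kernel k (a(i := t)) y" "d i" 0 "a i"] by simp
    qed
    then show ?thesis using d by blast
  qed
  show "coordinate_differentiable (\<lambda>x. kernel k x y)"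
    unfolding coordinate_differentiable_def field_differentiable_def using coord by blast
  show ?B
  proof -
    let ?a = "\<lambda>i. a i + t * v i"
    obtain d where d: "\<forall>i. ((\<lambda>t. kernel k (?a(i := t)) y) has_field_derivative d i) (at (?a i))"
       "\<forall>v. ((\<lambda>t. kernel k (\<lambda>i. ?a i + t * v i) y) has_field_derivative (\<Sum>i\<in>UNIV. d i * v i)) (at 0)"
      using coord[of ?a] by blast
    have "d i = cpartial i (\<lambda>x. kernel k x y) ?a" for i
      unfolding cpartial_def using DERIV_imp_deriv[OF d(1)[rule_format]] by simp
    then have "((\<lambda>s. kernel k (\<lambda>i. a i + (s + t) * v i) y) has_field_derivative (\<Sum>i\<in>UNIV. cpartial i (\<lambda>x. kernel k x y) ?a * v i)) (at 0)"
      using d(2)[rule_format, of v] by (simp add: algebra_simps)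
    then show ?thesis using DERIV_shift[of "\<lambda>t. kernel k (\<lambda>i. a i + t * v i) y" _ 0 t] by simp
  qed
qed

text \<open>The series is differentiated term by term in the j-th coordinate under a summable
  majorant; the difference part is a finite combination of convergent series.\<close>

lemma cdunkl_kernel:
  fixes x y :: "'n::finite \<Rightarrow> complex"
  assumes "inj x"
  shows "cdunkl k j (\<lambda>x. kernel k x y) x = y j * kernel k x y"
proof -
  obtain X Y where X: "\<forall>i. norm (x i) \<le> X" and Y: "\<forall>i. norm (y i) \<le> Y"
    using finite_bound_ex[of x] finite_bound_ex[of y] by auto
  have "X \<ge> 0" using X by (meson norm_ge_zero order_trans)
  let ?f = "\<lambda>m t. hom_kernel k m (x(j := t)) y"
  let ?f' = "\<lambda>m t. cpartial j (\<lambda>x. hom_kernel k m x y) (x(j := t))"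
  have "\<exists>g g'. \<forall>t \<in> ball 0 (X + 1). ((\<lambda>n. ?f n t) sums g t) \<and> ((\<lambda>n. ?f' n t) sums g' t) \<and> (g has_field_derivative g' t) (at t)"
  proof (rule series_and_derivative_comparison_complex)
    show "(?f n has_field_derivative ?f' n t) (at t)" for n t
      using coordinate_differentiableD[OF hom_kernel_coordinate_differentiable[OF k_pos], where x = "x(j := t)" and i = j] by simp
  next
    \<comment> \<open>For |t| < X + 1 all coordinates of \<open>x(j := t)\<close> have norm at most
      X + 1, so one majorant serves the whole disc, which contains x j.\<close>
    let ?h = "\<lambda>m. (CARD('n) * ((X + 1) * Y)) ^ m / fact m"
    fix t :: complex
    define b where "b m = \<bar>?h m\<bar>" for m
    have fb: "norm (?f n t) \<le> b n" if "t \<in> ball 0 (X + 1)" for t n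
    proof -
      have "norm (?f n t) \<le> ?h n"
        by (rule norm_hom_kernel_le[OF k_pos]) (use X Y that in \<open>auto intro: order_trans less_imp_le\<close>)
      then show ?thesis unfolding b_def by (rule order_trans[OF _ abs_ge_self])
    qed
    have sb: "summable b"
      unfolding b_def using summable_power_fact[of "norm (CARD('n) * ((X + 1) * Y))"] by (simp add: power_abs abs_mult)
    have b0: "b m \<ge> 0" for m by (simp add: b_def)
    show "\<exists>d h. 0 < d \<and> summable h \<and> range h \<subseteq> \<real>\<^sub>\<ge>\<^sub>0 \<and>
        (\<forall>\<^sub>F n in sequentially. \<forall>t\<in>ball t d \<inter> ball 0 (X + 1). norm (?f n t) \<le> norm (h n :: complex))"
      using fb sb b0 by (intro exI[of _ 1] exI[of _ "\<lambda>m. complex_of_real (b m)"]) (auto simp: summable_complex_of_real)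
  qed auto
  then obtain g g' where g: "\<And>t. t \<in> ball 0 (X + 1) \<Longrightarrow> (\<lambda>n. ?f n t) sums g t \<and> (\<lambda>n. ?f' n t) sums g' t \<and> (g has_field_derivative g' t) (at t)"
    by blast
  have xj: "x j \<in> ball 0 (X + 1)" using X[rule_format, of j] by simp
  have gk: "g t = kernel k (x(j := t)) y" if "t \<in> ball 0 (X + 1)" for t
    using g[OF that] kernel_sums sums_unique2 by blast
  have "((\<lambda>t. kernel k (x(j := t)) y) has_field_derivative g' (x j)) (at (x j))"
    by (rule has_field_derivative_transform_within_open[of g _ _ "ball 0 (X + 1)"]) (use g xj gk in auto)
  then have "cpartial j (\<lambda>x. kernel k x y) x = g' (x j)"
    unfolding cpartial_def by (rule DERIV_imp_deriv)
  then have "(\<lambda>m. cpartial j (\<lambda>x. hom_kernel k m x y) x) sums cpartial j (\<lambda>x. kernel k x y) x"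
    using g[OF xj] by simp
  then have S: "(\<lambda>m. cdunkl k j (\<lambda>x. hom_kernel k m x y) x) sums cdunkl k j (\<lambda>x. kernel k x y) x"
    unfolding cdunkl_def by (intro sums_add sums_mult sums_sum sums_divide sums_diff kernel_sums)
  \<comment> \<open>T_j kills the constant part, so the series may start in degree 1; lowering every
    degree by one then recovers the kernel itself.\<close>
  have "cdunkl k j (\<lambda>x. hom_kernel k 0 x y) x = 0" by (simp add: cdunkl_def cpartial_def)
  then have "(\<lambda>m. cdunkl k j (\<lambda>x. hom_kernel k (Suc m) x y) x) sums cdunkl k j (\<lambda>x. kernel k x y) x"
    using S sums_Suc_iff[of "\<lambda>m. cdunkl k j (\<lambda>x. hom_kernel k m x y) x"] by simp
  then have "(\<lambda>m. y j * hom_kernel k m x y) sums cdunkl k j (\<lambda>x. kernel k x y) x"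
    by (simp only: cdunkl_hom_kernel[OF k_pos assms])
  moreover have "(\<lambda>m. y j * hom_kernel k m x y) sums (y j * kernel k x y)"
    by (intro sums_mult kernel_sums)
  ultimately show ?thesis by (rule sums_unique2)
qed

end

section \<open>Uniqueness and decay\<close>

definition rpartial :: "'n \<Rightarrow> (('n \<Rightarrow> real) \<Rightarrow> complex) \<Rightarrow> ('n \<Rightarrow> real) \<Rightarrow> complex" where
  "rpartial i f x = vector_derivative (\<lambda>t. f (x(i := x i + t))) (at 0)"

definition rdunkl :: "real \<Rightarrow> 'n::finite \<Rightarrow> (('n \<Rightarrow> real) \<Rightarrow> complex) \<Rightarrow> ('n \<Rightarrow> real) \<Rightarrow> complex" where
  "rdunkl k i f x = rpartial i f x + of_real k * (\<Sum>j\<in>UNIV. (f x - f (x \<circ> swp i j)) / of_real (x i - x j))"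

text \<open>A quadratic remainder is what the constructed kernel and an arbitrary analytic
  competitor have in common. It suffices for derivatives along rays in the energy estimate and for
  limits along lines.\<close>

definition linearizable :: "(('n::finite \<Rightarrow> real) \<Rightarrow> complex) \<Rightarrow> bool" where
  "linearizable f \<longleftrightarrow> (\<forall>x. \<exists>d K \<delta>. \<delta> > 0 \<and> (\<forall>h s. 0 \<le> s \<longrightarrow> s \<le> \<delta> \<longrightarrow> (\<forall>i. \<bar>h i\<bar> \<le> s) \<longrightarrow>
      norm (f (\<lambda>i. x i + h i) - f x - (\<Sum>i\<in>UNIV. d i * of_real (h i))) \<le> K * s\<^sup>2))"

lemma linearizable_line:
  assumes "linearizable f"
  shows "((\<lambda>t. f (\<lambda>i. x i + t * v i)) has_vector_derivative
     (\<Sum>i\<in>UNIV. of_real (v i) * rpartial i f (\<lambda>i. x i + t * v i))) (at t)"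
proof -
  have ex: "\<exists>d. \<forall>v. ((\<lambda>t. f (\<lambda>i. x i + t * v i)) has_vector_derivative (\<Sum>i\<in>UNIV. of_real (v i) * d i)) (at 0)" for x
  proof -
    obtain d K \<delta> where "\<delta> > 0" and dK: "\<And>h s. 0 \<le> s \<Longrightarrow> s \<le> \<delta> \<Longrightarrow> (\<forall>i. \<bar>h i\<bar> \<le> s) \<Longrightarrow>
      norm (f (\<lambda>i. x i + h i) - f x - (\<Sum>i\<in>UNIV. d i * of_real (h i))) \<le> K * s\<^sup>2"
      using assms unfolding linearizable_def by blast
    have "((\<lambda>t. f (\<lambda>i. x i + t * v i)) has_derivative (\<lambda>t. t *\<^sub>R (\<Sum>i\<in>UNIV. of_real (v i) * d i))) (at 0)" for v
    proof -
      obtain V where V: "\<forall>i. norm (v i) \<le> V" using finite_bound_ex by blast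
      then have "V \<ge> 0" by (meson norm_ge_zero order_trans)
      show ?thesis
      proof (rule has_derivative_at_0_quadratic[where \<delta> = "\<delta> / (V + 1)" and K = "K * V\<^sup>2"])
        fix t :: real assume t: "norm t \<le> \<delta> / (V + 1)"
        have "\<bar>t\<bar> * V \<le> \<delta> / (V + 1) * V" using t \<open>V \<ge> 0\<close> by (intro mult_right_mono) auto
        also have "\<dots> \<le> \<delta>" using \<open>V \<ge> 0\<close> \<open>\<delta> > 0\<close> by (simp add: field_simps)
        finally have "norm (f (\<lambda>i. x i + t * v i) - f x - (\<Sum>i\<in>UNIV. d i * of_real (t * v i))) \<le> K * (\<bar>t\<bar> * V)\<^sup>2"
          using V \<open>V \<ge> 0\<close> by (intro dK) (auto simp: abs_mult intro!: mult_left_mono)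
        moreover have "(\<Sum>i\<in>UNIV. d i * of_real (t * v i)) = t *\<^sub>R (\<Sum>i\<in>UNIV. of_real (v i) * d i)"
          unfolding scaleR_sum_right by (intro sum.cong) (auto simp: scaleR_conv_of_real)
        ultimately show "norm (f (\<lambda>i. x i + t * v i) - f (\<lambda>i. x i + 0 * v i) - t *\<^sub>R (\<Sum>i\<in>UNIV. of_real (v i) * d i)) \<le> K * V\<^sup>2 * (norm t)\<^sup>2"
          by (simp add: power_mult_distrib algebra_simps)
      qed (use \<open>V \<ge> 0\<close> \<open>\<delta> > 0\<close> in \<open>auto intro: bounded_linear_scaleR_left\<close>)
    qed
    then show ?thesis unfolding has_vector_derivative_def by blast
  qed
  let ?x = "\<lambda>i. x i + t * v i"
  obtain d where d: "\<And>v. ((\<lambda>s. f (\<lambda>i. ?x i + s * v i)) has_vector_derivative (\<Sum>i\<in>UNIV. of_real (v i) * d i)) (at 0)"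
    using ex[of ?x] by blast
  have "d i = rpartial i f ?x" for i
  proof -
    have "(\<lambda>l. ?x l + s * (if l = i then 1 else 0)) = ?x(i := ?x i + s)" for s by auto
    then have "((\<lambda>s. f (?x(i := ?x i + s))) has_vector_derivative (\<Sum>j\<in>UNIV. of_real (if j = i then 1 else 0) * d j)) (at 0)"
      using d[of "\<lambda>l. if l = i then 1 else 0"] by simp
    also have "(\<Sum>j\<in>UNIV. of_real (if j = i then 1 else 0) * d j) = (\<Sum>j\<in>UNIV. if j = i then d j else 0)"
      by (intro sum.cong) auto
    also have "\<dots> = d i" by simp
    finally show ?thesis unfolding rpartial_def by (rule vector_derivative_at[symmetric])
  qed
  then have "((\<lambda>s. f (\<lambda>i. x i + (s + t) * v i)) has_vector_derivative (\<Sum>i\<in>UNIV. of_real (v i) * rpartial i f ?x)) (at 0)"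
    using d[of v] by (simp add: algebra_simps)
  moreover have "((\<lambda>s. s - t) has_vector_derivative 1) (at t)"
    by (auto intro!: derivative_eq_intros)
  ultimately have "((\<lambda>s. f (\<lambda>i. x i + (s + t) * v i)) \<circ> (\<lambda>s. s - t) has_vector_derivative 1 *\<^sub>R (\<Sum>i\<in>UNIV. of_real (v i) * rpartial i f ?x)) (at t)"
    by (intro vector_diff_chain_at) simp_all
  then show ?thesis by (simp add: comp_def)
qed

text \<open>The terms (i, j) and (j, i) combine through u_i / (u_i - u_j) + u_j / (u_j - u_i) = 1.
  The denominators disappear, which leaves the radial derivative of a solution with no singularity
  but the factor 1 / t.\<close>

lemma symmetrize_sum:
  fixes u :: "'n::finite \<Rightarrow> real" and D :: "'n \<Rightarrow> 'n \<Rightarrow> complex"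
  assumes "inj u" and sym: "\<And>i j. D i j = D j i" and diag: "\<And>i. D i i = 0"
  shows "(\<Sum>i\<in>UNIV. \<Sum>j\<in>UNIV. of_real (u i) * (D i j / of_real (u i - u j))) = (\<Sum>i\<in>UNIV. \<Sum>j\<in>UNIV. D i j) / 2"
proof -
  let ?A = "\<Sum>i\<in>UNIV. \<Sum>j\<in>UNIV. of_real (u i) * (D i j / of_real (u i - u j))"
  have "?A + ?A = ?A + (\<Sum>i\<in>UNIV. \<Sum>j\<in>UNIV. of_real (u j) * (D j i / of_real (u j - u i)))"
    by (subst (3) sum.swap) simp
  also have "\<dots> = (\<Sum>i\<in>UNIV. \<Sum>j\<in>UNIV. D i j)"
    unfolding sum.distrib[symmetric]
  proof (intro sum.cong refl)
    fix i j
    show "of_real (u i) * (D i j / of_real (u i - u j)) + of_real (u j) * (D j i / of_real (u j - u i)) = D i j"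
    proof (cases "i = j")
      case False
      then have "complex_of_real (u i) - of_real (u j) \<noteq> 0" using assms(1) by (auto dest: injD)
      then have "of_real (u i) * (D i j / of_real (u i - u j)) - of_real (u j) * (D i j / of_real (u i - u j)) = D i j"
        unfolding left_diff_distrib[symmetric] by simp
      moreover have "complex_of_real (u j - u i) = - of_real (u i - u j)" by simp
      ultimately show ?thesis unfolding sym[of j i] by (simp only: divide_minus_right mult_minus_right diff_conv_add_uminus)
    qed (simp add: diag)
  qed
  finally show ?thesis by (simp add: mult.commute)
qed

lemma card_bij: "card {\<pi> :: 'n::finite \<Rightarrow> 'n. bij \<pi>} = fact CARD('n)"
  using card_permutations[of "UNIV :: 'n set" "CARD('n)"]
  by (simp add: permutes_def bij_iff)

lemma real_pairing_le:
  fixes y :: "'n::finite \<Rightarrow> complex"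
  assumes "\<And>i. x i \<ge> (0::real)" "\<And>i. Re (y i) \<le> - \<epsilon>" "bij \<pi>"
  shows "Re (pairing (\<lambda>i. of_real (x (\<pi> i))) y) \<le> - \<epsilon> * (\<Sum>i\<in>UNIV. x i)"
proof -
  have "Re (pairing (\<lambda>i. of_real (x (\<pi> i))) y) = (\<Sum>i\<in>UNIV. x (\<pi> i) * Re (y i))"
    by (simp add: pairing_def)
  also have "\<dots> \<le> (\<Sum>i\<in>UNIV. x (\<pi> i) * - \<epsilon>)"
    by (intro sum_mono mult_left_mono assms)
  also have "\<dots> = (\<Sum>i\<in>UNIV. x i * - \<epsilon>)"
    using sum.reindex_bij_betw[OF assms(3), of "\<lambda>i. x i * - \<epsilon>"] by simp
  finally show ?thesis by (simp add: sum_distrib_left sum_negf mult.commute)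
qed

text \<open>The sum of squares over the orbit of a ray satisfies a Gronwall inequality, since the
  difference part of the Dunkl operators contributes a negative semidefinite quadratic form.\<close>

lemma dunkl_energy_bound:
  fixes f :: "('n::finite \<Rightarrow> real) \<Rightarrow> complex"
  assumes k: "k > 0" and lin: "linearizable f" and T: "\<And>x i. inj x \<Longrightarrow> rdunkl k i f x = y i * f x"
    and "inj x" and M: "\<And>\<pi>. bij \<pi> \<Longrightarrow> Re (pairing (\<lambda>i. of_real (x (\<pi> i))) y) \<le> M"
  shows "(norm (f x))\<^sup>2 \<le> fact CARD('n) * (norm (f (\<lambda>_. 0)))\<^sup>2 * exp (2 * M)"
proof -
  define B where "B = {\<pi> :: 'n \<Rightarrow> 'n. bij \<pi>}"
  define F where "F \<pi> t = f (\<lambda>i. t * x (\<pi> i))" for \<pi> t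
  \<comment> \<open>The radial derivative predicted by the eigenvalue equations weighted with the
    coordinates: \<open>symmetrize_sum\<close> halves the sum over ordered pairs, and homogeneity of
    the quotients leaves 1 / t.\<close>
  define F' where "F' \<pi> t = pairing (\<lambda>i. of_real (x (\<pi> i))) y * F \<pi> t
     - of_real (k / (2 * t)) * (\<Sum>(a,b)\<in>UNIV. F \<pi> t - F (\<pi> \<circ> swp a b) t)" for \<pi> t
  have der: "(F \<pi> has_vector_derivative (\<Sum>i\<in>UNIV. of_real (x (\<pi> i)) * rpartial i f (\<lambda>i. t * x (\<pi> i)))) (at t)" for \<pi> t
    unfolding F_def using linearizable_line[OF lin, of "\<lambda>_. 0" "\<lambda>i. x (\<pi> i)" t] by simp
  have radial: "(\<Sum>i\<in>UNIV. of_real (x (\<pi> i)) * rpartial i f (\<lambda>i. t * x (\<pi> i))) = F' \<pi> t" if "bij \<pi>" "t > 0" for \<pi> t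
  proof -
    let ?u = "\<lambda>i. t * x (\<pi> i)"
    have inju: "inj (\<lambda>i. x (\<pi> i))" using \<open>inj x\<close> \<open>bij \<pi>\<close> by (metis bij_is_inj comp_apply inj_compose inj_def)
    then have "inj ?u" using \<open>t > 0\<close> by (auto simp: inj_def)
    from T[OF this] have "rpartial i f ?u = y i * F \<pi> t - of_real k * (\<Sum>j\<in>UNIV. (f ?u - f (?u \<circ> swp i j)) / of_real (t * x (\<pi> i) - t * x (\<pi> j)))" for i
      unfolding rdunkl_def F_def by (simp add: algebra_simps)
    moreover have "f (?u \<circ> swp i j) = F (\<pi> \<circ> swp i j) t" for i j by (simp add: F_def comp_def)
    ultimately have "rpartial i f ?u = y i * F \<pi> t - of_real k * (\<Sum>j\<in>UNIV. (F \<pi> t - F (\<pi> \<circ> swp i j) t) / of_real (t * (x (\<pi> i) - x (\<pi> j))))" for i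
      by (simp add: F_def right_diff_distrib)
    then have "(\<Sum>i\<in>UNIV. of_real (x (\<pi> i)) * rpartial i f ?u) =
       (\<Sum>i\<in>UNIV. of_real (x (\<pi> i)) * y i * F \<pi> t - of_real k * (\<Sum>j\<in>UNIV. of_real (x (\<pi> i)) * ((F \<pi> t - F (\<pi> \<circ> swp i j) t) / of_real (t * (x (\<pi> i) - x (\<pi> j))))))"
    proof (intro sum.cong refl)
      fix i
      have e: "X * (Y * G - K * R) = X * Y * G - K * (X * R)" for X Y G K R :: complex by (simp only: algebra_simps)
      assume "rpartial i f ?u = y i * F \<pi> t - of_real k * (\<Sum>j\<in>UNIV. (F \<pi> t - F (\<pi> \<circ> swp i j) t) / of_real (t * (x (\<pi> i) - x (\<pi> j))))" for i
      then show "of_real (x (\<pi> i)) * rpartial i f ?u = of_real (x (\<pi> i)) * y i * F \<pi> t - of_real k * (\<Sum>j\<in>UNIV. of_real (x (\<pi> i)) * ((F \<pi> t - F (\<pi> \<circ> swp i j) t) / of_real (t * (x (\<pi> i) - x (\<pi> j)))))"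
        unfolding sum_distrib_left[symmetric] by (simp only: e)
    qed
    also have "\<dots> = pairing (\<lambda>i. of_real (x (\<pi> i))) y * F \<pi> t
       - of_real k * (\<Sum>i\<in>UNIV. \<Sum>j\<in>UNIV. of_real (x (\<pi> i)) * ((F \<pi> t - F (\<pi> \<circ> swp i j) t) / of_real (t * (x (\<pi> i) - x (\<pi> j)))))"
      by (simp add: sum_subtractf pairing_def sum_distrib_right sum_distrib_left)
    also have "(\<Sum>i\<in>UNIV. \<Sum>j\<in>UNIV. of_real (x (\<pi> i)) * ((F \<pi> t - F (\<pi> \<circ> swp i j) t) / of_real (t * (x (\<pi> i) - x (\<pi> j)))))
      = (\<Sum>i\<in>UNIV. \<Sum>j\<in>UNIV. of_real (x (\<pi> i)) * ((F \<pi> t - F (\<pi> \<circ> swp i j) t) / of_real (x (\<pi> i) - x (\<pi> j)))) / of_real t"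
      unfolding sum_divide_distrib by (simp add: mult.commute)
    also have "\<dots> = (\<Sum>i\<in>UNIV. \<Sum>j\<in>UNIV. F \<pi> t - F (\<pi> \<circ> swp i j) t) / 2 / of_real t"
      by (subst symmetrize_sum[OF inju]) (auto simp: transpose_commute)
    finally show ?thesis
      unfolding F'_def UNIV_Times_UNIV[symmetric] sum.cartesian_product[symmetric] by simp
  qed
  define S where "S t = (\<Sum>\<pi>\<in>B. (norm (F \<pi> t))\<^sup>2)" for t
  have dS: "(S has_real_derivative (\<Sum>\<pi>\<in>B. 2 * (F \<pi> t \<bullet> F' \<pi> t))) (at t)" if "t > 0" for t
  proof -
    have "((\<lambda>t. F \<pi> t \<bullet> F \<pi> t) has_real_derivative 2 * (F \<pi> t \<bullet> F' \<pi> t)) (at t)" if "\<pi> \<in> B" for \<pi>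
    proof -
      have "(F \<pi> has_derivative (\<lambda>h. h *\<^sub>R F' \<pi> t)) (at t)"
        using der[of \<pi> t] radial[of \<pi> t] that \<open>t > 0\<close> by (simp add: B_def has_vector_derivative_def)
      from has_derivative_inner[OF this this] show ?thesis
        unfolding has_field_derivative_def
        by (rule has_derivative_eq_rhs) (auto simp: inner_commute algebra_simps)
    qed
    then show ?thesis unfolding S_def power2_norm_eq_inner by (intro DERIV_sum)
  qed
  have le: "(\<Sum>\<pi>\<in>B. 2 * (F \<pi> t \<bullet> F' \<pi> t)) \<le> 2 * M * S t" if "t > 0" for t
  proof -
    \<comment> \<open>Reindexing by the swap shows that twice this sum is the sum of
      \<open>(norm (F \<pi> t - F (\<pi> \<circ> swp a b) t))\<^sup>2\<close>. As k > 0, the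
      reflection part can only lower the energy.\<close>
    have nn: "(\<Sum>\<pi>\<in>B. F \<pi> t \<bullet> (F \<pi> t - F (\<pi> \<circ> swp a b) t)) \<ge> 0" for a b
    proof -
      have bb: "bij_betw (\<lambda>\<pi>. \<pi> \<circ> swp a b) B B"
        by (rule bij_betw_byWitness[where f' = "\<lambda>\<pi>. \<pi> \<circ> swp a b"]) (auto simp: B_def comp_assoc bij_comp)
      let ?N = "\<Sum>\<pi>\<in>B. F \<pi> t \<bullet> (F \<pi> t - F (\<pi> \<circ> swp a b) t)"
      have "?N = (\<Sum>\<pi>\<in>B. F (\<pi> \<circ> swp a b) t \<bullet> (F (\<pi> \<circ> swp a b) t - F \<pi> t))"
        using sum.reindex_bij_betw[OF bb, of "\<lambda>\<pi>. F \<pi> t \<bullet> (F \<pi> t - F (\<pi> \<circ> swp a b) t)"] by (simp add: comp_assoc)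
      then have "2 * ?N = (\<Sum>\<pi>\<in>B. (norm (F \<pi> t - F (\<pi> \<circ> swp a b) t))\<^sup>2)"
        by (simp add: sum.distrib[symmetric] power2_norm_eq_inner algebra_simps inner_commute)
          (simp add: sum.distrib sum_subtractf sum_distrib_left algebra_simps)
      moreover have "\<dots> \<ge> 0" by (intro sum_nonneg) auto
      ultimately show ?thesis by simp
    qed
    have "F \<pi> t \<bullet> F' \<pi> t = Re (pairing (\<lambda>i. of_real (x (\<pi> i))) y) * (norm (F \<pi> t))\<^sup>2
       - k / (2 * t) * (\<Sum>(a,b)\<in>UNIV. F \<pi> t \<bullet> (F \<pi> t - F (\<pi> \<circ> swp a b) t))" for \<pi>
    proof -
      have c: "z \<bullet> (c * z) = Re c * (norm z)\<^sup>2" for z c :: complex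
        by (simp add: inner_complex_def cmod_power2) (simp add: power2_eq_square algebra_simps)
      have r: "z \<bullet> (of_real r * w) = r * (z \<bullet> w)" for z w :: complex and r
        by (simp add: inner_complex_def algebra_simps)
      show ?thesis unfolding F'_def inner_diff_right c r
        by (simp add: inner_sum_right case_prod_unfold inner_diff_right)
    qed
    then have "(\<Sum>\<pi>\<in>B. F \<pi> t \<bullet> F' \<pi> t) = (\<Sum>\<pi>\<in>B. Re (pairing (\<lambda>i. of_real (x (\<pi> i))) y) * (norm (F \<pi> t))\<^sup>2)
       - k / (2 * t) * (\<Sum>(a,b)\<in>UNIV. \<Sum>\<pi>\<in>B. F \<pi> t \<bullet> (F \<pi> t - F (\<pi> \<circ> swp a b) t))"
      by (simp only: sum_subtractf case_prod_unfold sum_distrib_left[symmetric]) (subst sum.swap, rule refl)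
    also have "\<dots> \<le> (\<Sum>\<pi>\<in>B. M * (norm (F \<pi> t))\<^sup>2) - 0"
      using k that nn by (intro diff_mono sum_mono mult_right_mono M mult_nonneg_nonneg sum_nonneg) (auto simp: B_def)
    finally show ?thesis by (simp add: S_def flip: sum_distrib_left)
  qed
  have contS: "continuous_on A S" for A
  proof -
    have "continuous_on A (F \<pi>)" for \<pi>
      using der[of \<pi>] has_vector_derivative_continuous continuous_at_imp_continuous_on by blast
    then show ?thesis unfolding S_def by (intro continuous_intros)
  qed
  \<comment> \<open>The factor 1 / t rules out the derivative formula at 0, so monotonicity uses the
    open interval and continuity at its ends. At t = 0 all n! branches have the value f(0).\<close>
  have "exp (- 2 * M * 1) * S 1 \<le> exp (- 2 * M * 0) * S 0"
  proof (rule DERIV_nonpos_imp_decreasing_open[where f = "\<lambda>t. exp (- 2 * M * t) * S t"])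
    fix t :: real assume "0 < t" "t < 1"
    let ?D = "\<Sum>\<pi>\<in>B. 2 * (F \<pi> t \<bullet> F' \<pi> t)"
    have "((\<lambda>t. exp (- 2 * M * t) * S t) has_real_derivative (exp (- 2 * M * t) * (?D - 2 * M * S t))) (at t)"
      by (rule derivative_eq_intros dS[OF \<open>0 < t\<close>] refl | simp add: algebra_simps)+
    moreover have "exp (- 2 * M * t) * (?D - 2 * M * S t) \<le> 0"
      using le[OF \<open>0 < t\<close>] by (intro mult_nonneg_nonpos) auto
    ultimately show "\<exists>y. ((\<lambda>t. exp (- 2 * M * t) * S t) has_real_derivative y) (at t) \<and> y \<le> 0" by blast
  qed (auto intro!: continuous_intros contS)
  then have "S 1 \<le> exp (2 * M) * S 0"
    by (simp add: exp_minus field_simps)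
  also have "S 0 = fact CARD('n) * (norm (f (\<lambda>_. 0)))\<^sup>2"
    by (simp add: S_def F_def B_def card_bij)
  finally have "S 1 \<le> fact CARD('n) * (norm (f (\<lambda>_. 0)))\<^sup>2 * exp (2 * M)" by (simp add: mult_ac)
  moreover have "(norm (F id 1))\<^sup>2 \<le> S 1"
    unfolding S_def by (rule member_le_sum) (auto simp: B_def bij_id[unfolded id_def])
  ultimately show ?thesis by (simp add: F_def)
qed

lemma kernel_real_linearizable:
  assumes "k > 0"
  shows "linearizable (\<lambda>x. kernel k (\<lambda>i. of_real (x i)) y)"
  unfolding linearizable_def
proof
  fix x :: "'a \<Rightarrow> real"
  obtain d K where dK: "\<And>h s. 0 \<le> s \<Longrightarrow> s \<le> 1 \<Longrightarrow> (\<forall>i. norm (h i) \<le> s) \<Longrightarrow>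
      norm (kernel k (\<lambda>i. of_real (x i) + h i) y - kernel k (\<lambda>i. of_real (x i)) y - (\<Sum>i\<in>UNIV. d i * h i)) \<le> K * s\<^sup>2"
    using kernel_quadratic[OF assms, of "\<lambda>i. of_real (x i)" y] by blast
  show "\<exists>d K \<delta>. \<delta> > 0 \<and> (\<forall>h s. 0 \<le> s \<longrightarrow> s \<le> \<delta> \<longrightarrow> (\<forall>i. \<bar>h i\<bar> \<le> s) \<longrightarrow>
      norm (kernel k (\<lambda>i. of_real (x i + h i)) y - kernel k (\<lambda>i. of_real (x i)) y - (\<Sum>i\<in>UNIV. d i * of_real (h i))) \<le> K * s\<^sup>2)"
  proof (intro exI conjI allI impI)
    fix h :: "'a \<Rightarrow> real" and s assume "0 \<le> s" "s \<le> 1" "\<forall>i. \<bar>h i\<bar> \<le> (s :: real)"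
    then show "norm (kernel k (\<lambda>i. of_real (x i + h i)) y - kernel k (\<lambda>i. of_real (x i)) y - (\<Sum>i\<in>UNIV. d i * of_real (h i))) \<le> K * s\<^sup>2"
      using dK[of s "\<lambda>i. of_real (h i)"] by simp
  qed simp
qed

lemma kernel_real_coordinate_derivative:
  assumes "k > 0"
  shows "((\<lambda>t. kernel k (\<lambda>l. of_real ((x(i := t)) l)) y) has_vector_derivative
     cpartial i (\<lambda>x. kernel k x y) (\<lambda>i. of_real (x i))) (at (x i))"
proof -
  let ?x = "\<lambda>i. complex_of_real (x i)"
  have "((\<lambda>t. kernel k (?x(i := t)) y) has_field_derivative cpartial i (\<lambda>x. kernel k x y) ?x) (at (?x i))"
    using coordinate_differentiableD[OF kernel_coordinate_differentiable[OF assms]] .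
  then have "((\<lambda>t. kernel k (?x(i := of_real t)) y) has_vector_derivative cpartial i (\<lambda>x. kernel k x y) ?x) (at (x i))"
    by (rule has_vector_derivative_real_field)
  moreover have "?x(i := of_real t) = (\<lambda>l. of_real ((x(i := t)) l))" for t by auto
  ultimately show ?thesis by simp
qed

lemma rdunkl_kernel:
  fixes y :: "'n::finite \<Rightarrow> complex"
  assumes "k > 0" "inj x"
  shows "rdunkl k i (\<lambda>x. kernel k (\<lambda>i. of_real (x i)) y) x = y i * kernel k (\<lambda>i. of_real (x i)) y"
proof -
  have "((\<lambda>t. kernel k (\<lambda>l. of_real ((x(i := t)) l)) y) \<circ> (\<lambda>t. x i + t) has_vector_derivative
     1 *\<^sub>R cpartial i (\<lambda>x. kernel k x y) (\<lambda>i. of_real (x i))) (at 0)"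
    by (rule vector_diff_chain_at) (use kernel_real_coordinate_derivative[OF assms(1), of x i y] in \<open>auto intro!: derivative_eq_intros\<close>)
  then have "rpartial i (\<lambda>x. kernel k (\<lambda>i. of_real (x i)) y) x = cpartial i (\<lambda>x. kernel k x y) (\<lambda>i. of_real (x i))"
    unfolding rpartial_def by (simp add: vector_derivative_at comp_def)
  then have "rdunkl k i (\<lambda>x. kernel k (\<lambda>i. of_real (x i)) y) x = cdunkl k i (\<lambda>x. kernel k x y) (\<lambda>i. of_real (x i))"
    by (simp add: rdunkl_def cdunkl_def comp_def)
  also have "\<dots> = y i * kernel k (\<lambda>i. of_real (x i)) y"
    by (rule cdunkl_kernel[OF assms(1)]) (use assms(2) in \<open>auto simp: inj_def\<close>)
  finally show ?thesis .
qed

text \<open>Coordinates that differ at x stay different for small t, and those that agree separate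
  at once because v is injective. This carries statements proved at distinct coordinates to every
  point by a limit.\<close>

lemma eventually_inj_line:
  fixes x v :: "'n::finite \<Rightarrow> real"
  assumes "inj v"
  shows "eventually (\<lambda>t. inj (\<lambda>i. x i + t * v i)) (at_right 0)"
proof -
  have "eventually (\<lambda>t. x i + t * v i \<noteq> x j + t * v j) (at_right 0)" if "i \<noteq> j" for i j
  proof (cases "x i = x j")
    case True
    have "v i \<noteq> v j" using assms that by (auto dest: injD)
    show ?thesis
      by (rule eventually_mono[OF eventually_at_right_less[of 0]]) (use True \<open>v i \<noteq> v j\<close> in auto)
  next
    case False
    have "((\<lambda>t. (x i + t * v i) - (x j + t * v j)) \<longlongrightarrow> (x i + 0 * v i) - (x j + 0 * v j)) (at_right 0)"
      by (intro tendsto_intros)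
    then have "eventually (\<lambda>t. (x i + t * v i) - (x j + t * v j) \<noteq> 0) (at_right 0)"
      using False by (intro tendsto_imp_eventually_ne) auto
    then show ?thesis by eventually_elim auto
  qed
  then have "eventually (\<lambda>t. \<forall>i\<in>UNIV. \<forall>j\<in>UNIV. i \<noteq> j \<longrightarrow> x i + t * v i \<noteq> x j + t * v j) (at_right 0)"
  proof (intro eventually_ball_finite ballI finite)
    fix i j
    show "eventually (\<lambda>t. i \<noteq> j \<longrightarrow> x i + t * v i \<noteq> x j + t * v j) (at_right 0)"
      using \<open>i \<noteq> j \<Longrightarrow> eventually (\<lambda>t. x i + t * v i \<noteq> x j + t * v j) (at_right 0)\<close> by (cases "i = j") auto
  qed
  then show ?thesis by eventually_elim (auto simp: inj_def)
qed

lemma linearizable_limit_line: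
  assumes "linearizable f"
  shows "((\<lambda>t. f (\<lambda>i. x i + t * v i)) \<longlongrightarrow> f x) (at_right 0)"
proof -
  have "continuous (at 0) (\<lambda>t. f (\<lambda>i. x i + t * v i))"
    using has_vector_derivative_continuous[OF linearizable_line[OF assms]] .
  then have "((\<lambda>t. f (\<lambda>i. x i + t * v i)) \<longlongrightarrow> f (\<lambda>i. x i + 0 * v i)) (at 0)" by (simp add: continuous_at)
  then have "((\<lambda>t. f (\<lambda>i. x i + t * v i)) \<longlongrightarrow> f (\<lambda>i. x i + 0 * v i)) (at_right 0)"
    by (rule filterlim_mono) (auto simp: at_within_le_at)
  then show ?thesis by simp
qed

lemma ex_inj_nonneg: "\<exists>v :: 'n::finite \<Rightarrow> real. inj v \<and> (\<forall>i. v i \<ge> 0)"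
proof -
  obtain g :: "'n \<Rightarrow> nat" where "inj g" using finite_imp_inj_to_nat_seg[of "UNIV :: 'n set"] by auto
  then show ?thesis by (intro exI[of _ "\<lambda>i. real (g i)"]) (auto simp: inj_def)
qed

text \<open>The energy bound with value 1 at the origin and M = -\<epsilon> times the sum of the x_i
  yields the constant sqrt (n!). The direction v is nonnegative, so perturbing to distinct
  coordinates does not leave the orthant where \<open>real_pairing_le\<close> applies.\<close>

lemma kernel_decay:
  fixes y :: "'n::finite \<Rightarrow> complex"
  assumes k: "k > 0" and x: "\<And>i. x i \<ge> 0" and y: "\<And>i. Re (y i) \<le> - \<epsilon>"
  shows "norm (kernel k (\<lambda>i. of_real (x i)) y) \<le> sqrt (fact CARD('n)) * exp (- \<epsilon> * (\<Sum>i\<in>UNIV. x i))"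
proof -
  obtain v :: "'n \<Rightarrow> real" where v: "inj v" "\<And>i. v i \<ge> 0" using ex_inj_nonneg by auto
  have inj_case: "norm (kernel k (\<lambda>i. of_real (x i)) y) \<le> sqrt (fact CARD('n)) * exp (- \<epsilon> * (\<Sum>i\<in>UNIV. x i))"
    if "inj x" "\<And>i. x i \<ge> 0" for x
  proof -
    have "(norm (kernel k (\<lambda>i. of_real (x i)) y))\<^sup>2 \<le> fact CARD('n) * (norm (kernel k (\<lambda>i. of_real 0) y))\<^sup>2 * exp (2 * (- \<epsilon> * (\<Sum>i\<in>UNIV. x i)))"
    proof (rule dunkl_energy_bound[OF k kernel_real_linearizable[OF k] _ \<open>inj x\<close>])
      show "Re (pairing (\<lambda>i. of_real (x (\<pi> i))) y) \<le> - \<epsilon> * (\<Sum>i\<in>UNIV. x i)" if "bij \<pi>" for \<pi>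
        by (rule real_pairing_le[OF \<open>\<And>i. x i \<ge> 0\<close> y that])
    qed (rule rdunkl_kernel[OF k])
    also have "\<dots> = (sqrt (fact CARD('n)) * exp (- \<epsilon> * (\<Sum>i\<in>UNIV. x i)))\<^sup>2"
      using kernel_zero_left[OF k, of y] by (simp only: power_mult_distrib exp_double) simp
    finally show ?thesis by (rule power2_le_imp_le) simp
  qed
  have "((\<lambda>t. norm (kernel k (\<lambda>i. of_real (x i + t * v i)) y)) \<longlongrightarrow> norm (kernel k (\<lambda>i. of_real (x i)) y)) (at_right 0)"
    using linearizable_limit_line[OF kernel_real_linearizable[OF k]] by (rule tendsto_norm)
  moreover have "((\<lambda>t. sqrt (fact CARD('n)) * exp (- \<epsilon> * (\<Sum>i\<in>UNIV. x i + t * v i))) \<longlongrightarrow>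
     sqrt (fact CARD('n)) * exp (- \<epsilon> * (\<Sum>i\<in>UNIV. x i + 0 * v i))) (at_right 0)"
    by (intro tendsto_intros)
  moreover have "eventually (\<lambda>t. norm (kernel k (\<lambda>i. of_real (x i + t * v i)) y) \<le> sqrt (fact CARD('n)) * exp (- \<epsilon> * (\<Sum>i\<in>UNIV. x i + t * v i))) (at_right 0)"
    using eventually_inj_line[OF v(1), of x] eventually_at_right_less[of 0]
    by eventually_elim (intro inj_case, auto simp: x v)
  ultimately have "norm (kernel k (\<lambda>i. of_real (x i)) y) \<le> sqrt (fact CARD('n)) * exp (- \<epsilon> * (\<Sum>i\<in>UNIV. x i + 0 * v i))"
    using trivial_limit_at_right_real by (intro tendsto_le[where F = "at_right (0::real)"]) auto
  then show ?thesis by simp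
qed

section \<open>Identification with the kernel of the definition\<close>

lemma real_analytic_linearizable:
  fixes f :: "real ^ 'n \<Rightarrow> complex"
  assumes "real_analytic_on UNIV f"
  shows "linearizable (\<lambda>x. f (\<chi> i. x i))"
  unfolding linearizable_def
proof
  fix x :: "'n \<Rightarrow> real"
  obtain r c where "r > 0" and c: "\<And>u. u \<in> ball (\<chi> i. x i) r \<Longrightarrow>
      ((\<lambda>\<alpha>. c \<alpha> * (\<Prod>i\<in>UNIV. of_real ((u $ i - (\<chi> i. x i) $ i) ^ \<alpha> i))) has_sum f u) UNIV"
    using assms unfolding real_analytic_on_def by blast
  \<comment> \<open>The polydisc of radius \<rho> lies in the ball of radius r, since the Euclidean
    norm is at most the sum of the n absolute coordinates, here at most r / 2.\<close>
  define \<rho> where "\<rho> = r / (2 * CARD('n))"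
  have "\<rho> > 0" using \<open>r > 0\<close> by (simp add: \<rho>_def)
  have hs: "((\<lambda>\<alpha>. c \<alpha> * multi_power (\<lambda>i. of_real (h i)) \<alpha>) has_sum f (\<chi> i. x i + h i)) UNIV" if "\<forall>i. \<bar>h i\<bar> \<le> \<rho>" for h
  proof -
    have "dist (\<chi> i. x i) (\<chi> i. x i + h i) = norm (\<chi> i. h i)"
    proof -
      have "(\<chi> i. x i + h i) - (\<chi> i. x i) = (\<chi> i. h i)" by (simp add: vec_eq_iff)
      then show ?thesis by (metis dist_commute dist_norm)
    qed
    also have "\<dots> \<le> (\<Sum>i\<in>UNIV. \<bar>h i\<bar>)" using norm_le_l1_cart[of "\<chi> i. h i"] by simp
    also have "\<dots> \<le> (\<Sum>i\<in>(UNIV::'n set). \<rho>)" using that by (intro sum_mono) auto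
    also have "\<dots> < r" using \<open>r > 0\<close> by (simp add: \<rho>_def)
    finally have "(\<chi> i. x i + h i) \<in> ball (\<chi> i. x i) r" by simp
    from c[OF this] show ?thesis by (simp add: multi_power_def)
  qed
  \<comment> \<open>Evaluation at the corner (\<rho>, ..., \<rho>): summability over multi-indices
    is unconditional, hence absolute, and this one point provides the majorant for the whole
    polydisc.\<close>
  have "(\<lambda>\<alpha>. c \<alpha> * multi_power (\<lambda>i. of_real \<rho>) \<alpha>) summable_on UNIV"
    using hs[of "\<lambda>_. \<rho>"] \<open>\<rho> > 0\<close> by (auto simp: summable_on_def)
  then have "(\<lambda>\<alpha>. norm (c \<alpha> * multi_power (\<lambda>i. of_real \<rho>) \<alpha>)) summable_on UNIV"
    by (rule summable_on_iff_abs_summable_on_complex[THEN iffD1])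
  moreover have "norm (multi_power (\<lambda>i::'n. complex_of_real \<rho>) \<alpha>) = \<rho> ^ deg \<alpha>" for \<alpha>
    using \<open>\<rho> > 0\<close> by (simp add: multi_power_def deg_def power_sum norm_power flip: prod_norm)
  ultimately have "(\<lambda>\<alpha>. norm (c \<alpha>) * \<rho> ^ deg \<alpha>) summable_on UNIV" by (simp add: norm_mult)
  from power_series_quadratic[OF \<open>\<rho> > 0\<close> this]
  obtain d K where dK: "\<And>s h S. 0 \<le> s \<Longrightarrow> s \<le> \<rho> \<Longrightarrow> (\<forall>i. norm (h i) \<le> s) \<Longrightarrow> ((\<lambda>\<alpha>. c \<alpha> * multi_power h \<alpha>) has_sum S) UNIV \<Longrightarrow>
      norm (S - c (\<lambda>_. 0) - (\<Sum>i\<in>UNIV. d i * h i)) \<le> K * s\<^sup>2"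
    by blast
  have main: "norm (f (\<chi> i. x i + h i) - c (\<lambda>_. 0) - (\<Sum>i\<in>UNIV. d i * of_real (h i))) \<le> K * s\<^sup>2"
    if "0 \<le> s" "s \<le> \<rho>" "\<forall>i. \<bar>h i\<bar> \<le> s" for h s
    using that by (intro dK hs) (auto intro: order_trans)
  from main[of 0 "\<lambda>_. 0"] \<open>\<rho> > 0\<close> have "c (\<lambda>_. 0) = f (\<chi> i. x i)" by simp
  with main \<open>\<rho> > 0\<close> show "\<exists>d K \<delta>. \<delta> > 0 \<and> (\<forall>h s. 0 \<le> s \<longrightarrow> s \<le> \<delta> \<longrightarrow> (\<forall>i. \<bar>h i\<bar> \<le> s) \<longrightarrow>
      norm (f (\<chi> i. x i + h i) - f (\<chi> i. x i) - (\<Sum>i\<in>UNIV. d i * of_real (h i))) \<le> K * s\<^sup>2)"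
    by (intro exI[of _ d] exI[of _ K] exI[of _ \<rho>]) auto
qed

lemma kernel_real_analytic:
  fixes y :: "'n::finite \<Rightarrow> complex"
  assumes "k > 0"
  shows "real_analytic_on UNIV (\<lambda>x. kernel k (\<lambda>i. of_real (x $ i)) y)"
  unfolding real_analytic_on_def
proof
  fix a :: "real ^ 'n"
  obtain B c where c: "power_series_bound 1 B (\<lambda>h. kernel k (\<lambda>i. of_real (a $ i) + h i) y) c"
    using kernel_power_series[OF assms zero_le_one, of "\<lambda>i. of_real (a $ i)" y] by (elim exE)
  show "\<exists>r>0. \<exists>c. \<forall>x\<in>ball a r. ((\<lambda>\<alpha>. c \<alpha> * (\<Prod>i\<in>UNIV. of_real ((x $ i - a $ i) ^ \<alpha> i))) has_sum kernel k (\<lambda>i. of_real (x $ i)) y) UNIV"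
  proof (intro exI[of _ 1] conjI exI[of _ c] ballI)
    fix x assume "x \<in> ball a 1"
    then have "norm (x - a) \<le> 1" by (simp add: dist_norm norm_minus_commute)
    then have "\<forall>i. norm (complex_of_real (x $ i - a $ i)) \<le> 1"
      using component_le_norm_cart[of "x - a"] by (auto simp flip: of_real_diff intro: order_trans)
    then show "((\<lambda>\<alpha>. c \<alpha> * (\<Prod>i\<in>UNIV. of_real ((x $ i - a $ i) ^ \<alpha> i))) has_sum kernel k (\<lambda>i. of_real (x $ i)) y) UNIV"
      using c unfolding power_series_bound_def multi_power_def
      by (auto dest!: spec[of _ "\<lambda>i. complex_of_real (x $ i - a $ i)"] simp: multi_power_def)
  qed simp
qed

lemma partial_i_rpartial: "partial_i i f x = rpartial i (\<lambda>x. f (\<chi> i. x i)) (\<lambda>i. x $ i)"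
proof -
  have "x + t *\<^sub>R axis i 1 = (\<chi> l. ((\<lambda>i. x $ i)(i := x $ i + t)) l)" for t
    by (auto simp: vec_eq_iff axis_def)
  then show ?thesis unfolding partial_i_def rpartial_def by (simp only:)
qed

lemma dunkl_op_rdunkl: "dunkl_op k i f x = rdunkl k i (\<lambda>x. f (\<chi> i. x i)) (\<lambda>i. x $ i)"
proof -
  have "swap_coords i j x = (\<chi> l. ((\<lambda>i. x $ i) \<circ> swp i j) l)" for j
    by (auto simp: vec_eq_iff swap_coords_def Transposition.transpose_def)
  then have sc: "f (\<chi> l. ((\<lambda>i. x $ i) \<circ> swp i j) l) = f (swap_coords i j x)" for j by (simp only:)
  have "(\<Sum>j\<in>UNIV. (f x - f (\<chi> l. ((\<lambda>i. x $ i) \<circ> swp i j) l)) / of_real (x $ i - x $ j))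
    = (\<Sum>j\<in>UNIV - {i}. (f x - f (swap_coords i j x)) / of_real (x $ i - x $ j))"
    unfolding sc by (subst sum.remove[of _ i]) auto
  moreover have "f (\<chi> i. x $ i) = f x" by simp
  ultimately show ?thesis unfolding dunkl_op_def rdunkl_def partial_i_rpartial by (simp only:)
qed

lemma rdunkl_diff:
  assumes "linearizable f" "linearizable g"
  shows "rdunkl k i (\<lambda>x. f x - g x) x = rdunkl k i f x - rdunkl k i g x"
proof -
  have e: "x(i := x i + t) = (\<lambda>l. x l + t * (if l = i then 1 else 0))" for t by auto
  have "((\<lambda>t. f (x(i := x i + t))) has_vector_derivative rpartial i f x) (at 0)" if "linearizable f" for f
  proof -
    have "(\<lambda>t. f (x(i := x i + t))) differentiable at 0"
      unfolding e by (rule differentiableI_vector[OF linearizable_line[OF that]])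
    then show ?thesis unfolding rpartial_def by (rule vector_derivative_works[THEN iffD1])
  qed
  then have "rpartial i (\<lambda>x. f x - g x) x = rpartial i f x - rpartial i g x"
    unfolding rpartial_def[of i "\<lambda>x. f x - g x"] using assms by (intro vector_derivative_at has_vector_derivative_diff)
  moreover have "(\<Sum>j\<in>UNIV. (f x - g x - (f (x \<circ> swp i j) - g (x \<circ> swp i j))) / of_real (x i - x j))
    = (\<Sum>j\<in>UNIV. (f x - f (x \<circ> swp i j)) / of_real (x i - x j)) - (\<Sum>j\<in>UNIV. (g x - g (x \<circ> swp i j)) / of_real (x i - x j))"
    unfolding sum_subtractf[symmetric] diff_divide_distrib[symmetric] by (intro sum.cong) (simp_all add: algebra_simps)
  ultimately show ?thesis
    unfolding rdunkl_def by (simp add: right_diff_distrib)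
qed

lemma linearizable_diff:
  fixes f g :: "('n::finite \<Rightarrow> real) \<Rightarrow> complex"
  assumes "linearizable f" "linearizable g"
  shows "linearizable (\<lambda>x. f x - g x)"
  unfolding linearizable_def
proof
  fix x
  obtain d K \<delta> where 1: "\<delta> > 0" and dK: "\<And>h s. 0 \<le> s \<Longrightarrow> s \<le> \<delta> \<Longrightarrow> (\<forall>i. \<bar>h i\<bar> \<le> s) \<Longrightarrow>
      norm (f (\<lambda>i. x i + h i) - f x - (\<Sum>i\<in>UNIV. d i * of_real (h i))) \<le> K * s\<^sup>2"
    using assms(1) unfolding linearizable_def by blast
  obtain d' K' \<delta>' where 2: "\<delta>' > 0" and dK': "\<And>h s. 0 \<le> s \<Longrightarrow> s \<le> \<delta>' \<Longrightarrow> (\<forall>i. \<bar>h i\<bar> \<le> s) \<Longrightarrow>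
      norm (g (\<lambda>i. x i + h i) - g x - (\<Sum>i\<in>UNIV. d' i * of_real (h i))) \<le> K' * s\<^sup>2"
    using assms(2) unfolding linearizable_def by blast
  show "\<exists>d K \<delta>. \<delta> > 0 \<and> (\<forall>h s. 0 \<le> s \<longrightarrow> s \<le> \<delta> \<longrightarrow> (\<forall>i. \<bar>h i\<bar> \<le> s) \<longrightarrow>
      norm (f (\<lambda>i. x i + h i) - g (\<lambda>i. x i + h i) - (f x - g x) - (\<Sum>i\<in>UNIV. d i * of_real (h i))) \<le> K * s\<^sup>2)"
  proof (rule exI[of _ "\<lambda>i. d i - d' i"], rule exI[of _ "K + K'"], rule exI[of _ "min \<delta> \<delta>'"], intro conjI allI impI)
    fix h :: "'n \<Rightarrow> real" and s :: real assume s: "0 \<le> s" "s \<le> min \<delta> \<delta>'" and h: "\<forall>i. \<bar>h i\<bar> \<le> s"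
    let ?A = "f (\<lambda>i. x i + h i) - f x - (\<Sum>i\<in>UNIV. d i * of_real (h i))"
    let ?B = "g (\<lambda>i. x i + h i) - g x - (\<Sum>i\<in>UNIV. d' i * of_real (h i))"
    have "f (\<lambda>i. x i + h i) - g (\<lambda>i. x i + h i) - (f x - g x) - (\<Sum>i\<in>UNIV. (d i - d' i) * of_real (h i)) = ?A - ?B"
      by (simp add: left_diff_distrib sum_subtractf)
    also have "norm (?A - ?B) \<le> norm ?A + norm ?B" by (rule norm_triangle_ineq4)
    also have "\<dots> \<le> (K + K') * s\<^sup>2" using dK[of s h] dK'[of s h] s h by (simp add: algebra_simps)
    finally show "norm (f (\<lambda>i. x i + h i) - g (\<lambda>i. x i + h i) - (f x - g x) - (\<Sum>i\<in>UNIV. (d i - d' i) * of_real (h i))) \<le> (K + K') * s\<^sup>2" .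
  qed (use 1 2 in auto)
qed

text \<open>Two solutions differ by a solution g with g(0) = 0, and the energy bound for g carries
  the factor |g(0)|^2. This settles points with distinct coordinates; the others follow by a limit
  along an injective direction.\<close>

lemma dunkl_kernel_A_eq:
  fixes z :: "complex ^ 'n::finite"
  assumes k: "k > 0"
  shows "dunkl_kernel_A k x z = kernel k (\<lambda>i. of_real (x $ i)) (\<lambda>i. z $ i)"
proof -
  let ?E = "\<lambda>x :: real ^ 'n. kernel k (\<lambda>i. of_real (x $ i)) (\<lambda>i. z $ i)"
  have "(THE f. real_analytic_on UNIV f \<and> f 0 = 1 \<and>
        (\<forall>i. \<forall>u. distinct_coords u \<longrightarrow> dunkl_op k i f u = z $ i * f u)) = ?E"
  proof (rule the_equality)
    have "dunkl_op k i ?E u = z $ i * ?E u" if "distinct_coords u" for i u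
      using rdunkl_kernel[OF k, of "\<lambda>i. u $ i" i "\<lambda>i. z $ i"] that
      by (auto simp: dunkl_op_rdunkl inj_def distinct_coords_def)
    then show "real_analytic_on UNIV ?E \<and> ?E 0 = 1 \<and> (\<forall>i. \<forall>u. distinct_coords u \<longrightarrow> dunkl_op k i ?E u = z $ i * ?E u)"
      by (intro conjI kernel_real_analytic[OF k]) (simp_all add: kernel_zero_left[OF k])
  next
    fix f assume f: "real_analytic_on UNIV f \<and> f 0 = 1 \<and> (\<forall>i. \<forall>u. distinct_coords u \<longrightarrow> dunkl_op k i f u = z $ i * f u)"
    define g where "g x = f (\<chi> i. x i) - kernel k (\<lambda>i. of_real (x i)) (\<lambda>i. z $ i)" for x
    have lf: "linearizable (\<lambda>x. f (\<chi> i. x i))" using f real_analytic_linearizable by blast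
    then have lg: "linearizable g" unfolding g_def by (intro linearizable_diff kernel_real_linearizable k)
    have Tg: "rdunkl k i g x = z $ i * g x" if "inj x" for x i
    proof -
      have "distinct_coords (\<chi> i. x i)" using that by (auto simp: distinct_coords_def inj_def)
      then have "dunkl_op k i f (\<chi> i. x i) = z $ i * f (\<chi> i. x i)" using f by blast
      then have "rdunkl k i (\<lambda>x. f (\<chi> i. x i)) x = z $ i * f (\<chi> i. x i)" by (simp add: dunkl_op_rdunkl)
      then show ?thesis unfolding g_def rdunkl_diff[OF lf kernel_real_linearizable[OF k]] rdunkl_kernel[OF k that]
        by (simp add: right_diff_distrib)
    qed
    have g0: "g (\<lambda>_. 0) = 0"
      using f kernel_zero_left[OF k, of "\<lambda>i. z $ i"] by (simp add: g_def flip: zero_vec_def)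
    have inj0: "g x = 0" if "inj x" for x
    proof -
      \<comment> \<open>Any common upper bound over the permutations would do, since it enters only
        next to the factor |g(0)|^2 = 0.\<close>
      define M where "M = Max ((\<lambda>\<pi>. Re (pairing (\<lambda>i. of_real (x (\<pi> i))) (\<lambda>i. z $ i))) ` {\<pi>. bij \<pi>})"
      have "(norm (g x))\<^sup>2 \<le> fact CARD('n) * (norm (g (\<lambda>_. 0)))\<^sup>2 * exp (2 * M)"
        by (rule dunkl_energy_bound[OF k lg Tg that]) (auto simp: M_def)
      then show ?thesis using g0 by simp
    qed
    have "g x = 0" for x
    proof -
      obtain v :: "'n \<Rightarrow> real" where v: "inj v" using ex_inj_nonneg by auto
      have "((\<lambda>t. g (\<lambda>i. x i + t * v i)) \<longlongrightarrow> 0) (at_right 0)"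
        by (rule tendsto_eventually, rule eventually_mono[OF eventually_inj_line[OF v, of x]]) (rule inj0)
      then show ?thesis
        using tendsto_unique[OF _ linearizable_limit_line[OF lg]] trivial_limit_at_right_real by blast
    qed
    then have "g (\<lambda>i. x $ i) = 0" for x by blast
    then show "f = ?E" by (simp add: g_def fun_eq_iff)
  qed
  then show ?thesis unfolding dunkl_kernel_A_def by simp
qed

section \<open>Integration by parts on the orthant\<close>

definition pos_line :: "real measure" where
  "pos_line = restrict_space lborel {0<..}"

text \<open>Functions on an index set replace vectors: a coordinate can then be integrated out or
  removed, as the integration by parts and the induction on the dimension require.\<close>

definition orthant :: "'a set \<Rightarrow> ('a \<Rightarrow> real) measure" where
  "orthant I = PiM I (\<lambda>_. pos_line)"

text \<open>Ordered pairs with exponent k give each unordered pair the exponent 2 k. Invariance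
  under swaps becomes a reindexing, and no order on the indices is involved.\<close>

definition weight :: "real \<Rightarrow> 'a set \<Rightarrow> ('a \<Rightarrow> real) \<Rightarrow> real" where
  "weight k I x = (\<Prod>a\<in>I. \<Prod>b\<in>I - {a}. \<bar>x a - x b\<bar> powr k)"

lemma space_pos_line [simp]: "space pos_line = {0<..}"
  by (simp add: pos_line_def space_restrict_space)

lemma space_orthant: "space (orthant I) = PiE I (\<lambda>_. {0<..})"
  by (simp add: orthant_def space_PiM)

lemma orthant_pos: "x \<in> space (orthant I) \<Longrightarrow> i \<in> I \<Longrightarrow> x i > 0"
  by (auto simp: space_orthant PiE_def Pi_def)

lemma orthant_upd: "x \<in> space (orthant (I - {i})) \<Longrightarrow> i \<in> I \<Longrightarrow> t > 0 \<Longrightarrow> x(i := t) \<in> space (orthant I)"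
  by (auto simp: space_orthant PiE_def Pi_def extensional_def)

interpretation pos_line: sigma_finite_measure pos_line
  unfolding pos_line_def by (intro sigma_finite_measure_restrict_space sigma_finite_lborel) auto

interpretation pos_prod: product_sigma_finite "\<lambda>_. pos_line"
  by standard

lemma borel_measurable_pos_line: "f \<in> borel_measurable borel \<Longrightarrow> f \<in> borel_measurable pos_line"
  unfolding pos_line_def by (intro measurable_restrict_space1) simp

lemma measurable_orthant_component: "i \<in> I \<Longrightarrow> (\<lambda>x. x i) \<in> borel_measurable (orthant I)"
  unfolding orthant_def
  by (rule measurable_compose[OF measurable_component_singleton[of i I] borel_measurable_pos_line]) auto

lemma measurable_weight: "weight k I \<in> borel_measurable (orthant I)"
proof -
  have "(\<lambda>u. \<bar>u\<bar> powr k) \<in> borel_measurable (borel :: real measure)" by measurable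
  then have "(\<lambda>x. \<bar>x a - x b\<bar> powr k) \<in> borel_measurable (orthant I)" if "a \<in> I" "b \<in> I" for a b
    using that by (intro measurable_compose[OF borel_measurable_diff] measurable_orthant_component)
  then show ?thesis unfolding weight_def by (intro borel_measurable_prod) auto
qed

lemma weight_nonneg: "weight k I x \<ge> 0"
  unfolding weight_def by (intro prod_nonneg ballI) simp

lemma nn_integral_pos_line: "(\<integral>\<^sup>+t. f t \<partial>pos_line) = (\<integral>\<^sup>+t. f t * indicator {0<..} t \<partial>lborel)"
  unfolding pos_line_def by (subst nn_integral_restrict_space) auto

lemma integrable_pos_line_Gamma:
  fixes s \<epsilon> :: real
  assumes "s > 0" "\<epsilon> > 0"
  shows "integrable pos_line (\<lambda>t. t powr (s - 1) * exp (- \<epsilon> * t))"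
proof -
  have "set_integrable lebesgue {0<..} (\<lambda>t. norm (complex_of_real t powr (of_real s - 1) / of_real (exp (\<epsilon> * t))))"
    by (rule set_integrable_norm[OF absolutely_integrable_Gamma_integral]) (use assms in auto)
  also have "?this \<longleftrightarrow> set_integrable lebesgue {0<..} (\<lambda>t. t powr (s - 1) * exp (- \<epsilon> * t))"
  proof (rule set_integrable_cong)
    fix t :: real assume "t \<in> {0<..}"
    then have "complex_of_real t powr (of_real s - 1) = of_real (t powr (s - 1))"
      using powr_of_real[of t "s - 1"] by simp
    then show "norm (complex_of_real t powr (of_real s - 1) / of_real (exp (\<epsilon> * t))) = t powr (s - 1) * exp (- \<epsilon> * t)"
      unfolding norm_divide norm_of_real by (simp only: norm_of_real) (simp add: exp_minus divide_inverse)
  qed auto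
  finally have "integrable lborel (\<lambda>t. indicator {0<..} t *\<^sub>R (t powr (s - 1) * exp (- \<epsilon> * t)))"
    unfolding set_integrable_def by (subst (asm) integrable_completion) auto
  then show ?thesis unfolding pos_line_def by (subst integrable_restrict_space) auto
qed

lemma integrable_orthant_Gamma:
  assumes "finite I" "s > 0" "\<epsilon> > 0"
  shows "integrable (orthant I) (\<lambda>x. (\<Prod>i\<in>I. x i powr (s - 1)) * exp (- \<epsilon> * (\<Sum>i\<in>I. x i)))"
proof -
  have "integrable (orthant I) (\<lambda>x. \<Prod>i\<in>I. x i powr (s - 1) * exp (- \<epsilon> * x i))"
    unfolding orthant_def by (intro pos_prod.product_integrable_prod assms integrable_pos_line_Gamma)
  then show ?thesis
    using assms(1) by (simp add: prod.distrib exp_sum[symmetric] sum_distrib_left)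
qed

lemma integrable_orthant_exp:
  assumes "finite I" "\<epsilon> > 0"
  shows "integrable (orthant I) (\<lambda>x. exp (- \<epsilon> * (\<Sum>i\<in>I. x i)))"
proof -
  have "(\<Prod>i\<in>I. x i powr (1 - 1)) = 1" if "x \<in> space (orthant I)" for x
    using orthant_pos[OF that] by (intro prod.neutral) force
  then have "integrable (orthant I) (\<lambda>x. exp (- \<epsilon> * (\<Sum>i\<in>I. x i))) \<longleftrightarrow>
     integrable (orthant I) (\<lambda>x. (\<Prod>i\<in>I. x i powr (1 - 1)) * exp (- \<epsilon> * (\<Sum>i\<in>I. x i)))"
    by (intro Bochner_Integration.integrable_cong) auto
  then show ?thesis using integrable_orthant_Gamma[OF assms(1), of 1 \<epsilon>] assms(2) by simp
qed

lemma swp_mem: "i \<in> I \<Longrightarrow> j \<in> I \<Longrightarrow> swp i j a \<in> I \<longleftrightarrow> a \<in> I"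
  by (auto simp: Transposition.transpose_def)

lemma swp_eq_iff: "swp i j a = swp i j b \<longleftrightarrow> a = b"
  by (metis transpose_involutory)

lemma bij_betw_swp: "i \<in> I \<Longrightarrow> j \<in> I \<Longrightarrow> bij_betw (swp i j) I I"
  by (rule bij_betw_byWitness[where f' = "swp i j"]) (auto simp: swp_mem)

lemma orthant_swp_space: "i \<in> I \<Longrightarrow> j \<in> I \<Longrightarrow> x \<in> space (orthant I) \<Longrightarrow> x \<circ> swp i j \<in> space (orthant I)"
  by (auto simp: space_orthant PiE_def Pi_def extensional_def swp_mem)

lemma measurable_orthant_swp:
  assumes "i \<in> I" "j \<in> I"
  shows "(\<lambda>x. x \<circ> swp i j) \<in> measurable (orthant I) (orthant I)"
  unfolding orthant_def
proof (rule measurable_PiM_single')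
  show "(\<lambda>x. (x \<circ> swp i j) a) \<in> measurable (PiM I (\<lambda>_. pos_line)) pos_line" if "a \<in> I" for a
    using that assms by (simp add: comp_def) (intro measurable_component_singleton, simp add: swp_mem)
  show "(\<lambda>x. x \<circ> swp i j) \<in> space (PiM I (\<lambda>_. pos_line)) \<rightarrow> PiE I (\<lambda>_. space pos_line)"
    using orthant_swp_space[OF assms] by (auto simp: orthant_def space_PiM)
qed

lemma distr_orthant_swp:
  assumes "finite I" "i \<in> I" "j \<in> I"
  shows "distr (orthant I) (orthant I) (\<lambda>x. x \<circ> swp i j) = orthant I"
proof -
  have "distr (orthant I) (PiM I (\<lambda>_. pos_line)) (\<lambda>x. x \<circ> swp i j) = PiM I (\<lambda>_. pos_line)"
  proof (rule pos_prod.PiM_eqI)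
    fix A :: "'a \<Rightarrow> real set" assume A: "\<And>i. i \<in> I \<Longrightarrow> A i \<in> sets pos_line"
    have "(\<lambda>x. x \<circ> swp i j) -` PiE I A \<inter> space (orthant I) = PiE I (\<lambda>a. A (swp i j a))"
    proof (intro set_eqI iffI)
      fix x assume "x \<in> (\<lambda>x. x \<circ> swp i j) -` PiE I A \<inter> space (orthant I)"
      then have x: "\<And>a. a \<in> I \<Longrightarrow> x (swp i j a) \<in> A a" and e: "x \<in> extensional I" by (auto simp: PiE_def space_orthant)
      have "x a \<in> A (swp i j a)" if "a \<in> I" for a
        using x[of "swp i j a"] that assms by (simp add: swp_mem)
      then show "x \<in> PiE I (\<lambda>a. A (swp i j a))" using e by (auto simp: PiE_def)
    next
      fix x assume x: "x \<in> PiE I (\<lambda>a. A (swp i j a))"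
      have "x a > 0" if "a \<in> I" for a
      proof -
        have "A (swp i j a) \<subseteq> {0<..}" using sets.sets_into_space[OF A[of "swp i j a"]] that assms by (simp add: swp_mem)
        then show ?thesis using x that by (auto simp: PiE_def)
      qed
      moreover have "x (swp i j a) \<in> A a" if "a \<in> I" for a
        using PiE_mem[OF x, of "swp i j a"] that assms by (simp add: swp_mem)
      ultimately show "x \<in> (\<lambda>x. x \<circ> swp i j) -` PiE I A \<inter> space (orthant I)"
        using x assms by (auto simp: PiE_def space_orthant extensional_def swp_mem)
    qed
    then have "emeasure (distr (orthant I) (PiM I (\<lambda>_. pos_line)) (\<lambda>x. x \<circ> swp i j)) (PiE I A) = emeasure (orthant I) (PiE I (\<lambda>a. A (swp i j a)))"
      using measurable_orthant_swp[OF assms(2,3)] A assms(1)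
      by (subst emeasure_distr) (auto simp: orthant_def intro!: sets_PiM_I_finite)
    also have "\<dots> = (\<Prod>a\<in>I. emeasure pos_line (A (swp i j a)))"
      unfolding orthant_def by (rule pos_prod.emeasure_PiM) (use assms A in \<open>auto simp: swp_mem\<close>)
    also have "\<dots> = (\<Prod>a\<in>I. emeasure pos_line (A a))"
      by (rule prod.reindex_bij_betw[OF bij_betw_swp[OF assms(2,3)]])
    finally show "emeasure (distr (orthant I) (PiM I (\<lambda>_. pos_line)) (\<lambda>x. x \<circ> swp i j)) (PiE I A) = (\<Prod>i\<in>I. emeasure pos_line (A i))" .
  qed (use assms in auto)
  then show ?thesis by (simp add: orthant_def)
qed

lemma
  fixes f :: "('a \<Rightarrow> real) \<Rightarrow> 'b::{banach, second_countable_topology}"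
  assumes "finite I" "i \<in> I" "j \<in> I" "f \<in> borel_measurable (orthant I)"
  shows integral_orthant_swp: "(\<integral>x. f (x \<circ> swp i j) \<partial>orthant I) = (\<integral>x. f x \<partial>orthant I)"
    and integrable_orthant_swp: "integrable (orthant I) (\<lambda>x. f (x \<circ> swp i j)) \<longleftrightarrow> integrable (orthant I) f"
  using integral_distr[OF measurable_orthant_swp[OF assms(2,3)] assms(4)]
    integrable_distr_eq[OF measurable_orthant_swp[OF assms(2,3)] assms(4)]
  by (simp_all add: distr_orthant_swp[OF assms(1-3)])

lemma prod_off_diagonal:
  assumes "finite I"
  shows "(\<Prod>a\<in>I. \<Prod>b\<in>I - {a}. g a b) = (\<Prod>p\<in>{p \<in> I \<times> I. fst p \<noteq> snd p}. g (fst p) (snd p))"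
proof -
  have "(\<Prod>a\<in>I. \<Prod>b\<in>I - {a}. g a b) = (\<Prod>(a,b)\<in>Sigma I (\<lambda>a. I - {a}). g a b)"
    by (rule prod.Sigma) (use assms in auto)
  moreover have "Sigma I (\<lambda>a. I - {a}) = {p \<in> I \<times> I. fst p \<noteq> snd p}" by auto
  ultimately show ?thesis by (simp add: case_prod_unfold)
qed

lemma weight_swp:
  assumes "finite I" "i \<in> I" "j \<in> I"
  shows "weight k I (x \<circ> swp i j) = weight k I x"
proof -
  let ?D = "{p \<in> I \<times> I. fst p \<noteq> snd p}"
  let ?s = "\<lambda>p. (swp i j (fst p), swp i j (snd p))"
  have "bij_betw ?s ?D ?D"
    by (rule bij_betw_byWitness[where f' = ?s]) (use assms in \<open>auto simp: swp_mem swp_eq_iff\<close>)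
  from prod.reindex_bij_betw[OF this, of "\<lambda>p. \<bar>x (fst p) - x (snd p)\<bar> powr k"]
  show ?thesis unfolding weight_def prod_off_diagonal[OF assms(1)] by simp
qed

section \<open>Growth of the weight and its singularities on the diagonals\<close>

lemma powr_le_exp:
  fixes p \<delta> :: real
  assumes "p \<ge> 0" "\<delta> > 0"
  shows "\<exists>C>0. \<forall>S\<ge>0. (1 + S) powr p \<le> C * exp (\<delta> * S)"
proof -
  \<comment> \<open>The estimate is ln u <= u at u = (1 + S) c, with c small enough that p c <=
    \<delta>; the term - p ln c goes into the constant.\<close>
  define c where "c = \<delta> / (p + 1)"
  have c: "c > 0" "p * c \<le> \<delta>" using assms by (auto simp: c_def field_simps)
  have "(1 + S) powr p \<le> exp (\<delta> - p * ln c) * exp (\<delta> * S)" if "S \<ge> 0" for S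
  proof -
    have "ln (1 + S) + ln c = ln ((1 + S) * c)" using that c by (simp add: ln_mult)
    also have "\<dots> \<le> (1 + S) * c" using ln_bound[of "(1 + S) * c"] that c by simp
    finally have "p * (ln (1 + S) + ln c) \<le> p * ((1 + S) * c)" using assms by (intro mult_left_mono)
    also have "\<dots> = (1 + S) * (p * c)" by simp
    also have "\<dots> \<le> (1 + S) * \<delta>" using that c by (intro mult_left_mono) auto
    finally have "p * ln (1 + S) \<le> \<delta> - p * ln c + \<delta> * S" by (simp add: algebra_simps)
    then show ?thesis using that by (simp add: powr_def flip: exp_add)
  qed
  then show ?thesis by (intro exI[of _ "exp (\<delta> - p * ln c)"]) auto
qed

lemma abs_diff_le_sum:
  assumes "finite I" "a \<in> I" "b \<in> I" "\<And>i. i \<in> I \<Longrightarrow> x i \<ge> (0::real)"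
  shows "\<bar>x a - x b\<bar> \<le> 1 + (\<Sum>i\<in>I. x i)"
proof -
  have "x a \<le> sum x I" "x b \<le> sum x I" using assms by (auto intro: member_le_sum)
  then show ?thesis using assms(4)[of a] assms(4)[of b] assms(2,3) by linarith
qed

lemma prod_powr_le:
  fixes k S :: real and f :: "'a \<Rightarrow> real"
  assumes "finite D" "k \<ge> 0" "\<And>p. p \<in> D \<Longrightarrow> \<bar>f p\<bar> \<le> S" "1 \<le> S"
  shows "(\<Prod>p\<in>D. \<bar>f p\<bar> powr k) \<le> S powr (k * card D)"
proof -
  have "(\<Prod>p\<in>D. \<bar>f p\<bar> powr k) \<le> (\<Prod>p\<in>D. S powr k)"
    by (intro prod_mono conjI powr_mono2 assms) auto
  also have "\<dots> = (S powr k) powr card D" using assms(4) by (subst powr_realpow) auto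
  also have "\<dots> = S powr (k * card D)" by (rule powr_powr)
  finally show ?thesis .
qed

lemma weight_bound:
  assumes "finite I" "k \<ge> 0" "\<delta> > 0"
  shows "\<exists>C>0. \<forall>x. (\<forall>i\<in>I. x i \<ge> 0) \<longrightarrow> weight k I x \<le> C * exp (\<delta> * (\<Sum>i\<in>I. x i))"
proof -
  let ?D = "{p \<in> I \<times> I. fst p \<noteq> snd p}"
  obtain C where C: "C > 0" "\<And>S. S \<ge> 0 \<Longrightarrow> (1 + S) powr (k * card ?D) \<le> C * exp (\<delta> * S)"
    using powr_le_exp[of "k * card ?D" \<delta>] assms by auto
  have "weight k I x \<le> C * exp (\<delta> * (\<Sum>i\<in>I. x i))" if "\<forall>i\<in>I. x i \<ge> 0" for x
  proof -
    have S: "sum x I \<ge> 0" using that by (simp add: sum_nonneg)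
    have "weight k I x \<le> (1 + sum x I) powr (k * card ?D)"
      unfolding weight_def prod_off_diagonal[OF assms(1)]
      by (rule prod_powr_le) (use that S assms abs_diff_le_sum[OF assms(1)] in auto)
    also have "\<dots> \<le> C * exp (\<delta> * (\<Sum>i\<in>I. x i))" by (rule C(2)[OF S])
    finally show ?thesis .
  qed
  then show ?thesis using C(1) by blast
qed

text \<open>The factors for (i, j) and (j, i) combine to |x_i - x_j|^(2 k), so the division leaves
  the exponent 2 k - 1. It may be negative but exceeds -1, which is what integrability asks
  for.\<close>

lemma weight_div_bound:
  assumes "finite I" "k > 0" "\<delta> > 0" "i \<in> I" "j \<in> I" "i \<noteq> j"
  shows "\<exists>C>0. \<forall>x. (\<forall>i\<in>I. x i \<ge> 0) \<longrightarrow> weight k I x / \<bar>x i - x j\<bar> \<le> C * exp (\<delta> * (\<Sum>i\<in>I. x i)) * \<bar>x i - x j\<bar> powr (2 * k - 1)"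
proof -
  let ?D = "{p \<in> I \<times> I. fst p \<noteq> snd p}"
  let ?D' = "?D - {(i,j)} - {(j,i)}"
  obtain C where C: "C > 0" "\<And>S. S \<ge> 0 \<Longrightarrow> (1 + S) powr (k * card ?D') \<le> C * exp (\<delta> * S)"
    using powr_le_exp[of "k * card ?D'" \<delta>] assms by auto
  have "weight k I x / \<bar>x i - x j\<bar> \<le> C * exp (\<delta> * (\<Sum>i\<in>I. x i)) * \<bar>x i - x j\<bar> powr (2 * k - 1)" if "\<forall>i\<in>I. x i \<ge> 0" for x
  proof (cases "x i = x j")
    case False
    have S: "sum x I \<ge> 0" using that by (simp add: sum_nonneg)
    let ?g = "\<lambda>p. \<bar>x (fst p) - x (snd p)\<bar> powr k"
    have "weight k I x = ?g (i,j) * (?g (j,i) * prod ?g ?D')"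
      unfolding weight_def prod_off_diagonal[OF assms(1)]
      using assms by (subst prod.remove[of _ "(i,j)"], simp, simp, subst prod.remove[of _ "(j,i)"]) auto
    also have "\<dots> = \<bar>x i - x j\<bar> powr (2 * k) * prod ?g ?D'"
      by (simp add: abs_minus_commute mult.assoc[symmetric] powr_add[symmetric])
    finally have eq: "weight k I x / \<bar>x i - x j\<bar> = prod ?g ?D' * \<bar>x i - x j\<bar> powr (2 * k - 1)"
      using False by (simp add: powr_diff)
    have "prod ?g ?D' \<le> (1 + sum x I) powr (k * card ?D')"
      by (rule prod_powr_le) (use that S assms abs_diff_le_sum[OF assms(1)] in auto)
    also have "\<dots> \<le> C * exp (\<delta> * (\<Sum>i\<in>I. x i))" by (rule C(2)[OF S])
    finally show ?thesis unfolding eq by (rule mult_right_mono) simp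
  qed simp
  then show ?thesis using C(1) by blast
qed

lemma nn_integral_singular_finite:
  fixes k :: real
  assumes "k > 0"
  defines "\<psi> \<equiv> (\<lambda>u::real. \<bar>u\<bar> powr (2 * k - 1) * indicator {-1..1} u)"
  shows "(\<integral>\<^sup>+u. ennreal (\<psi> u) \<partial>lborel) < \<infinity>"
proof -
  define \<phi> where "\<phi> = (\<lambda>u::real. ennreal (u powr (2 * k - 1)) * indicator {0..1} u)"
  have [measurable]: "\<phi> \<in> borel_measurable borel" unfolding \<phi>_def by measurable
  have "(\<integral>\<^sup>+u. \<phi> u \<partial>lborel) = ennreal (1 powr (2 * k - 1 + 1) / (2 * k - 1 + 1))"
    unfolding \<phi>_def by (rule nn_integral_has_integral_lebesgue'[OF _ has_integral_powr_from_0]) (use assms in auto)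
  then have fin: "(\<integral>\<^sup>+u. \<phi> u \<partial>lborel) < \<infinity>" by simp
  have "(\<integral>\<^sup>+u. ennreal (\<psi> u) \<partial>lborel) \<le> (\<integral>\<^sup>+u. \<phi> u + \<phi> (- u) \<partial>lborel)"
    by (intro nn_integral_mono) (auto simp: \<psi>_def \<phi>_def indicator_def)
  also have "\<dots> = (\<integral>\<^sup>+u. \<phi> u \<partial>lborel) + (\<integral>\<^sup>+u. \<phi> (- u) \<partial>lborel)"
    by (intro nn_integral_add) auto
  also have "(\<integral>\<^sup>+u. \<phi> (- u) \<partial>lborel) = (\<integral>\<^sup>+u. \<phi> u \<partial>lborel)"
    using nn_integral_real_affine[of \<phi> "-1" 0] by simp
  finally show ?thesis using fin by (simp add: top.not_eq_extremum order_le_less_trans)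
qed

lemma measurable_orthant_exp: "(\<lambda>x. exp (c * (\<Sum>i\<in>I. x i))) \<in> borel_measurable (orthant I)"
  by (rule measurable_compose[OF _ borel_measurable_exp])
     (intro borel_measurable_times borel_measurable_const borel_measurable_sum measurable_orthant_component)

text \<open>The cutoff \<open>\<psi>\<close> isolates |x_i - x_j| <= 1: there x_i is integrated
  first, and a translation gives a constant independent of the other coordinates. Farther away the
  power is at most (1 + S)^(2 k), with S the sum of the coordinates, and half of the exponential
  absorbs it.\<close>

lemma integrable_orthant_singular:
  fixes k \<epsilon> :: real
  assumes "finite I" "i \<in> I" "j \<in> I" "i \<noteq> j" "k > 0" "\<epsilon> > 0"
  shows "integrable (orthant I) (\<lambda>x. exp (- \<epsilon> * (\<Sum>i\<in>I. x i)) * \<bar>x i - x j\<bar> powr (2 * k - 1))"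
proof -
  define \<psi> where "\<psi> = (\<lambda>u::real. \<bar>u\<bar> powr (2 * k - 1) * indicator {-1..1} u)"
  have [measurable]: "\<psi> \<in> borel_measurable borel" unfolding \<psi>_def by measurable
  have cm: "(\<lambda>t. ennreal (\<psi> (t - c))) \<in> borel_measurable lborel" for c by measurable
  have \<psi>0: "\<psi> u \<ge> 0" for u by (simp add: \<psi>_def)
  define J where "J = I - {i}"
  have J: "finite J" "i \<notin> J" "I = insert i J" "j \<in> J"
    unfolding J_def using assms(1-4) by (simp_all add: insert_absorb)
  define g where "g = (\<lambda>x. exp (- \<epsilon> * (\<Sum>i\<in>I. x i)) * \<psi> (x i - x j))"
  have gm: "g \<in> borel_measurable (orthant I)"
    unfolding g_def by (intro borel_measurable_times measurable_orthant_exp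
        measurable_compose[OF borel_measurable_diff \<open>\<psi> \<in> borel_measurable borel\<close>] measurable_orthant_component assms(2,3))
  define K where "K = (\<integral>\<^sup>+u. ennreal (\<psi> u) \<partial>lborel)"
  have K: "K < \<infinity>" unfolding K_def \<psi>_def using nn_integral_singular_finite[OF \<open>k > 0\<close>] .
  have "(\<integral>\<^sup>+x. ennreal (g x) \<partial>orthant I) = (\<integral>\<^sup>+x. \<integral>\<^sup>+t. ennreal (g (x(i := t))) \<partial>pos_line \<partial>orthant J)"
    unfolding orthant_def J(3) by (rule pos_prod.product_nn_integral_insert) (use J gm in \<open>auto simp: orthant_def\<close>)
  also have "\<dots> \<le> (\<integral>\<^sup>+x. ennreal (exp (- \<epsilon> * (\<Sum>i\<in>J. x i))) * K \<partial>orthant J)"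
  proof (rule nn_integral_mono)
    fix x assume x: "x \<in> space (orthant J)"
    have "(\<integral>\<^sup>+t. ennreal (g (x(i := t))) \<partial>pos_line) \<le> (\<integral>\<^sup>+t. ennreal (exp (- \<epsilon> * (\<Sum>i\<in>J. x i)) * \<psi> (t - x j)) \<partial>lborel)"
      unfolding nn_integral_pos_line
    proof (intro nn_integral_mono)
      fix t :: real
      show "ennreal (g (x(i := t))) * indicator {0<..} t \<le> ennreal (exp (- \<epsilon> * (\<Sum>i\<in>J. x i)) * \<psi> (t - x j))"
      proof (cases "t > 0")
        case True
        have "(\<Sum>a\<in>I. (x(i := t)) a) = t + (\<Sum>a\<in>J. x a)"
        proof -
          have "(\<Sum>a\<in>J. (x(i := t)) a) = (\<Sum>a\<in>J. x a)" by (rule sum.cong) (use J(2) in auto)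
          then show ?thesis unfolding J(3) sum.insert[OF J(1,2)] by simp
        qed
        then have "g (x(i := t)) = exp (- \<epsilon> * (t + (\<Sum>a\<in>J. x a))) * \<psi> (t - x j)"
          using \<open>i \<noteq> j\<close> by (simp add: g_def)
        also have "\<dots> \<le> exp (- \<epsilon> * (\<Sum>i\<in>J. x i)) * \<psi> (t - x j)"
          using True \<open>\<epsilon> > 0\<close> \<psi>0 by (intro mult_right_mono) auto
        finally have "ennreal (g (x(i := t))) \<le> ennreal (exp (- \<epsilon> * (\<Sum>i\<in>J. x i)) * \<psi> (t - x j))" by (rule ennreal_leI)
        then show ?thesis using True by simp
      qed simp
    qed
    also have "\<dots> = ennreal (exp (- \<epsilon> * (\<Sum>i\<in>J. x i))) * (\<integral>\<^sup>+t. ennreal (\<psi> (t - x j)) \<partial>lborel)"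
      unfolding ennreal_mult[OF exp_ge_zero \<psi>0] by (rule nn_integral_cmult[OF cm])
    also have "(\<integral>\<^sup>+t. ennreal (\<psi> (t - x j)) \<partial>lborel) = K"
    proof -
      have m: "(\<lambda>u. ennreal (\<psi> u)) \<in> borel_measurable borel" by measurable
      have e: "\<psi> (t - x j) = \<psi> (- x j + 1 * t)" for t by simp
      show ?thesis unfolding K_def e using nn_integral_real_affine[OF m one_neq_zero, of "- x j"]
        by (simp only: abs_one ennreal_1 mult_1_left)
    qed
    finally show "(\<integral>\<^sup>+t. ennreal (g (x(i := t))) \<partial>pos_line) \<le> ennreal (exp (- \<epsilon> * (\<Sum>i\<in>J. x i))) * K" .
  qed
  also have "\<dots> = (\<integral>\<^sup>+x. ennreal (exp (- \<epsilon> * (\<Sum>i\<in>J. x i))) \<partial>orthant J) * K"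
    by (intro nn_integral_multc measurable_compose[OF measurable_orthant_exp measurable_ennreal])
  also have "\<dots> < \<infinity>"
  proof -
    have "(\<integral>\<^sup>+x. ennreal (exp (- \<epsilon> * (\<Sum>i\<in>J. x i))) \<partial>orthant J) = ennreal (\<integral>x. exp (- \<epsilon> * (\<Sum>i\<in>J. x i)) \<partial>orthant J)"
      by (rule nn_integral_eq_integral[OF integrable_orthant_exp[OF J(1) \<open>\<epsilon> > 0\<close>] AE_I2]) (rule exp_ge_zero)
    then show ?thesis using K by (simp only:) (auto simp: ennreal_mult_less_top)
  qed
  finally have g: "integrable (orthant I) g"
    by (intro integrableI_nonneg[OF gm AE_I2]) (auto simp: g_def \<psi>0)
  obtain C where C: "C > 0" "\<And>S. S \<ge> 0 \<Longrightarrow> (1 + S) powr (2 * k) \<le> C * exp (\<epsilon> / 2 * S)"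
    using powr_le_exp[of "2 * k" "\<epsilon> / 2"] assms by auto
  have "integrable (orthant I) (\<lambda>x. g x + C * exp (- (\<epsilon> / 2) * (\<Sum>i\<in>I. x i)))"
    by (intro Bochner_Integration.integrable_add g integrable_mult_right integrable_orthant_exp) (use assms in auto)
  then show ?thesis
  proof (rule Bochner_Integration.integrable_bound)
    show "AE x in orthant I. norm (exp (- \<epsilon> * (\<Sum>i\<in>I. x i)) * \<bar>x i - x j\<bar> powr (2 * k - 1))
       \<le> norm (g x + C * exp (- (\<epsilon> / 2) * (\<Sum>i\<in>I. x i)))"
    proof (rule AE_I2)
      fix x assume x: "x \<in> space (orthant I)"
      let ?S = "\<Sum>i\<in>I. x i"
      have S: "?S \<ge> 0" using orthant_pos[OF x] by (intro sum_nonneg) (auto intro: less_imp_le)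
      have le: "\<bar>x i - x j\<bar> \<le> 1 + ?S"
        using abs_diff_le_sum[OF assms(1-3)] orthant_pos[OF x] by (auto intro: less_imp_le)
      have "\<bar>x i - x j\<bar> powr (2 * k - 1) \<le> \<psi> (x i - x j) + (1 + ?S) powr (2 * k)"
      proof (cases "\<bar>x i - x j\<bar> \<le> 1")
        case True
        then show ?thesis by (auto simp: \<psi>_def indicator_def abs_le_iff)
      next
        case False
        then have "\<bar>x i - x j\<bar> powr (2 * k - 1) \<le> \<bar>x i - x j\<bar> powr (2 * k)" by (intro powr_mono) auto
        also have "\<dots> \<le> (1 + ?S) powr (2 * k)" using le assms by (intro powr_mono2) auto
        finally show ?thesis using \<psi>0[of "x i - x j"] by linarith
      qed
      also have "\<dots> \<le> \<psi> (x i - x j) + C * exp (\<epsilon> / 2 * ?S)" using C(2)[OF S] by simp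
      finally have "exp (- \<epsilon> * ?S) * \<bar>x i - x j\<bar> powr (2 * k - 1) \<le> exp (- \<epsilon> * ?S) * (\<psi> (x i - x j) + C * exp (\<epsilon> / 2 * ?S))"
        by (intro mult_left_mono) auto
      also have "\<dots> = g x + C * (exp (- \<epsilon> * ?S) * exp (\<epsilon> / 2 * ?S))" by (simp add: g_def algebra_simps)
      also have "exp (- \<epsilon> * ?S) * exp (\<epsilon> / 2 * ?S) = exp (- (\<epsilon> / 2) * ?S)" by (simp flip: exp_add)
      finally show "norm (exp (- \<epsilon> * ?S) * \<bar>x i - x j\<bar> powr (2 * k - 1)) \<le> norm (g x + C * exp (- (\<epsilon> / 2) * ?S))"
        by (simp add: abs_mult)
    qed
  next
    have "(\<lambda>u. \<bar>u\<bar> powr (2 * k - 1)) \<in> borel_measurable (borel :: real measure)" by measurable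
    from measurable_compose[OF borel_measurable_diff this, OF measurable_orthant_component measurable_orthant_component, OF assms(2,3)]
    show "(\<lambda>x. exp (- \<epsilon> * (\<Sum>i\<in>I. x i)) * \<bar>x i - x j\<bar> powr (2 * k - 1)) \<in> borel_measurable (orthant I)"
      by (intro borel_measurable_times measurable_orthant_exp)
  qed
qed

section \<open>Skew-adjointness of the Dunkl operators\<close>

lemma ftc_pos_line:
  fixes v v' :: "real \<Rightarrow> complex"
  assumes int: "integrable pos_line v'" and "finite S"
    and der: "\<And>t. t > 0 \<Longrightarrow> t \<notin> S \<Longrightarrow> (v has_vector_derivative v' t) (at t)"
    and cont: "continuous_on {0..} v" and lim: "(v \<longlongrightarrow> 0) at_top"
  shows "(\<integral>t. v' t \<partial>pos_line) = - v 0"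
proof -
  have set: "set_integrable lborel {0<..} v'"
    using int unfolding pos_line_def set_integrable_def by (subst (asm) integrable_restrict_space) auto
  have part: "(\<integral>t. indicator {..<b} t *\<^sub>R v' t \<partial>pos_line) = v b - v 0" if "b \<ge> 0" for b
  proof -
    have "(v' has_integral (v b - v 0)) {0..b}"
      by (rule fundamental_theorem_of_calculus_interior_strong[OF \<open>finite S\<close> that])
         (use der in \<open>auto intro: continuous_on_subset[OF cont]\<close>)
    then have "(v' has_integral (v b - v 0)) {0<..<b}" by (simp add: has_integral_Icc_iff_Ioo)
    then have "integral {0<..<b} v' = v b - v 0" by (rule integral_unique)
    moreover have "set_integrable lborel {0<..<b} v'" by (rule set_integrable_subset[OF set]) auto
    ultimately have "(LINT t:{0<..<b}|lborel. v' t) = v b - v 0"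
      using set_borel_integral_eq_integral(2) by metis
    moreover have "(\<integral>t. indicator {..<b} t *\<^sub>R v' t \<partial>pos_line) = (LINT t:{0<..<b}|lborel. v' t)"
      unfolding pos_line_def set_lebesgue_integral_def
      by (subst integral_restrict_space) (auto intro!: Bochner_Integration.integral_cong simp: indicator_def)
    ultimately show ?thesis by simp
  qed
  \<comment> \<open>Truncation at n with majorant |v'|. As v(n) tends to 0, only the value at 0
    survives in the limit.\<close>
  have "(\<lambda>n. \<integral>t. indicator {..<real n} t *\<^sub>R v' t \<partial>pos_line) \<longlonglongrightarrow> (\<integral>t. v' t \<partial>pos_line)"
  proof (rule integral_dominated_convergence[where w = "\<lambda>t. norm (v' t)"])
    show "v' \<in> borel_measurable pos_line" using int by auto
    have [measurable]: "(\<lambda>t. indicator {..<real n} t :: real) \<in> borel_measurable pos_line" for n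
      by (intro borel_measurable_pos_line) measurable
    show "(\<lambda>t. indicator {..<real n} t *\<^sub>R v' t) \<in> borel_measurable pos_line" for n
      using int by (intro borel_measurable_scaleR) auto
    show "AE t in pos_line. (\<lambda>n. indicator {..<real n} t *\<^sub>R v' t) \<longlonglongrightarrow> v' t"
    proof (rule AE_I2, rule tendsto_eventually)
      fix t :: real
      obtain N where "t < real N" using reals_Archimedean2 by blast
      then show "eventually (\<lambda>n. indicator {..<real n} t *\<^sub>R v' t = v' t) sequentially"
        by (intro eventually_sequentiallyI[of N]) (auto simp: indicator_def)
    qed
  qed (use int in \<open>auto simp: indicator_def\<close>)
  moreover have "(\<lambda>n. v (real n) - v 0) \<longlonglongrightarrow> 0 - v 0"
    by (intro tendsto_intros filterlim_compose[OF lim filterlim_real_sequentially])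
  ultimately show ?thesis using part LIMSEQ_unique by fastforce
qed

lemma weight_fun_upd:
  assumes "finite I" "i \<in> I"
  shows "weight k I (x(i := t)) = weight k (I - {i}) x * (\<Prod>j\<in>I - {i}. \<bar>t - x j\<bar> powr (2 * k))"
proof -
  let ?J = "I - {i}"
  have "weight k I (x(i := t)) = (\<Prod>b\<in>?J. \<bar>t - x b\<bar> powr k) * (\<Prod>a\<in>?J. \<Prod>b\<in>I - {a}. \<bar>(x(i := t)) a - (x(i := t)) b\<bar> powr k)"
    unfolding weight_def using assms by (subst prod.remove[of _ i]) (auto intro!: prod.cong)
  also have "(\<Prod>a\<in>?J. \<Prod>b\<in>I - {a}. \<bar>(x(i := t)) a - (x(i := t)) b\<bar> powr k)
    = (\<Prod>a\<in>?J. \<bar>t - x a\<bar> powr k * (\<Prod>b\<in>?J - {a}. \<bar>x a - x b\<bar> powr k))"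
  proof (rule prod.cong)
    fix a assume a: "a \<in> ?J"
    then have "I - {a} - {i} = ?J - {a}" by auto
    then show "(\<Prod>b\<in>I - {a}. \<bar>(x(i := t)) a - (x(i := t)) b\<bar> powr k) = \<bar>t - x a\<bar> powr k * (\<Prod>b\<in>?J - {a}. \<bar>x a - x b\<bar> powr k)"
      using a assms by (subst prod.remove[of _ i]) (auto simp: abs_minus_commute intro!: prod.cong)
  qed simp
  also have "\<dots> = (\<Prod>a\<in>?J. \<bar>t - x a\<bar> powr k) * weight k ?J x"
    unfolding weight_def by (rule prod.distrib)
  also have "(\<Prod>b\<in>?J. \<bar>t - x b\<bar> powr k) * ((\<Prod>a\<in>?J. \<bar>t - x a\<bar> powr k) * weight k ?J x)
    = weight k ?J x * (\<Prod>b\<in>?J. \<bar>t - x b\<bar> powr k * \<bar>t - x b\<bar> powr k)"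
    unfolding prod.distrib by (simp only: mult_ac)
  also have "\<dots> = weight k ?J x * (\<Prod>b\<in>?J. \<bar>t - x b\<bar> powr (2 * k))"
    unfolding powr_add[symmetric] mult_2 ..
  finally show ?thesis .
qed

text \<open>Writing |u|^p as (u^2)^(p / 2) covers both signs of t - c at once.\<close>

lemma DERIV_abs_powr:
  fixes p c t :: real
  assumes "t \<noteq> c"
  shows "((\<lambda>t. \<bar>t - c\<bar> powr p) has_real_derivative p * \<bar>t - c\<bar> powr p / (t - c)) (at t)"
proof -
  have sq: "\<bar>u\<bar> powr q = (u\<^sup>2) powr (q / 2)" for u q :: real
  proof -
    have "u\<^sup>2 = \<bar>u\<bar> powr 2" by (cases "u = 0") auto
    then show ?thesis by (simp only: powr_powr) simp
  qed
  have "((\<lambda>t. ((t - c)\<^sup>2) powr (p / 2)) has_real_derivative (p / 2) * ((t - c)\<^sup>2) powr (p / 2 - 1) * (2 * (t - c))) (at t)"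
  proof -
    have "(t - c)\<^sup>2 > 0" using assms by simp
    then show ?thesis by (auto intro!: derivative_eq_intros)
  qed
  moreover have "(p / 2) * ((t - c)\<^sup>2) powr (p / 2 - 1) * (2 * (t - c)) = p * \<bar>t - c\<bar> powr p / (t - c)"
  proof -
    have d: "((t - c)\<^sup>2) powr (p / 2 - 1) = \<bar>t - c\<bar> powr p / (t - c)\<^sup>2"
      using powr_diff[of "(t - c)\<^sup>2" "p / 2" 1] assms by (simp add: sq)
    have "(p / 2) * (A / u\<^sup>2) * (2 * u) = p * A / u" if "u \<noteq> 0" for A u :: real
      using that by (simp add: power2_eq_square)
    from this[of "t - c" "\<bar>t - c\<bar> powr p"] show ?thesis unfolding d using assms by (simp only: right_minus_eq) simp
  qed
  ultimately show ?thesis unfolding sq by (simp only:)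
qed

text \<open>Logarithmic derivatives add under products. The field is left general because the rule
  serves the weight over the reals and D(z)^mu over the complex numbers.\<close>

lemma DERIV_prod_log:
  fixes g l :: "'a \<Rightarrow> 'b::real_normed_field \<Rightarrow> 'b"
  assumes "finite J" "\<And>j. j \<in> J \<Longrightarrow> (g j has_field_derivative g j t * l j t) (at t)"
  shows "((\<lambda>t. \<Prod>j\<in>J. g j t) has_field_derivative (\<Prod>j\<in>J. g j t) * (\<Sum>j\<in>J. l j t)) (at t)"
  using assms
proof (induction J)
  case (insert a J)
  then have "((\<lambda>t. g a t * (\<Prod>j\<in>J. g j t)) has_field_derivative
     g a t * l a t * (\<Prod>j\<in>J. g j t) + (\<Prod>j\<in>J. g j t) * (\<Sum>j\<in>J. l j t) * g a t) (at t)"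
    by (intro DERIV_mult) auto
  then show ?case using insert by (simp add: algebra_simps)
qed simp

lemma DERIV_weight:
  assumes "finite I" "i \<in> I" "\<And>j. j \<in> I - {i} \<Longrightarrow> t \<noteq> x j"
  shows "((\<lambda>t. weight k I (x(i := t))) has_real_derivative weight k I (x(i := t)) * (\<Sum>j\<in>I - {i}. 2 * k / (t - x j))) (at t)"
proof -
  have "((\<lambda>t. \<Prod>j\<in>I - {i}. \<bar>t - x j\<bar> powr (2 * k)) has_real_derivative
     (\<Prod>j\<in>I - {i}. \<bar>t - x j\<bar> powr (2 * k)) * (\<Sum>j\<in>I - {i}. 2 * k / (t - x j))) (at t)"
  proof (rule DERIV_prod_log)
    fix j assume "j \<in> I - {i}"
    then show "((\<lambda>t. \<bar>t - x j\<bar> powr (2 * k)) has_real_derivative \<bar>t - x j\<bar> powr (2 * k) * (2 * k / (t - x j))) (at t)"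
      using DERIV_abs_powr[of t "x j" "2 * k"] assms(3) by (simp add: mult.commute)
  qed (use assms in auto)
  from DERIV_cmult[OF this, of "weight k (I - {i}) x"] show ?thesis
    unfolding weight_fun_upd[OF assms(1,2)] by (simp add: mult.assoc)
qed

lemma continuous_weight:
  assumes "finite I" "i \<in> I" "k > 0"
  shows "continuous_on A (\<lambda>t. weight k I (x(i := t)))"
  unfolding weight_fun_upd[OF assms(1,2)]
proof (intro continuous_on_mult continuous_on_const continuous_on_prod)
  fix j
  show "continuous_on A (\<lambda>t. \<bar>t - x j\<bar> powr (2 * k))"
    by (rule continuous_on_powr') (use assms in \<open>auto intro!: continuous_intros\<close>)
qed

lemma weight_eq_0:
  assumes "finite I" "a \<in> I" "b \<in> I" "a \<noteq> b" "x a = x b"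
  shows "weight k I x = 0"
  unfolding weight_def
  by (rule prod_zero[OF assms(1)], rule bexI[OF _ assms(2)], rule prod_zero, use assms in simp, rule bexI[of _ b]) (use assms in auto)

text \<open>Hypothesis \<open>der\<close> says G = T_i F. The partial derivative of F w is then G w
  plus k times the sum over j of K_j minus its reflection, where K_j = F w / (x_i - x_j). The
  measure is invariant under swaps, so these differences integrate to 0, and the fundamental theorem
  in x_i leaves the face x_i = 0.\<close>

lemma orthant_ibp:
  fixes F G :: "('a \<Rightarrow> real) \<Rightarrow> complex" and k \<epsilon> C :: real
  assumes k: "k > 0" and I: "finite I" "i \<in> I" and "\<epsilon> > 0"
    and mF: "F \<in> borel_measurable (orthant I)" and mG: "G \<in> borel_measurable (orthant I)"
    and bF: "\<And>x. x \<in> space (orthant I) \<Longrightarrow> norm (F x) \<le> C * exp (- \<epsilon> * (\<Sum>i\<in>I. x i))"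
    and bG: "\<And>x. x \<in> space (orthant I) \<Longrightarrow> norm (G x) \<le> C * exp (- \<epsilon> * (\<Sum>i\<in>I. x i))"
    and cont: "\<And>x. x \<in> space (orthant (I - {i})) \<Longrightarrow> continuous_on {0..} (\<lambda>t. F (x(i := t)))"
    and der: "\<And>x. x \<in> space (orthant I) \<Longrightarrow> inj_on x I \<Longrightarrow>
      ((\<lambda>t. F (x(i := t))) has_vector_derivative
        (G x - of_real k * (\<Sum>j\<in>I - {i}. (F x - F (x \<circ> swp i j)) / of_real (x i - x j)))) (at (x i))"
  shows "(\<integral>x. G x * of_real (weight k I x) \<partial>orthant I) =
      - (\<integral>x. F (x(i := 0)) * of_real (weight k I (x(i := 0))) \<partial>orthant (I - {i}))"
proof -
  let ?w = "weight k I"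
  let ?S = "\<lambda>x. \<Sum>i\<in>I. x i"
  define J where "J = I - {i}"
  have J: "finite J" "i \<notin> J" "I = insert i J" unfolding J_def using I by (simp_all add: insert_absorb)
  have mcr: "complex_of_real \<in> borel_measurable borel" by measurable
  have mw: "(\<lambda>x. complex_of_real (?w x)) \<in> borel_measurable (orthant I)"
    by (rule measurable_compose[OF measurable_weight mcr])
  have C0: "C \<ge> 0" if "x \<in> space (orthant I)" for x
    using order_trans[OF norm_ge_zero bF[OF that]] by (simp add: zero_le_mult_iff)
  obtain W where W: "W > 0" "\<And>x. (\<forall>i\<in>I. x i \<ge> 0) \<Longrightarrow> ?w x \<le> W * exp (\<epsilon> / 2 * ?S x)"
    using weight_bound[OF I(1), of k "\<epsilon> / 2"] k \<open>\<epsilon> > 0\<close> by auto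
  have wbound: "norm (H x * of_real (?w x)) \<le> C * W * exp (- (\<epsilon> / 2) * ?S x)"
    if "x \<in> space (orthant I)" "norm (H x) \<le> C * exp (- \<epsilon> * ?S x)" for x and H :: "('a \<Rightarrow> real) \<Rightarrow> complex"
  proof -
    have "norm (H x * of_real (?w x)) = norm (H x) * ?w x" by (simp add: norm_mult weight_nonneg)
    also have "\<dots> \<le> (C * exp (- \<epsilon> * ?S x)) * (W * exp (\<epsilon> / 2 * ?S x))"
      using that orthant_pos[OF that(1)] C0[OF that(1)] by (intro mult_mono W weight_nonneg) (auto intro: less_imp_le)
    also have "\<dots> = C * W * (exp (- \<epsilon> * ?S x) * exp (\<epsilon> / 2 * ?S x))" by (simp add: mult_ac)
    also have "exp (- \<epsilon> * ?S x) * exp (\<epsilon> / 2 * ?S x) = exp (- (\<epsilon> / 2) * ?S x)" by (simp flip: exp_add)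
    finally show ?thesis .
  qed
  have intG: "integrable (orthant I) (\<lambda>x. G x * of_real (?w x))"
  proof (rule Bochner_Integration.integrable_bound)
    show "integrable (orthant I) (\<lambda>x. C * W * exp (- (\<epsilon> / 2) * ?S x))"
      using \<open>\<epsilon> > 0\<close> by (intro integrable_mult_right integrable_orthant_exp I) auto
    show "AE x in orthant I. norm (G x * of_real (?w x)) \<le> norm (C * W * exp (- (\<epsilon> / 2) * ?S x))"
      unfolding real_norm_def by (intro AE_I2 order_trans[OF wbound abs_ge_self] bG)
  qed (intro borel_measurable_times mG mw)
  \<comment> \<open>The singular part of the integrand; its integrability is where the exponent 2 k
    - 1 > -1 enters.\<close>
  define K where "K j x = F x * of_real (?w x) / of_real (x i - x j)" for j x
  have mK: "K j \<in> borel_measurable (orthant I)" if "j \<in> J" for j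
    unfolding K_def using that I(2)
    by (intro borel_measurable_divide borel_measurable_times mF mw measurable_compose[OF borel_measurable_diff mcr] measurable_orthant_component)
       (auto simp: J_def)
  have intK: "integrable (orthant I) (K j)" if "j \<in> J" for j
  proof -
    have j: "j \<in> I" "i \<noteq> j" using that by (auto simp: J_def)
    obtain B where B: "B > 0" "\<And>x. (\<forall>i\<in>I. x i \<ge> 0) \<Longrightarrow> ?w x / \<bar>x i - x j\<bar> \<le> B * exp (\<epsilon> / 2 * ?S x) * \<bar>x i - x j\<bar> powr (2 * k - 1)"
      using weight_div_bound[OF I(1) k _ I(2) j, of "\<epsilon> / 2"] \<open>\<epsilon> > 0\<close> by auto
    have "integrable (orthant I) (\<lambda>x. C * B * (exp (- (\<epsilon> / 2) * ?S x) * \<bar>x i - x j\<bar> powr (2 * k - 1)))"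
      using \<open>\<epsilon> > 0\<close> by (intro integrable_mult_right integrable_orthant_singular I j k) auto
    then show ?thesis
    proof (rule Bochner_Integration.integrable_bound[OF _ mK[OF that]], intro AE_I2)
      fix x assume x: "x \<in> space (orthant I)"
      have "norm (K j x) = norm (F x) * (?w x / \<bar>x i - x j\<bar>)"
        by (simp add: K_def norm_mult norm_divide weight_nonneg flip: of_real_diff)
      also have "\<dots> \<le> (C * exp (- \<epsilon> * ?S x)) * (B * exp (\<epsilon> / 2 * ?S x) * \<bar>x i - x j\<bar> powr (2 * k - 1))"
        using orthant_pos[OF x] C0[OF x] by (intro mult_mono bF x B) (auto intro: less_imp_le simp: weight_nonneg)
      also have "\<dots> = C * B * ((exp (- \<epsilon> * ?S x) * exp (\<epsilon> / 2 * ?S x)) * \<bar>x i - x j\<bar> powr (2 * k - 1))" by (simp only: mult_ac)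
      also have "exp (- \<epsilon> * ?S x) * exp (\<epsilon> / 2 * ?S x) = exp (- (\<epsilon> / 2) * ?S x)" by (simp flip: exp_add)
      finally show "norm (K j x) \<le> norm (C * B * (exp (- (\<epsilon> / 2) * ?S x) * \<bar>x i - x j\<bar> powr (2 * k - 1)))"
        unfolding real_norm_def by (rule order_trans[OF _ abs_ge_self])
    qed
  qed
  \<comment> \<open>The weight is symmetric while the denominator changes sign. Hence K_j minus its
    reflection has F plus the reflected F as numerator, as the derivative of F w demands.\<close>
  have Ks: "K j (x \<circ> swp i j) = - (F (x \<circ> swp i j) * of_real (?w x) / of_real (x i - x j))" if "j \<in> J" for j x
  proof -
    have j: "j \<in> I" using that by (auto simp: J_def)
    have "complex_of_real (x j - x i) = - of_real (x i - x j)" by simp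
    then show ?thesis unfolding K_def weight_swp[OF I j] by (simp only: comp_apply transpose_apply_first transpose_apply_second divide_minus_right)
  qed
  define V' where "V' x = G x * of_real (?w x) + of_real k * (\<Sum>j\<in>J. K j x - K j (x \<circ> swp i j))" for x
  have intKs: "integrable (orthant I) (\<lambda>x. K j (x \<circ> swp i j))" if "j \<in> J" for j
    using integrable_orthant_swp[OF I _ mK[OF that]] intK[OF that] that by (auto simp: J_def)
  have intV': "integrable (orthant I) V'"
    unfolding V'_def by (intro Bochner_Integration.integrable_add intG integrable_mult_right Bochner_Integration.integrable_sum Bochner_Integration.integrable_diff intK intKs)
  have "(\<integral>x. V' x \<partial>orthant I) = (\<integral>x. G x * of_real (?w x) \<partial>orthant I) + of_real k * (\<Sum>j\<in>J. (\<integral>x. K j x \<partial>orthant I) - (\<integral>x. K j (x \<circ> swp i j) \<partial>orthant I))"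
    unfolding V'_def using intG intK intKs
    by (subst Bochner_Integration.integral_add)
       (auto intro!: integrable_mult_right Bochner_Integration.integrable_sum Bochner_Integration.integrable_diff simp: Bochner_Integration.integral_sum Bochner_Integration.integral_diff)
  also have "(\<Sum>j\<in>J. (\<integral>x. K j x \<partial>orthant I) - (\<integral>x. K j (x \<circ> swp i j) \<partial>orthant I)) = 0"
  proof (rule sum.neutral, rule ballI)
    fix j assume "j \<in> J"
    then show "(\<integral>x. K j x \<partial>orthant I) - (\<integral>x. K j (x \<circ> swp i j) \<partial>orthant I) = 0"
      using integral_orthant_swp[OF I _ mK, of j j] by (auto simp: J_def)
  qed
  finally have "(\<integral>x. G x * of_real (?w x) \<partial>orthant I) = (\<integral>x. V' x \<partial>orthant I)" by simp
  also have "\<dots> = (\<integral>x. (\<integral>t. V' (x(i := t)) \<partial>pos_line) \<partial>orthant J)"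
    using intV' unfolding orthant_def J(3) by (intro pos_prod.product_integral_insert J)
  also have "\<dots> = (\<integral>x. - (F (x(i := 0)) * of_real (?w (x(i := 0)))) \<partial>orthant J)"
  proof (rule integral_cong_AE)
    have upd: "(\<lambda>(x, t). x(i := t)) \<in> measurable (orthant J \<Otimes>\<^sub>M pos_line) (orthant I)"
      unfolding orthant_def J(3) by (rule measurable_add_dim)
    have mV': "(\<lambda>(x, t). V' (x(i := t))) \<in> borel_measurable (orthant J \<Otimes>\<^sub>M pos_line)"
      using measurable_compose[OF upd, of V' borel] intV' by (auto simp: case_prod_unfold)
    then show "(\<lambda>x. \<integral>t. V' (x(i := t)) \<partial>pos_line) \<in> borel_measurable (orthant J)"
      by (rule pos_line.borel_measurable_lebesgue_integral)
    have upd1: "(\<lambda>x. x(i := t)) \<in> measurable (orthant J) (orthant I)" if "t > 0" for t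
    proof -
      have "(\<lambda>x. (x, t)) \<in> measurable (orthant J) (orthant J \<Otimes>\<^sub>M pos_line)"
        by (rule measurable_Pair) (use that in auto)
      from measurable_compose[OF this upd] show ?thesis by simp
    qed
    have contv: "continuous_on {0..} (\<lambda>t. F (x(i := t)) * of_real (?w (x(i := t))))" if "x \<in> space (orthant J)" for x
      using cont[of x] that by (intro continuous_intros continuous_weight I k) (auto simp: J_def)
    show "(\<lambda>x. - (F (x(i := 0)) * of_real (?w (x(i := 0))))) \<in> borel_measurable (orthant J)"
    \<comment> \<open>The face x_i = 0 lies outside the space of \<open>orthant I\<close>, so
      measurability is obtained as a limit along x_i = 1 / (n + 1).\<close>
    proof (rule borel_measurable_uminus, rule borel_measurable_LIMSEQ_metric)
      fix n :: nat
      show "(\<lambda>x. F (x(i := 1 / real (Suc n))) * of_real (?w (x(i := 1 / real (Suc n))))) \<in> borel_measurable (orthant J)"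
        by (intro borel_measurable_times measurable_compose[OF upd1 mF] measurable_compose[OF upd1 mw]) auto
    next
      fix x assume x: "x \<in> space (orthant J)"
      show "(\<lambda>n. F (x(i := 1 / real (Suc n))) * of_real (?w (x(i := 1 / real (Suc n))))) \<longlonglongrightarrow> F (x(i := 0)) * of_real (?w (x(i := 0)))"
        using continuous_on_tendsto_compose[OF contv[OF x], of "\<lambda>n. 1 / real (Suc n)" 0 sequentially]
          LIMSEQ_inverse_real_of_nat by (simp add: inverse_eq_divide)
    qed
    \<comment> \<open>Finite total mass makes almost every slice of V' integrable, as
      \<open>ftc_pos_line\<close> requires.\<close>
    have "(\<integral>\<^sup>+x. \<integral>\<^sup>+t. norm (V' (x(i := t))) \<partial>pos_line \<partial>orthant J) = (\<integral>\<^sup>+x. norm (V' x) \<partial>orthant I)"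
      using intV' unfolding orthant_def J(3)
      by (intro pos_prod.product_nn_integral_insert[symmetric] J) auto
    then have "(\<integral>\<^sup>+x. \<integral>\<^sup>+t. norm (V' (x(i := t))) \<partial>pos_line \<partial>orthant J) \<noteq> \<infinity>"
      using intV' unfolding integrable_iff_bounded infinity_ennreal_def by (metis less_irrefl)
    then have "AE x in orthant J. (\<integral>\<^sup>+t. norm (V' (x(i := t))) \<partial>pos_line) \<noteq> \<infinity>"
    proof (intro nn_integral_PInf_AE)
      have "(\<lambda>(x, t). ennreal (norm (V' (x(i := t))))) \<in> borel_measurable (orthant J \<Otimes>\<^sub>M pos_line)"
        using measurable_compose[OF mV', of "\<lambda>z. ennreal (norm z)" borel] by (simp add: case_prod_unfold)
      then show "(\<lambda>x. \<integral>\<^sup>+t. norm (V' (x(i := t))) \<partial>pos_line) \<in> borel_measurable (orthant J)"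
        by (rule pos_line.borel_measurable_nn_integral)
    qed
    then show "AE x in orthant J. (\<integral>t. V' (x(i := t)) \<partial>pos_line) = - (F (x(i := 0)) * of_real (?w (x(i := 0))))"
    proof (rule AE_mp, intro AE_I2 impI)
      fix x assume x: "x \<in> space (orthant J)" and fin: "(\<integral>\<^sup>+t. norm (V' (x(i := t))) \<partial>pos_line) \<noteq> \<infinity>"
      have xJ: "x \<in> space (orthant (I - {i}))" using x by (simp add: J_def)
      show "(\<integral>t. V' (x(i := t)) \<partial>pos_line) = - (F (x(i := 0)) * of_real (?w (x(i := 0))))"
      \<comment> \<open>If two frozen coordinates agree, the weight vanishes along the whole line
        and both sides are 0. Otherwise the derivative formula holds except where t meets one of the
        finitely many frozen coordinates.\<close>
      proof (cases "inj_on x J")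
        case False
        then obtain a b where "a \<in> J" "b \<in> J" "a \<noteq> b" "x a = x b" by (auto simp: inj_on_def)
        then have w0: "?w (x(i := t)) = 0" for t
          using J by (intro weight_eq_0[of I a b]) (auto simp: I(1))
        have "K j (x(i := t)) = 0" for j t by (simp add: K_def w0)
        moreover have "K j (x(i := t) \<circ> swp i j) = 0" if "j \<in> J" for j t by (simp only: Ks[OF that] w0) simp
        ultimately have "V' (x(i := t)) = 0" for t by (simp add: V'_def w0)
        then show ?thesis by (simp add: w0)
      next
        case True
        have meas: "(\<lambda>t. V' (x(i := t))) \<in> borel_measurable pos_line"
          using measurable_Pair2[OF mV' x] by simp
        have int: "integrable pos_line (\<lambda>t. V' (x(i := t)))"
          using fin meas by (simp add: integrable_iff_bounded top.not_eq_extremum)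
        have "(\<integral>t. V' (x(i := t)) \<partial>pos_line) = - (\<lambda>t. F (x(i := t)) * of_real (?w (x(i := t)))) 0"
        proof (rule ftc_pos_line[OF int])
          show "finite (x ` J)" using J(1) by simp
          show "continuous_on {0..} (\<lambda>t. F (x(i := t)) * of_real (?w (x(i := t))))" by (rule contv[OF x])
          fix t :: real assume t: "t > 0" "t \<notin> x ` J"
          let ?y = "x(i := t)"
          have y: "?y \<in> space (orthant I)" using orthant_upd[OF xJ I(2) t(1)] .
          have yi: "?y i = t" by simp
          have yj: "?y j = x j" if "j \<in> J" for j using that J(2) by auto
          have ij: "inj_on ?y I" using True t(2) J by (auto simp: inj_on_def)
          have dF: "((\<lambda>s. F (x(i := s))) has_vector_derivative
              (G ?y - of_real k * (\<Sum>j\<in>J. (F ?y - F (?y \<circ> swp i j)) / of_real (t - x j)))) (at t)"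
          proof -
            have "(\<Sum>j\<in>I - {i}. (F ?y - F (?y \<circ> swp i j)) / of_real (?y i - ?y j)) = (\<Sum>j\<in>J. (F ?y - F (?y \<circ> swp i j)) / of_real (t - x j))"
              unfolding J_def[symmetric] by (intro sum.cong refl) (simp only: yi yj)
            then show ?thesis using der[OF y ij] by (simp only: fun_upd_upd yi)
          qed
          have dw: "((\<lambda>s. complex_of_real (?w (x(i := s)))) has_vector_derivative of_real (?w ?y * (\<Sum>j\<in>J. 2 * k / (t - x j)))) (at t)"
            unfolding J_def by (intro has_vector_derivative_of_real DERIV_weight I) (use t J_def in auto)
          have eq: "F ?y * of_real (?w ?y * (\<Sum>j\<in>J. 2 * k / (t - x j)))
              + (G ?y - of_real k * (\<Sum>j\<in>J. (F ?y - F (?y \<circ> swp i j)) / of_real (t - x j))) * of_real (?w ?y) = V' ?y"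
          proof -
            have "K j ?y - K j (?y \<circ> swp i j) = F ?y * of_real (?w ?y) / of_real (t - x j) + F (?y \<circ> swp i j) * of_real (?w ?y) / of_real (t - x j)" if "j \<in> J" for j
              unfolding Ks[OF that] unfolding K_def yi yj[OF that] by simp
            then have "V' ?y = G ?y * of_real (?w ?y) + of_real k * (\<Sum>j\<in>J. F ?y * of_real (?w ?y) / of_real (t - x j) + F (?y \<circ> swp i j) * of_real (?w ?y) / of_real (t - x j))"
              unfolding V'_def by (simp cong: sum.cong)
            moreover have "F ?y * of_real (?w ?y * (\<Sum>j\<in>J. 2 * k / (t - x j))) - of_real k * (\<Sum>j\<in>J. (F ?y - F (?y \<circ> swp i j)) / of_real (t - x j)) * of_real (?w ?y)
              = of_real k * (\<Sum>j\<in>J. F ?y * of_real (?w ?y) / of_real (t - x j) + F (?y \<circ> swp i j) * of_real (?w ?y) / of_real (t - x j))"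
              unfolding of_real_mult of_real_sum sum_distrib_left sum_distrib_right sum_subtractf[symmetric]
            proof (rule sum.cong[OF refl])
              fix j assume "j \<in> J"
              have alg: "d \<noteq> 0 \<Longrightarrow> a * (w * (2 * c / d)) - c * ((a - b) / d) * w = c * (a * w / d + b * w / d)" for a b c d w :: complex
                by (simp add: field_simps)
              have "complex_of_real (t - x j) \<noteq> 0" using t(2) \<open>j \<in> J\<close> by auto
              then show "F ?y * (of_real (?w ?y) * of_real (2 * k / (t - x j))) - of_real k * ((F ?y - F (?y \<circ> swp i j)) / of_real (t - x j)) * of_real (?w ?y)
                 = of_real k * (F ?y * of_real (?w ?y) / of_real (t - x j) + F (?y \<circ> swp i j) * of_real (?w ?y) / of_real (t - x j))"
                unfolding of_real_divide of_real_mult of_real_numeral by (rule alg)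
            qed
            ultimately show ?thesis by (simp only: left_diff_distrib) (simp only: algebra_simps)
          qed
          show "((\<lambda>t. F (x(i := t)) * of_real (?w (x(i := t)))) has_vector_derivative V' ?y) (at t)"
            using has_vector_derivative_mult[OF dF dw] unfolding eq .
        next
          show "((\<lambda>t. F (x(i := t)) * of_real (?w (x(i := t)))) \<longlongrightarrow> 0) at_top"
          proof (rule Lim_null_comparison)
            show "eventually (\<lambda>t. norm (F (x(i := t)) * of_real (?w (x(i := t)))) \<le> C * W * exp (- (\<epsilon> / 2) * (t + (\<Sum>a\<in>J. x a)))) at_top"
              using eventually_gt_at_top[of 0]
            proof eventually_elim
              case (elim t)
              have "x(i := t) \<in> space (orthant I)" using orthant_upd[OF xJ I(2) elim] .
              moreover have "?S (x(i := t)) = t + (\<Sum>a\<in>J. x a)"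
              proof -
                have "(\<Sum>a\<in>J. (x(i := t)) a) = (\<Sum>a\<in>J. x a)" by (rule sum.cong) (use J(2) in auto)
                then show ?thesis unfolding J(3) sum.insert[OF J(1,2)] by simp
              qed
              ultimately show ?case using wbound[of "x(i := t)" F] bF by metis
            qed
            have "((\<lambda>t. C * W * exp (- (\<epsilon> / 2) * (t + (\<Sum>a\<in>J. x a)))) \<longlongrightarrow> C * W * 0) at_top"
            proof (intro tendsto_mult tendsto_const filterlim_compose[OF exp_at_bot])
              have "filterlim (\<lambda>t. (\<Sum>a\<in>J. x a) + t) at_top at_top" by (rule filterlim_tendsto_add_at_top[OF tendsto_const filterlim_ident])
              then have "filterlim (\<lambda>t. t + (\<Sum>a\<in>J. x a)) at_top at_top" by (simp add: add.commute)
              then show "filterlim (\<lambda>t. - (\<epsilon> / 2) * (t + (\<Sum>a\<in>J. x a))) at_bot at_top"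
                using \<open>\<epsilon> > 0\<close> by (intro filterlim_tendsto_neg_mult_at_bot[OF tendsto_const]) auto
            qed
            then show "((\<lambda>t. C * W * exp (- (\<epsilon> / 2) * (t + (\<Sum>a\<in>J. x a)))) \<longlongrightarrow> 0) at_top" by simp
          qed
        qed
        then show ?thesis by simp
      qed
    qed
  qed
  finally show ?thesis unfolding J_def by simp
qed

section \<open>Integration by parts against powers of the product of the coordinates\<close>

definition power_weight :: "real \<Rightarrow> 'a set \<Rightarrow> ('a \<Rightarrow> real) \<Rightarrow> real" where
  "power_weight a I x = (\<Prod>l\<in>I. x l powr (a - 1))"

lemma power_weight_nonneg: "power_weight a I x \<ge> 0"
  unfolding power_weight_def by (intro prod_nonneg) simp

lemma measurable_power_weight: "power_weight a I \<in> borel_measurable (orthant I)"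
proof -
  have "(\<lambda>u. u powr (a - 1)) \<in> borel_measurable (borel :: real measure)" by measurable
  then show ?thesis unfolding power_weight_def
    by (intro borel_measurable_prod measurable_compose[OF measurable_orthant_component])
qed

lemma measurable_complex_of_real: "f \<in> borel_measurable M \<Longrightarrow> (\<lambda>x. complex_of_real (f x)) \<in> borel_measurable M"
proof -
  assume f: "f \<in> borel_measurable M"
  have "complex_of_real \<in> borel_measurable borel" by measurable
  then show ?thesis by (rule measurable_compose[OF f])
qed

lemma power_weight_swp:
  assumes "i \<in> I" "j \<in> I"
  shows "power_weight a I (x \<circ> swp i j) = power_weight a I x"
  unfolding power_weight_def comp_apply
  by (rule prod.reindex_bij_betw[OF bij_betw_swp[OF assms]])

lemma sum_swp:
  assumes "i \<in> I" "j \<in> I"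
  shows "(\<Sum>l\<in>I. (x \<circ> swp i j) l) = (\<Sum>l\<in>I. x l :: real)"
  unfolding comp_apply by (rule sum.reindex_bij_betw[OF bij_betw_swp[OF assms]])

lemma orthant_sum_nonneg: "x \<in> space (orthant I) \<Longrightarrow> 0 \<le> (\<Sum>i\<in>I. x i)"
  by (intro sum_nonneg) (meson less_imp_le orthant_pos)

lemma integrable_weighted:
  fixes H :: "('a \<Rightarrow> real) \<Rightarrow> complex"
  assumes "k \<ge> 0" "finite I" "\<epsilon> > 0" "a > 0" and mH: "H \<in> borel_measurable (orthant I)"
    and bH: "\<And>x. x \<in> space (orthant I) \<Longrightarrow> norm (H x) \<le> C * (power_weight a I x * exp (- \<epsilon> * (\<Sum>i\<in>I. x i)))"
  shows "integrable (orthant I) (\<lambda>x. H x * of_real (weight k I x))"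
proof -
  obtain W where W: "W > 0" "\<And>x. (\<forall>i\<in>I. x i \<ge> 0) \<Longrightarrow> weight k I x \<le> W * exp (\<epsilon> / 2 * (\<Sum>i\<in>I. x i))"
    using weight_bound[of I k "\<epsilon> / 2"] assms by auto
  have "integrable (orthant I) (\<lambda>x. C * W * (power_weight a I x * exp (- (\<epsilon> / 2) * (\<Sum>i\<in>I. x i))))"
    unfolding power_weight_def using assms by (intro integrable_mult_right integrable_orthant_Gamma) auto
  then show ?thesis
  proof (rule Bochner_Integration.integrable_bound, intro borel_measurable_times mH measurable_complex_of_real measurable_weight, intro AE_I2)
    fix x assume x: "x \<in> space (orthant I)"
    let ?S = "\<Sum>i\<in>I. x i"
    have "norm (H x * of_real (weight k I x)) = norm (H x) * weight k I x" by (simp add: norm_mult weight_nonneg)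
    also have "\<dots> \<le> (C * (power_weight a I x * exp (- \<epsilon> * ?S))) * (W * exp (\<epsilon> / 2 * ?S))"
      using orthant_pos[OF x] order_trans[OF norm_ge_zero bH[OF x]] by (intro mult_mono bH x W weight_nonneg) (auto intro: less_imp_le)
    also have "\<dots> = C * W * (power_weight a I x * (exp (- \<epsilon> * ?S) * exp (\<epsilon> / 2 * ?S)))" by (simp only: mult_ac)
    also have "exp (- \<epsilon> * ?S) * exp (\<epsilon> / 2 * ?S) = exp (- (\<epsilon> / 2) * ?S)" by (simp flip: exp_add)
    finally show "norm (H x * of_real (weight k I x)) \<le> norm (C * W * (power_weight a I x * exp (- (\<epsilon> / 2) * ?S)))"
      unfolding real_norm_def by (rule order_trans[OF _ abs_ge_self])
  qed
qed

lemma poly_exp_bound: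
  assumes "p \<ge> 0" "\<delta> > (0::real)"
  shows "\<exists>D>0. \<forall>x\<in>space (orthant I). (1 + (\<Sum>i\<in>I. x i)) powr p \<le> D * exp (\<delta> * (\<Sum>i\<in>I. x i))"
  using powr_le_exp[OF assms] orthant_sum_nonneg by blast

lemma orthant_le_sum: "finite I \<Longrightarrow> x \<in> space (orthant I) \<Longrightarrow> i \<in> I \<Longrightarrow> x i \<le> 1 + (\<Sum>i\<in>I. x i)"
  using member_le_sum[of i I x] orthant_pos[of x I] by (force intro: less_imp_le)

text \<open>Apply \<open>orthant_ibp\<close> to F = x_i D^(a-1) \<Phi>. The factor x_i removes the
  face term, and with \<Psi> = T_i \<Phi> one finds T_i F = D^(a-1) (a \<Phi> + x_i \<Psi> + k R),
  where R is the sum of the n - 1 reflections of \<Phi>. Each reflection has the same weighted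
  integral as \<Phi>, whence the factor a + k (n - 1).\<close>

lemma dunkl_ibp_power:
  fixes \<Phi> \<Psi> :: "('a \<Rightarrow> real) \<Rightarrow> complex" and k \<epsilon> C a :: real
  assumes k: "k > 0" and I: "finite I" "i \<in> I" and "\<epsilon> > 0" and a: "a \<ge> 1"
    and m\<Phi>: "\<Phi> \<in> borel_measurable (orthant I)" and m\<Psi>: "\<Psi> \<in> borel_measurable (orthant I)"
    and b\<Phi>: "\<And>x. x \<in> space (orthant I) \<Longrightarrow> norm (\<Phi> x) \<le> C * exp (- \<epsilon> * (\<Sum>i\<in>I. x i))"
    and b\<Psi>: "\<And>x. x \<in> space (orthant I) \<Longrightarrow> norm (\<Psi> x) \<le> C * exp (- \<epsilon> * (\<Sum>i\<in>I. x i))"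
    and cont: "\<And>x. x \<in> space (orthant (I - {i})) \<Longrightarrow> continuous_on {0..} (\<lambda>t. \<Phi> (x(i := t)))"
    and der: "\<And>x. x \<in> space (orthant I) \<Longrightarrow> inj_on x I \<Longrightarrow>
      ((\<lambda>t. \<Phi> (x(i := t))) has_vector_derivative
        (\<Psi> x - of_real k * (\<Sum>j\<in>I - {i}. (\<Phi> x - \<Phi> (x \<circ> swp i j)) / of_real (x i - x j)))) (at (x i))"
  shows "of_real (a + k * (real (card I) - 1)) * (\<integral>x. of_real (power_weight a I x) * \<Phi> x * of_real (weight k I x) \<partial>orthant I)
    = - (\<integral>x. of_real (power_weight a I x) * (of_real (x i) * \<Psi> x) * of_real (weight k I x) \<partial>orthant I)"
proof -
  let ?S = "\<lambda>x. \<Sum>i\<in>I. x i"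
  let ?d = "power_weight a I" and ?w = "weight k I"
  define J where "J = I - {i}"
  have J: "finite J" "i \<notin> J" "I = insert i J" unfolding J_def using I by (simp_all add: insert_absorb)
  define F where "F x = of_real (x i * ?d x) * \<Phi> x" for x
  define G where "G x = of_real (?d x) * (of_real a * \<Phi> x + of_real (x i) * \<Psi> x + of_real k * (\<Sum>j\<in>J. \<Phi> (x \<circ> swp i j)))" for x
  \<comment> \<open>The decay rate \<epsilon> is split: one quarter pays for the power, one quarter
    for the factor x_i, and \<epsilon> / 2 is left. Since a >= 1, the power grows at most
    polynomially in the sum of the coordinates.\<close>
  obtain D1 where D1: "D1 > 0" "\<And>x. x \<in> space (orthant I) \<Longrightarrow> (1 + ?S x) powr ((a - 1) * card I) \<le> D1 * exp (\<epsilon> / 4 * ?S x)"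
    using poly_exp_bound[of "(a - 1) * card I" "\<epsilon> / 4" I] a \<open>\<epsilon> > 0\<close> by auto
  obtain D2 where D2: "D2 > 0" "\<And>x. x \<in> space (orthant I) \<Longrightarrow> (1 + ?S x) powr 1 \<le> D2 * exp (\<epsilon> / 4 * ?S x)"
    using poly_exp_bound[of 1 "\<epsilon> / 4" I] \<open>\<epsilon> > 0\<close> by auto
  have db: "?d x \<le> D1 * exp (\<epsilon> / 4 * ?S x)" if "x \<in> space (orthant I)" for x
  proof -
    have "(\<Prod>l\<in>I. \<bar>x l\<bar> powr (a - 1)) \<le> (1 + ?S x) powr ((a - 1) * card I)"
      by (rule prod_powr_le) (use I a orthant_le_sum[OF I(1) that] orthant_pos[OF that] orthant_sum_nonneg[OF that] in \<open>auto simp: abs_of_pos\<close>)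
    moreover have "(\<Prod>l\<in>I. \<bar>x l\<bar> powr (a - 1)) = ?d x"
      unfolding power_weight_def by (intro prod.cong refl) (simp add: abs_of_pos orthant_pos[OF that])
    ultimately show ?thesis using D1(2)[OF that] by simp
  qed
  have xb: "x i \<le> D2 * exp (\<epsilon> / 4 * ?S x)" if "x \<in> space (orthant I)" for x
    using D2(2)[OF that] orthant_le_sum[OF I(1) that I(2)] orthant_sum_nonneg[OF that] by simp
  have C0: "C \<ge> 0" if "x \<in> space (orthant I)" for x
    using order_trans[OF norm_ge_zero b\<Phi>[OF that]] by (simp add: zero_le_mult_iff)
  have e1: "1 \<le> exp (\<epsilon> / 4 * ?S x)" if "x \<in> space (orthant I)" for x
    using orthant_sum_nonneg[OF that] \<open>\<epsilon> > 0\<close> by simp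
  let ?B = "D1 * (a + D2 + k * card J) * C"
  have comb: "(D1 * exp (\<epsilon> / 4 * ?S x)) * ((A * exp (\<epsilon> / 4 * ?S x)) * (C * exp (- \<epsilon> * ?S x))) \<le> ?B * exp (- (\<epsilon> / 2) * ?S x)"
    if "x \<in> space (orthant I)" "A \<le> a + D2 + k * card J" for x A
  proof -
    have "(D1 * exp (\<epsilon> / 4 * ?S x)) * ((A * exp (\<epsilon> / 4 * ?S x)) * (C * exp (- \<epsilon> * ?S x)))
      = D1 * A * C * (exp (\<epsilon> / 4 * ?S x) * exp (\<epsilon> / 4 * ?S x) * exp (- \<epsilon> * ?S x))" by (simp only: mult_ac)
    also have "exp (\<epsilon> / 4 * ?S x) * exp (\<epsilon> / 4 * ?S x) * exp (- \<epsilon> * ?S x) = exp (- (\<epsilon> / 2) * ?S x)"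
      unfolding exp_add[symmetric] by (simp add: algebra_simps)
    also have "D1 * A * C * \<dots> \<le> ?B * \<dots>"
      using D1(1) C0[OF that(1)] that(2) by (intro mult_right_mono mult_left_mono) auto
    finally show ?thesis .
  qed
  have bF: "norm (F x) \<le> ?B * exp (- (\<epsilon> / 2) * ?S x)" if x: "x \<in> space (orthant I)" for x
  proof -
    have "norm (F x) = ?d x * (x i * norm (\<Phi> x))"
      using orthant_pos[OF x I(2)] by (simp add: F_def norm_mult power_weight_nonneg)
    also have "\<dots> \<le> (D1 * exp (\<epsilon> / 4 * ?S x)) * ((D2 * exp (\<epsilon> / 4 * ?S x)) * (C * exp (- \<epsilon> * ?S x)))"
      using orthant_pos[OF x I(2)] D1(1) D2(1) by (intro mult_mono db xb b\<Phi> x) auto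
    also have "\<dots> \<le> ?B * exp (- (\<epsilon> / 2) * ?S x)"
      by (rule comb[OF x]) (use a k in simp)
    finally show ?thesis .
  qed
  have bG: "norm (G x) \<le> ?B * exp (- (\<epsilon> / 2) * ?S x)" if x: "x \<in> space (orthant I)" for x
  proof -
    let ?E = "exp (\<epsilon> / 4 * ?S x)" and ?N = "C * exp (- \<epsilon> * ?S x)"
    have N0: "?N \<ge> 0" using C0[OF x] by simp
    have "norm (\<Phi> (x \<circ> swp i j)) \<le> ?N" if "j \<in> J" for j
      using b\<Phi>[OF orthant_swp_space[OF I(2) _ x, of j]] sum_swp[OF I(2), of j x] that J(3) by simp
    then have "norm (\<Sum>j\<in>J. \<Phi> (x \<circ> swp i j)) \<le> (\<Sum>j\<in>J. ?N)" by (rule sum_norm_le)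
    then have s: "norm (of_real k * (\<Sum>j\<in>J. \<Phi> (x \<circ> swp i j))) \<le> k * (card J * ?N)"
      using k by (simp add: norm_mult)
    have "norm (of_real a * \<Phi> x) \<le> a * ?N" using b\<Phi>[OF x] a by (simp add: norm_mult)
    moreover have "norm (of_real (x i) * \<Psi> x) \<le> (D2 * ?E) * ?N"
      unfolding norm_mult using orthant_pos[OF x I(2)] D2(1) by (intro mult_mono b\<Psi> x) (use xb[OF x] in auto)
    ultimately have "norm (of_real a * \<Phi> x + of_real (x i) * \<Psi> x + of_real k * (\<Sum>j\<in>J. \<Phi> (x \<circ> swp i j)))
      \<le> a * ?N + (D2 * ?E) * ?N + k * (card J * ?N)"
      using s by (intro norm_triangle_le add_mono order_trans[OF norm_triangle_ineq]) auto
    also have "\<dots> \<le> (a * ?E) * ?N + (D2 * ?E) * ?N + ((k * card J) * ?E) * ?N"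
    proof (intro add_mono order_refl)
      show "a * ?N \<le> (a * ?E) * ?N" using mult_left_mono[OF e1[OF x], of a] a N0 by (intro mult_right_mono) auto
      have "k * card J * 1 \<le> k * card J * ?E" using e1[OF x] k by (intro mult_left_mono) auto
      show "k * (card J * ?N) \<le> ((k * card J) * ?E) * ?N"
        using mult_right_mono[OF \<open>k * card J * 1 \<le> k * card J * ?E\<close> N0] by (simp only: mult_1_right mult.assoc)
    qed
    also have "\<dots> = ((a + D2 + k * card J) * ?E) * ?N" by (simp add: algebra_simps)
    finally have "norm (G x) \<le> (D1 * ?E) * (((a + D2 + k * card J) * ?E) * ?N)"
      unfolding G_def norm_mult[of "of_real _"] norm_of_real using db[OF x] D1(1)
      by (intro mult_mono) (auto simp: power_weight_nonneg)
    also have "\<dots> \<le> ?B * exp (- (\<epsilon> / 2) * ?S x)" by (rule comb[OF x order_refl])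
    finally show ?thesis .
  qed
  have m\<Phi>s: "(\<lambda>x. \<Phi> (x \<circ> swp i j)) \<in> borel_measurable (orthant I)" if "j \<in> J" for j
    using that J(3) by (intro measurable_compose[OF measurable_orthant_swp m\<Phi>] I) auto
  have mF: "F \<in> borel_measurable (orthant I)"
    unfolding F_def by (intro borel_measurable_times m\<Phi> measurable_complex_of_real measurable_orthant_component measurable_power_weight I)
  have mG: "G \<in> borel_measurable (orthant I)"
    unfolding G_def by (intro borel_measurable_times borel_measurable_add borel_measurable_sum borel_measurable_const m\<Phi> m\<Psi> m\<Phi>s measurable_complex_of_real measurable_orthant_component measurable_power_weight I)
  \<comment> \<open>The case t = 0 is included, both sides being 0 there; this gives continuity up
    to the face.\<close>
  have xd: "t * ?d (x(i := t)) = t powr a * power_weight a J x" if "t \<ge> 0" for t x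
  proof -
    have "?d (x(i := t)) = t powr (a - 1) * power_weight a J x"
      unfolding power_weight_def J(3) prod.insert[OF J(1,2)] using J(2) by (auto intro!: prod.cong)
    moreover have "t * t powr (a - 1) = t powr a" using that a by (cases "t = 0") (auto simp: powr_diff)
    ultimately show ?thesis by simp
  qed
  have "(\<integral>x. G x * of_real (?w x) \<partial>orthant I) = - (\<integral>x. F (x(i := 0)) * of_real (?w (x(i := 0))) \<partial>orthant (I - {i}))"
  proof (rule orthant_ibp[OF k I _ mF mG bF bG])
    show "\<epsilon> / 2 > 0" using \<open>\<epsilon> > 0\<close> by simp
  next
    fix x assume x: "x \<in> space (orthant (I - {i}))"
    have "continuous_on {0..} (\<lambda>t. of_real (t powr a * power_weight a J x) * \<Phi> (x(i := t)))"
      by (intro continuous_intros cont[OF x] continuous_on_powr') (use a in auto)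
    then show "continuous_on {0..} (\<lambda>t. F (x(i := t)))"
      by (rule continuous_on_cong[THEN iffD1, rotated -1]) (use xd[of _ x] in \<open>auto simp: F_def\<close>)
  next
    fix x assume x: "x \<in> space (orthant I)" and inj: "inj_on x I"
    have pos: "x i > 0" using orthant_pos[OF x I(2)] .
    have dx: "?d x = x i powr (a - 1) * power_weight a J x"
      unfolding power_weight_def J(3) prod.insert[OF J(1,2)] ..
    have "((\<lambda>t. t powr a * power_weight a J x) has_real_derivative (a * ?d x)) (at (x i))"
      using pos by (auto intro!: derivative_eq_intros simp: dx)
    then have "((\<lambda>t. complex_of_real (t powr a * power_weight a J x)) has_vector_derivative of_real (a * ?d x)) (at (x i))"
      by (rule has_vector_derivative_of_real)
    from has_vector_derivative_mult[OF this der[OF x inj]]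
    have D: "((\<lambda>t. of_real (t powr a * power_weight a J x) * \<Phi> (x(i := t))) has_vector_derivative
       (of_real (x i * ?d x) * (\<Psi> x - of_real k * (\<Sum>j\<in>J. (\<Phi> x - \<Phi> (x \<circ> swp i j)) / of_real (x i - x j))) + of_real (a * ?d x) * \<Phi> x)) (at (x i))"
      using xd[of "x i" x] pos by (simp add: J_def)
    have Fs: "F (x \<circ> swp i j) = of_real (x j * ?d x) * \<Phi> (x \<circ> swp i j)" if "j \<in> J" for j
      using power_weight_swp[OF I(2), of j] that J(3) by (simp add: F_def)
    \<comment> \<open>With \<Phi>' the reflection of \<Phi>, the numerator is D^(a-1) times x_i
      \<Phi> - x_j \<Phi>' = x_i (\<Phi> - \<Phi>') + (x_i - x_j) \<Phi>', and the last summand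
      loses the denominator.\<close>
    have q: "(F x - F (x \<circ> swp i j)) / of_real (x i - x j) =
       of_real (?d x) * (of_real (x i) * ((\<Phi> x - \<Phi> (x \<circ> swp i j)) / of_real (x i - x j)) + \<Phi> (x \<circ> swp i j))" if "j \<in> J" for j
    proof -
      have "x i \<noteq> x j" using inj that J(3) J(2) by (auto simp: inj_on_def)
      then have "complex_of_real (x i) - of_real (x j) \<noteq> 0" by simp
      then show ?thesis unfolding Fs[OF that] unfolding F_def by (simp add: field_simps)
    qed
    have "G x - of_real k * (\<Sum>j\<in>I - {i}. (F x - F (x \<circ> swp i j)) / of_real (x i - x j)) =
      G x - of_real k * (\<Sum>j\<in>J. of_real (?d x) * (of_real (x i) * ((\<Phi> x - \<Phi> (x \<circ> swp i j)) / of_real (x i - x j)) + \<Phi> (x \<circ> swp i j)))"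
      unfolding J_def[symmetric] using q by (simp cong: sum.cong)
    also have "\<dots> = of_real (x i * ?d x) * (\<Psi> x - of_real k * (\<Sum>j\<in>J. (\<Phi> x - \<Phi> (x \<circ> swp i j)) / of_real (x i - x j))) + of_real (a * ?d x) * \<Phi> x"
      unfolding sum_distrib_left[symmetric] sum.distrib G_def of_real_mult by (simp only: algebra_simps)
    finally show "((\<lambda>t. F (x(i := t))) has_vector_derivative (G x - of_real k * (\<Sum>j\<in>I - {i}. (F x - F (x \<circ> swp i j)) / of_real (x i - x j)))) (at (x i))"
    proof (simp only:, intro has_vector_derivative_transform_within_open[OF D])
      show "open {0::real<..}" "x i \<in> {0<..}" using pos by auto
      fix t :: real assume "t \<in> {0<..}"
      then show "of_real (t powr a * power_weight a J x) * \<Phi> (x(i := t)) = F (x(i := t))"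
        using xd[of t x] by (simp only: F_def fun_upd_same greaterThan_iff less_imp_le)
    qed
  qed
  also have "\<dots> = 0" by (simp add: F_def)
  finally have G0: "(\<integral>x. G x * of_real (?w x) \<partial>orthant I) = 0" .
  have int: "integrable (orthant I) (\<lambda>x. of_real (?d x) * H x * of_real (?w x))"
    if "H \<in> borel_measurable (orthant I)" "\<And>x. x \<in> space (orthant I) \<Longrightarrow> norm (H x) \<le> B * exp (- \<delta> * ?S x)" "\<delta> > 0" for H :: "('a \<Rightarrow> real) \<Rightarrow> complex" and B \<delta>
  proof (rule integrable_weighted[where a = a and C = B and \<epsilon> = \<delta>])
    show "(\<lambda>x. of_real (?d x) * H x) \<in> borel_measurable (orthant I)"
      by (intro borel_measurable_times measurable_complex_of_real measurable_power_weight that)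
    show "norm (of_real (?d x) * H x) \<le> B * (?d x * exp (- \<delta> * ?S x))" if "x \<in> space (orthant I)" for x
      using mult_left_mono[OF \<open>\<And>x. x \<in> space (orthant I) \<Longrightarrow> norm (H x) \<le> B * exp (- \<delta> * ?S x)\<close>[OF that] power_weight_nonneg[of a I x]]
      by (simp add: norm_mult power_weight_nonneg mult_ac)
  qed (use k I a that in auto)
  have i1: "integrable (orthant I) (\<lambda>x. of_real (?d x) * \<Phi> x * of_real (?w x))"
    by (rule int[OF m\<Phi> b\<Phi> \<open>\<epsilon> > 0\<close>])
  have i2: "integrable (orthant I) (\<lambda>x. of_real (?d x) * (of_real (x i) * \<Psi> x) * of_real (?w x))"
  proof (rule int)
    show "(\<lambda>x. of_real (x i) * \<Psi> x) \<in> borel_measurable (orthant I)"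
      by (intro borel_measurable_times m\<Psi> measurable_complex_of_real measurable_orthant_component I)
    fix x assume x: "x \<in> space (orthant I)"
    have "norm (of_real (x i) * \<Psi> x) \<le> (D2 * exp (\<epsilon> / 4 * ?S x)) * (C * exp (- \<epsilon> * ?S x))"
      unfolding norm_mult using orthant_pos[OF x I(2)] D2(1) by (intro mult_mono b\<Psi> x) (use xb[OF x] in auto)
    also have "\<dots> = D2 * C * (exp (\<epsilon> / 4 * ?S x) * exp (- \<epsilon> * ?S x))" by (simp only: mult_ac)
    also have "exp (\<epsilon> / 4 * ?S x) * exp (- \<epsilon> * ?S x) = exp (- (3 * \<epsilon> / 4) * ?S x)"
      unfolding exp_add[symmetric] by (simp add: algebra_simps)
    finally show "norm (of_real (x i) * \<Psi> x) \<le> D2 * C * exp (- (3 * \<epsilon> / 4) * ?S x)" .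
  qed (use \<open>\<epsilon> > 0\<close> in simp)
  have m1: "(\<lambda>x. of_real (?d x) * \<Phi> x * of_real (?w x)) \<in> borel_measurable (orthant I)" using i1 by auto
  have sw: "of_real (?d x) * \<Phi> (x \<circ> swp i j) * of_real (?w x) = (\<lambda>x. of_real (?d x) * \<Phi> x * of_real (?w x)) (x \<circ> swp i j)" if "j \<in> J" for j x
    using power_weight_swp[OF I(2), of j a x] weight_swp[OF I, of j k x] that J(3) by simp
  have i3: "integrable (orthant I) (\<lambda>x. of_real (?d x) * \<Phi> (x \<circ> swp i j) * of_real (?w x))"
    and e3: "(\<integral>x. of_real (?d x) * \<Phi> (x \<circ> swp i j) * of_real (?w x) \<partial>orthant I) = (\<integral>x. of_real (?d x) * \<Phi> x * of_real (?w x) \<partial>orthant I)"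
    if "j \<in> J" for j
    unfolding sw[OF that] using integrable_orthant_swp[OF I _ m1, of j] integral_orthant_swp[OF I _ m1, of j] i1 that J(3) by auto
  have "(\<integral>x. G x * of_real (?w x) \<partial>orthant I) = (\<integral>x. of_real a * (of_real (?d x) * \<Phi> x * of_real (?w x))
     + of_real (?d x) * (of_real (x i) * \<Psi> x) * of_real (?w x) + of_real k * (\<Sum>j\<in>J. of_real (?d x) * \<Phi> (x \<circ> swp i j) * of_real (?w x)) \<partial>orthant I)"
    unfolding G_def by (intro Bochner_Integration.integral_cong refl) (simp add: algebra_simps sum_distrib_left sum_distrib_right)
  also have "\<dots> = of_real a * (\<integral>x. of_real (?d x) * \<Phi> x * of_real (?w x) \<partial>orthant I) + (\<integral>x. of_real (?d x) * (of_real (x i) * \<Psi> x) * of_real (?w x) \<partial>orthant I)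
     + of_real k * (\<Sum>j\<in>J. \<integral>x. of_real (?d x) * \<Phi> (x \<circ> swp i j) * of_real (?w x) \<partial>orthant I)"
  proof -
    have A: "integrable (orthant I) (\<lambda>x. of_real a * (of_real (?d x) * \<Phi> x * complex_of_real (?w x)))"
      by (rule integrable_mult_right[OF i1])
    have B: "integrable (orthant I) (\<lambda>x. of_real k * (\<Sum>j\<in>J. of_real (?d x) * \<Phi> (x \<circ> swp i j) * complex_of_real (?w x)))"
      by (intro integrable_mult_right Bochner_Integration.integrable_sum i3)
    show ?thesis
      unfolding Bochner_Integration.integral_add[OF Bochner_Integration.integrable_add[OF A i2] B] Bochner_Integration.integral_add[OF A i2]
        integral_mult_right_zero
      by (subst Bochner_Integration.integral_sum) (rule i3, simp, simp)
  qed
  also have "(\<Sum>j\<in>J. \<integral>x. of_real (?d x) * \<Phi> (x \<circ> swp i j) * of_real (?w x) \<partial>orthant I) = of_nat (card J) * (\<integral>x. of_real (?d x) * \<Phi> x * of_real (?w x) \<partial>orthant I)"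
    using e3 by (simp cong: sum.cong)
  finally have z: "0 = (of_real a + of_real k * of_nat (card J)) * (\<integral>x. of_real (?d x) * \<Phi> x * of_real (?w x) \<partial>orthant I) + (\<integral>x. of_real (?d x) * (of_real (x i) * \<Psi> x) * of_real (?w x) \<partial>orthant I)"
    unfolding G0 by (simp add: algebra_simps)
  have c: "real (card I) - 1 = card J" using J by simp
  show ?thesis unfolding c eq_neg_iff_add_eq_0 of_real_add of_real_mult of_real_of_nat_eq by (rule z[symmetric])
qed

text \<open>Convexity on N - 1, N, N + s and on N, N + s, N + 1 squeezes f(N + s) - f(N) between s
  h(N - 1) and s h(N). For two solutions of the same difference equation these increments differ by
  at most s |h(N) - h(N - 1)|, which tends to 0, while the difference of the solutions has period
  1.\<close>

lemma convex_periodic_difference: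
  fixes u v h :: "real \<Rightarrow> real"
  assumes cu: "convex_on {1..} u" and cv: "convex_on {1..} v"
    and u: "\<And>x. x \<ge> 1 \<Longrightarrow> u (x + 1) = u x + h x" and v: "\<And>x. x \<ge> 1 \<Longrightarrow> v (x + 1) = v x + h x"
    and h: "(\<lambda>n. h (real n + 2) - h (real n + 1)) \<longlonglongrightarrow> 0" and "x \<ge> 1"
  shows "u x - v x = u 1 - v 1"
proof -
  have up: "f (N + s) \<le> f N + s * h N" and lo: "f N + s * h (N - 1) \<le> f (N + s)"
    if f: "convex_on {1..} f" and inc: "\<And>x. x \<ge> 1 \<Longrightarrow> f (x + 1) = f x + h x" and s: "0 \<le> s" "s \<le> 1" and N: "N \<ge> 2" for f N s
  proof -
    have "f ((1 - s) *\<^sub>R N + s *\<^sub>R (N + 1)) \<le> (1 - s) * f N + s * f (N + 1)"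
      using s N by (intro convex_onD[OF f]) auto
    then show "f (N + s) \<le> f N + s * h N" using inc[of N] N by (simp add: algebra_simps)
    \<comment> \<open>N is the convex combination of N - 1 and N + s with weight 1 / (1 + s) on the
      latter.\<close>
    have "f ((1 - 1 / (1 + s)) *\<^sub>R (N - 1) + (1 / (1 + s)) *\<^sub>R (N + s)) \<le> (1 - 1 / (1 + s)) * f (N - 1) + 1 / (1 + s) * f (N + s)"
      using s N by (intro convex_onD[OF f]) auto
    moreover have "(1 - 1 / (1 + s)) *\<^sub>R (N - 1) + (1 / (1 + s)) *\<^sub>R (N + s) = N"
    proof -
      have r: "(1 - r) * (N - 1) + r * (N + s) = N" if "r * (1 + s) = 1" for r
        using that by (simp add: algebra_simps)
      show ?thesis unfolding real_scaleR_def by (rule r) (use s in simp)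
    qed
    ultimately have "f N * (1 + s) \<le> ((1 - 1 / (1 + s)) * f (N - 1) + 1 / (1 + s) * f (N + s)) * (1 + s)"
      using s by (intro mult_right_mono) auto
    also have "\<dots> = s * f (N - 1) + f (N + s)"
    proof -
      have r: "((1 - r) * A + r * B) * (1 + s) = s * A + B" if "r * (1 + s) = 1" for r A B
      proof -
        have "((1 - r) * A + r * B) * (1 + s) = (1 + s) * A - (r * (1 + s)) * A + (r * (1 + s)) * B" by (simp add: algebra_simps)
        then show ?thesis unfolding that by (simp add: algebra_simps)
      qed
      show ?thesis by (rule r) (use s in simp)
    qed
    finally show "f N + s * h (N - 1) \<le> f (N + s)" using inc[of "N - 1"] N by (simp add: algebra_simps)
  qed
  define d where "d x = u x - v x" for x
  have per: "d (y + real n) = d y" if "y \<ge> 1" for y n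
  proof (induction n)
    case (Suc n)
    then show ?case using u[of "y + n"] v[of "y + n"] that by (simp add: d_def algebra_simps)
  qed simp
  have base: "d (1 + s) = d 1" if s: "0 \<le> s" "s \<le> 1" for s
  proof -
    have "\<bar>d (1 + s) - d 1\<bar> \<le> \<bar>h (real n + 2) - h (real n + 1)\<bar>" for n
    proof -
      \<comment> \<open>The offset 2 keeps N - 1 in the half-line from 1 on, where convexity and the
        difference equation hold.\<close>
      let ?N = "real n + 2"
      have e: "?N - 1 = real n + 1" "(1 + s) + real (Suc n) = ?N + s" "1 + real (Suc n) = ?N" by simp_all
      have "d (?N + s) = d (1 + s)" "d ?N = d 1"
        using per[of "1 + s" "Suc n"] per[of 1 "Suc n"] s by (simp_all only: e(2) e(3))
      moreover have "\<bar>d (?N + s) - d ?N\<bar> \<le> s * \<bar>h ?N - h (real n + 1)\<bar>"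
      proof -
        have "u (?N + s) - u ?N \<le> s * h ?N" "s * h (real n + 1) \<le> u (?N + s) - u ?N"
          "v (?N + s) - v ?N \<le> s * h ?N" "s * h (real n + 1) \<le> v (?N + s) - v ?N"
          using up[OF cu u s, of ?N] lo[OF cu u s, of ?N] up[OF cv v s, of ?N] lo[OF cv v s, of ?N] by (simp_all add: e(1))
        then have "\<bar>d (?N + s) - d ?N\<bar> \<le> s * h ?N - s * h (real n + 1)" by (simp add: d_def abs_le_iff)
        also have "\<dots> = s * (h ?N - h (real n + 1))" by (simp add: algebra_simps)
        also have "\<dots> \<le> s * \<bar>h ?N - h (real n + 1)\<bar>" using s by (intro mult_left_mono) auto
        finally show ?thesis .
      qed
      moreover have "s * \<bar>h ?N - h (real n + 1)\<bar> \<le> 1 * \<bar>h ?N - h (real n + 1)\<bar>" using s by (intro mult_right_mono) auto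
      ultimately show ?thesis by simp
    qed
    moreover have "(\<lambda>n. \<bar>h (real n + 2) - h (real n + 1)\<bar>) \<longlonglongrightarrow> 0" using h by (rule tendsto_rabs_zero)
    ultimately have "\<bar>d (1 + s) - d 1\<bar> \<le> 0" by (intro LIMSEQ_le_const) auto
    then show ?thesis by simp
  qed
  define n where "n = nat \<lfloor>x - 1\<rfloor>"
  have n: "real n \<le> x - 1" "x - 1 < real n + 1" using \<open>x \<ge> 1\<close> unfolding n_def by linarith+
  have "d x = d ((1 + (x - 1 - real n)) + real n)" by simp
  also have "\<dots> = d (1 + (x - 1 - real n))" using n by (intro per) auto
  also have "\<dots> = d 1" using n by (intro base) auto
  finally show ?thesis by (simp add: d_def)
qed

section \<open>The Selberg--Laguerre integral\<close>

definition selberg :: "real \<Rightarrow> 'a set \<Rightarrow> real \<Rightarrow> real" where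
  "selberg k I a = (\<integral>x. power_weight a I x * exp (- (\<Sum>i\<in>I. x i)) * weight k I x \<partial>orthant I)"

lemma of_real_selberg:
  "complex_of_real (selberg k I a) = (\<integral>x. of_real (power_weight a I x) * of_real (exp (- (\<Sum>i\<in>I. x i))) * of_real (weight k I x) \<partial>orthant I)"
  unfolding selberg_def by (simp flip: integral_complex_of_real)

lemma integrable_selberg:
  assumes "k \<ge> 0" "finite I" "a > 0"
  shows "integrable (orthant I) (\<lambda>x. power_weight a I x * exp (- (\<Sum>i\<in>I. x i)) * weight k I x)"
proof -
  have "integrable (orthant I) (\<lambda>x. complex_of_real (power_weight a I x * exp (- 1 * (\<Sum>i\<in>I. x i))) * of_real (weight k I x))"
    by (rule integrable_weighted[where a = a and \<epsilon> = 1 and C = 1])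
       (use assms measurable_orthant_exp[of "-1" I] in \<open>auto intro!: measurable_complex_of_real borel_measurable_times measurable_power_weight measurable_orthant_exp simp: norm_mult power_weight_nonneg\<close>)
  then have "integrable (orthant I) (\<lambda>x. complex_of_real (power_weight a I x * exp (- (\<Sum>i\<in>I. x i)) * weight k I x))"
    by simp
  from integrable_bounded_linear[OF bounded_linear_Re this] show ?thesis by simp
qed

lemma has_vector_derivative_exp_sum:
  assumes "finite I" "i \<in> I"
  shows "((\<lambda>t. complex_of_real (exp (- (\<Sum>l\<in>I. (x(i := t)) l)))) has_vector_derivative - of_real (exp (- (\<Sum>l\<in>I. x l)))) (at (x i))"
proof -
  have S: "(\<Sum>l\<in>I. (x(i := t)) l) = t + (\<Sum>l\<in>I - {i}. x l)" for t
    using assms by (subst sum.remove[of _ i]) (auto intro!: sum.cong)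
  have "((\<lambda>t. exp (- (\<Sum>l\<in>I. (x(i := t)) l))) has_real_derivative - exp (- (\<Sum>l\<in>I. x l))) (at (x i))"
    unfolding S using S[of "x i"] by (auto intro!: derivative_eq_intros)
  from has_vector_derivative_of_real[OF this] show ?thesis by simp
qed

lemma continuous_exp_sum:
  assumes "finite I" "i \<in> I"
  shows "continuous_on A (\<lambda>t. complex_of_real (exp (- (\<Sum>l\<in>I. (x(i := t)) l))))"
proof -
  have S: "(\<Sum>l\<in>I. (x(i := t)) l) = t + (\<Sum>l\<in>I - {i}. x l)" for t
    using assms by (subst sum.remove[of _ i]) (auto intro!: sum.cong)
  show ?thesis unfolding S by (intro continuous_intros)
qed

text \<open>Aomoto's recursion for Selberg's integral.\<close>

lemma selberg_elementary_step:
  fixes k a :: real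
  assumes k: "k > 0" and I: "finite I" "i \<in> I" and J: "J \<subseteq> I" "i \<notin> J" and a: "a \<ge> 1"
  defines "P \<equiv> (\<lambda>J. \<integral>x. of_real (power_weight a I x) * of_real ((\<Prod>l\<in>J. x l) * exp (- (\<Sum>i\<in>I. x i))) * complex_of_real (weight k I x) \<partial>orthant I)"
  shows "P (insert i J) = of_real (a + k * (real (card I) - 1 - real (card J))) * P J"
proof -
  let ?e = "\<lambda>x. exp (- (\<Sum>i\<in>I. x i))"
  have fJ: "finite J" using J I finite_subset by blast
  define \<Phi> where "\<Phi> A x = complex_of_real ((\<Prod>l\<in>A. x l) * ?e x)" for A and x :: "'a \<Rightarrow> real"
  \<comment> \<open>This is T_i applied to \<open>\<Phi> J\<close> for i outside J. A swap with l in
    J replaces x_l by x_i and contributes \<open>- \<Phi> (J - {l})\<close>; a swap with an index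
    outside J changes nothing.\<close>
  define \<Psi> where "\<Psi> x = - \<Phi> J x - of_real k * (\<Sum>l\<in>J. \<Phi> (J - {l}) x)" for x
  have m: "\<Phi> A \<in> borel_measurable (orthant I)" if "A \<subseteq> I" for A
    unfolding \<Phi>_def using measurable_orthant_exp[of "-1" I] that
    by (intro measurable_complex_of_real borel_measurable_times borel_measurable_prod measurable_orthant_component) auto
  obtain D where D: "D > 0" "\<And>x. x \<in> space (orthant I) \<Longrightarrow> (1 + (\<Sum>i\<in>I. x i)) powr (card I) \<le> D * exp (1 / 2 * (\<Sum>i\<in>I. x i))"
    using poly_exp_bound[of "card I" "1 / 2" I] by auto
  have b: "norm (\<Phi> A x) \<le> D * exp (- (1 / 2) * (\<Sum>i\<in>I. x i))" if A: "A \<subseteq> I" and x: "x \<in> space (orthant I)" for A x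
  proof -
    have S: "0 \<le> (\<Sum>i\<in>I. x i)" by (rule orthant_sum_nonneg[OF x])
    have pos: "x l > 0" if "l \<in> A" for l using orthant_pos[OF x] that A by auto
    have "(\<Prod>l\<in>A. x l) \<le> (\<Prod>l\<in>A. 1 + (\<Sum>i\<in>I. x i))"
      using orthant_le_sum[OF I(1) x] A pos by (intro prod_mono) (auto intro: less_imp_le)
    also have "\<dots> = (1 + (\<Sum>i\<in>I. x i)) ^ card A" by simp
    also have "\<dots> \<le> (1 + (\<Sum>i\<in>I. x i)) ^ card I" using S card_mono[OF I(1) A] by (intro power_increasing) auto
    also have "\<dots> = (1 + (\<Sum>i\<in>I. x i)) powr (card I)" using S by (subst powr_realpow) auto
    also have "\<dots> \<le> D * exp (1 / 2 * (\<Sum>i\<in>I. x i))" by (rule D(2)[OF x])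
    finally have "(\<Prod>l\<in>A. x l) * ?e x \<le> (D * exp (1 / 2 * (\<Sum>i\<in>I. x i))) * ?e x" by (rule mult_right_mono) simp
    also have "\<dots> = D * (exp (1 / 2 * (\<Sum>i\<in>I. x i)) * ?e x)" by simp
    also have "exp (1 / 2 * (\<Sum>i\<in>I. x i)) * ?e x = exp (- (1 / 2) * (\<Sum>i\<in>I. x i))" unfolding exp_add[symmetric] by (simp add: algebra_simps)
    finally have "(\<Prod>l\<in>A. x l) * ?e x \<le> D * exp (- (1 / 2) * (\<Sum>i\<in>I. x i))" .
    moreover have "norm (\<Phi> A x) = (\<Prod>l\<in>A. x l) * ?e x"
      unfolding \<Phi>_def norm_of_real using pos by (intro abs_of_nonneg mult_nonneg_nonneg prod_nonneg) (auto intro: less_imp_le)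
    ultimately show ?thesis by simp
  qed
  have swap: "\<Phi> J (x \<circ> swp i l) = of_real (x i) * \<Phi> (J - {l}) x" if "l \<in> J" for l x
  proof -
    have "(\<Prod>a\<in>J. (x \<circ> swp i l) a) = (x \<circ> swp i l) l * (\<Prod>a\<in>J - {l}. (x \<circ> swp i l) a)"
      using fJ that by (rule prod.remove)
    also have "(\<Prod>a\<in>J - {l}. (x \<circ> swp i l) a) = (\<Prod>a\<in>J - {l}. x a)"
      using J(2) by (intro prod.cong) (auto simp: Transposition.transpose_def)
    finally show ?thesis using sum_swp[OF I(2), of l x] that J(1) by (auto simp: \<Phi>_def)
  qed
  have swap': "\<Phi> J (x \<circ> swp i l) = \<Phi> J x" if "l \<in> I" "l \<notin> J" for l x
  proof -
    have "(\<Prod>a\<in>J. (x \<circ> swp i l) a) = (\<Prod>a\<in>J. x a)"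
      using J(2) that by (intro prod.cong) (auto simp: Transposition.transpose_def)
    then show ?thesis using sum_swp[OF I(2) that(1), of x] by (simp add: \<Phi>_def)
  qed
  have upd: "\<Phi> J (x(i := t)) = of_real (\<Prod>l\<in>J. x l) * of_real (exp (- (\<Sum>l\<in>I. (x(i := t)) l)))" for x t
  proof -
    have "(\<Prod>l\<in>J. (x(i := t)) l) = (\<Prod>l\<in>J. x l)" using J(2) by (intro prod.cong) auto
    then show ?thesis by (simp add: \<Phi>_def)
  qed
  let ?C = "D * (1 + k * card J)"
  have main: "of_real (a + k * (real (card I) - 1)) * (\<integral>x. of_real (power_weight a I x) * \<Phi> J x * of_real (weight k I x) \<partial>orthant I)
    = - (\<integral>x. of_real (power_weight a I x) * (of_real (x i) * \<Psi> x) * of_real (weight k I x) \<partial>orthant I)"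
  proof (rule dunkl_ibp_power[where \<epsilon> = "1/2" and C = ?C])
    show "\<Phi> J \<in> borel_measurable (orthant I)" by (rule m[OF J(1)])
    show "\<Psi> \<in> borel_measurable (orthant I)"
      unfolding \<Psi>_def using J(1) by (intro borel_measurable_diff borel_measurable_uminus borel_measurable_times borel_measurable_sum borel_measurable_const m) auto
  next
    fix x assume x: "x \<in> space (orthant I)"
    let ?E = "exp (- (1 / 2) * (\<Sum>i\<in>I. x i))"
    have "D * ?E * 1 \<le> D * ?E * (1 + k * card J)" using D(1) k by (intro mult_left_mono) auto
    then have "D * ?E \<le> ?C * ?E" by (simp only: mult_ac mult_1_left)
    then show "norm (\<Phi> J x) \<le> ?C * ?E" using b[OF J(1) x] by linarith
    have "norm (of_real k * (\<Sum>l\<in>J. \<Phi> (J - {l}) x)) \<le> k * (\<Sum>l\<in>J. D * ?E)"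
      unfolding norm_mult using k J(1) by (intro mult_mono sum_norm_le b x) (auto intro: sum_nonneg)
    then have "norm (\<Psi> x) \<le> D * ?E + k * (\<Sum>l\<in>J. D * ?E)"
      unfolding \<Psi>_def using b[OF J(1) x] by (intro order_trans[OF norm_triangle_ineq4] add_mono) auto
    also have "\<dots> = ?C * ?E" by (simp add: algebra_simps)
    finally show "norm (\<Psi> x) \<le> ?C * ?E" .
  next
    fix x show "continuous_on {0..} (\<lambda>t. \<Phi> J (x(i := t)))"
      unfolding upd by (intro continuous_on_mult continuous_on_const continuous_exp_sum I)
  next
    fix x assume x: "x \<in> space (orthant I)" and inj: "inj_on x I"
    have D: "((\<lambda>t. \<Phi> J (x(i := t))) has_vector_derivative of_real (\<Prod>l\<in>J. x l) * (- of_real (?e x))) (at (x i))"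
      unfolding upd by (intro has_vector_derivative_mult_right has_vector_derivative_exp_sum I)
    have "(\<Sum>j\<in>I - {i}. (\<Phi> J x - \<Phi> J (x \<circ> swp i j)) / of_real (x i - x j)) = (\<Sum>j\<in>I - {i}. if j \<in> J then - \<Phi> (J - {j}) x else 0)"
    proof (rule sum.cong[OF refl])
      fix j assume j: "j \<in> I - {i}"
      show "(\<Phi> J x - \<Phi> J (x \<circ> swp i j)) / of_real (x i - x j) = (if j \<in> J then - \<Phi> (J - {j}) x else 0)"
      proof (cases "j \<in> J")
        case True
        have "\<Phi> J x = of_real (x j) * \<Phi> (J - {j}) x" using prod.remove[OF fJ True, of x] by (simp add: \<Phi>_def)
        then have "\<Phi> J x - \<Phi> J (x \<circ> swp i j) = - (of_real (x i - x j) * \<Phi> (J - {j}) x)" using swap[OF True] by (simp add: algebra_simps)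
        moreover have "complex_of_real (x i - x j) \<noteq> 0" using inj j I(2) by (auto simp: inj_on_def)
        ultimately show ?thesis using True by simp
      qed (use j swap' in auto)
    qed
    also have "\<dots> = (\<Sum>j\<in>J. - \<Phi> (J - {j}) x)"
      using I(1) J by (subst sum.inter_restrict[symmetric]) (auto intro!: sum.cong)
    finally have "\<Psi> x - of_real k * (\<Sum>j\<in>I - {i}. (\<Phi> J x - \<Phi> J (x \<circ> swp i j)) / of_real (x i - x j)) = of_real (\<Prod>l\<in>J. x l) * (- of_real (?e x))"
      by (simp add: \<Psi>_def sum_negf) (simp add: \<Phi>_def)
    then show "((\<lambda>t. \<Phi> J (x(i := t))) has_vector_derivative (\<Psi> x - of_real k * (\<Sum>j\<in>I - {i}. (\<Phi> J x - \<Phi> J (x \<circ> swp i j)) / of_real (x i - x j)))) (at (x i))"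
      using D by simp
  qed (use assms in auto)
  have iP: "integrable (orthant I) (\<lambda>x. of_real (power_weight a I x) * \<Phi> A x * of_real (weight k I x))" if "A \<subseteq> I" for A
  proof (rule integrable_weighted[where a = a and C = D and \<epsilon> = "1/2"])
    show "(\<lambda>x. of_real (power_weight a I x) * \<Phi> A x) \<in> borel_measurable (orthant I)"
      by (intro borel_measurable_times measurable_complex_of_real measurable_power_weight m that)
    show "norm (of_real (power_weight a I x) * \<Phi> A x) \<le> D * (power_weight a I x * exp (- (1 / 2) * (\<Sum>i\<in>I. x i)))" if x: "x \<in> space (orthant I)" for x
      using mult_left_mono[OF b[OF \<open>A \<subseteq> I\<close> x] power_weight_nonneg[of a I x]] by (simp add: norm_mult power_weight_nonneg mult_ac)
  qed (use assms in auto)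
  have PJ: "P A = (\<integral>x. of_real (power_weight a I x) * \<Phi> A x * of_real (weight k I x) \<partial>orthant I)" for A
    unfolding P_def \<Phi>_def ..
  let ?f = "\<lambda>x. of_real (power_weight a I x) * \<Phi> J x * complex_of_real (weight k I x)"
  have mf: "?f \<in> borel_measurable (orthant I)" using iP[OF J(1)] by auto
  have fs: "?f (x \<circ> swp i l) = of_real (power_weight a I x) * \<Phi> J (x \<circ> swp i l) * of_real (weight k I x)" if "l \<in> J" for l x
    using power_weight_swp[OF I(2), of l a x] weight_swp[OF I, of l k x] that J(1) by auto
  have iss: "integrable (orthant I) (\<lambda>x. of_real (power_weight a I x) * \<Phi> J (x \<circ> swp i l) * of_real (weight k I x))"
    "(\<integral>x. of_real (power_weight a I x) * \<Phi> J (x \<circ> swp i l) * of_real (weight k I x) \<partial>orthant I) = P J" if "l \<in> J" for l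
    unfolding fs[OF that, symmetric] PJ using integrable_orthant_swp[OF I _ mf, of l] integral_orthant_swp[OF I _ mf, of l] iP[OF J(1)] that J(1) by auto
  \<comment> \<open>Here x_i times \<open>\<Phi> (J - {l})\<close> is a reflection of
    \<open>\<Phi> J\<close>, whose weighted integral is again \<open>P J\<close>. These card J terms
    lower n - 1 to n - 1 - card J in the constant.\<close>
  have x\<Psi>: "of_real (x i) * \<Psi> x = - \<Phi> (insert i J) x - of_real k * (\<Sum>l\<in>J. \<Phi> J (x \<circ> swp i l))" for x
  proof -
    have "\<Phi> (insert i J) x = of_real (x i) * \<Phi> J x" using fJ J(2) by (simp add: \<Phi>_def)
    moreover have "(\<Sum>l\<in>J. \<Phi> J (x \<circ> swp i l)) = of_real (x i) * (\<Sum>l\<in>J. \<Phi> (J - {l}) x)" using swap by (simp add: sum_distrib_left)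
    ultimately show ?thesis by (simp add: \<Psi>_def algebra_simps)
  qed
  have "(\<integral>x. of_real (power_weight a I x) * (of_real (x i) * \<Psi> x) * of_real (weight k I x) \<partial>orthant I)
    = (\<integral>x. - (of_real (power_weight a I x) * \<Phi> (insert i J) x * of_real (weight k I x))
        - of_real k * (\<Sum>l\<in>J. of_real (power_weight a I x) * \<Phi> J (x \<circ> swp i l) * of_real (weight k I x)) \<partial>orthant I)"
    unfolding x\<Psi> by (intro Bochner_Integration.integral_cong refl) (simp add: algebra_simps sum_distrib_left sum_distrib_right)
  also have "\<dots> = - P (insert i J) - of_real k * (\<Sum>l\<in>J. P J)"
  proof -
    have 1: "integrable (orthant I) (\<lambda>x. - (of_real (power_weight a I x) * \<Phi> (insert i J) x * complex_of_real (weight k I x)))"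
      using iP[of "insert i J"] I(2) J(1) by simp
    have 2: "integrable (orthant I) (\<lambda>x. of_real k * (\<Sum>l\<in>J. of_real (power_weight a I x) * \<Phi> J (x \<circ> swp i l) * complex_of_real (weight k I x)))"
      by (intro integrable_mult_right Bochner_Integration.integrable_sum iss)
    show ?thesis
      unfolding Bochner_Integration.integral_diff[OF 1 2] PJ[of "insert i J"] using iss by (simp add: Bochner_Integration.integral_sum)
  qed
  finally have "of_real (a + k * (real (card I) - 1)) * P J = P (insert i J) + of_real k * (of_nat (card J) * P J)"
    using main unfolding PJ[symmetric] by simp
  then show ?thesis by (simp add: algebra_simps)
qed


text \<open>The indices enter the product one at a time by \<open>selberg_elementary_step\<close>;
  once all are present, the product of the x_l raises a by 1. The factors come out in reverse order
  and are reindexed.\<close>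

lemma selberg_add_one:
  assumes k: "k > 0" and I: "finite I" and a: "a \<ge> 1"
  shows "selberg k I (a + 1) = (\<Prod>m<card I. a + k * real m) * selberg k I a"
proof -
  define P where "P J = (\<integral>x. of_real (power_weight a I x) * of_real ((\<Prod>l\<in>J. x l) * exp (- (\<Sum>i\<in>I. x i))) * complex_of_real (weight k I x) \<partial>orthant I)" for J
  have "J \<subseteq> I \<Longrightarrow> P J = of_real (\<Prod>m<card J. a + k * (real (card I) - 1 - real m)) * P {}" if "finite J" for J
    using that
  proof (induction J)
    case (insert i J)
    then have "P (insert i J) = of_real (a + k * (real (card I) - 1 - real (card J))) * P J"
      unfolding P_def by (intro selberg_elementary_step k I a) auto
    then show ?case using insert by (simp add: mult_ac)
  qed simp
  from this[OF I subset_refl] have PI: "P I = of_real (\<Prod>m<card I. a + k * (real (card I) - 1 - real m)) * P {}" .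
  have "(\<Prod>m<card I. a + k * (real (card I) - 1 - real m)) = (\<Prod>m<card I. (\<lambda>m. a + k * real m) (card I - Suc m))"
    by (intro prod.cong refl) (simp add: of_nat_diff algebra_simps)
  also have "\<dots> = (\<Prod>m<card I. a + k * real m)" by (rule prod.nat_diff_reindex)
  finally have pr: "(\<Prod>m<card I. a + k * (real (card I) - 1 - real m)) = (\<Prod>m<card I. a + k * real m)" .
  have "P I = of_real (selberg k I (a + 1))"
    unfolding P_def of_real_selberg
  proof (intro Bochner_Integration.integral_cong refl)
    fix x assume x: "x \<in> space (orthant I)"
    have "power_weight a I x * (\<Prod>l\<in>I. x l) = power_weight (a + 1) I x"
      unfolding power_weight_def prod.distrib[symmetric]
    proof (rule prod.cong[OF refl])
      fix l assume "l \<in> I"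
      then have "x l > 0" using orthant_pos[OF x] by auto
      then show "x l powr (a - 1) * x l = x l powr (a + 1 - 1)" by (simp add: powr_diff)
    qed
    then show "of_real (power_weight a I x) * of_real ((\<Prod>l\<in>I. x l) * exp (- (\<Sum>i\<in>I. x i))) * complex_of_real (weight k I x)
      = of_real (power_weight (a + 1) I x) * of_real (exp (- (\<Sum>i\<in>I. x i))) * complex_of_real (weight k I x)"
      by (simp flip: of_real_mult add: mult.assoc[symmetric])
  qed
  moreover have "P {} = of_real (selberg k I a)" by (simp add: P_def of_real_selberg)
  ultimately have "complex_of_real (selberg k I (a + 1)) = of_real ((\<Prod>m<card I. a + k * real m) * selberg k I a)"
    using PI unfolding pr by (simp only: of_real_mult)
  then show ?thesis by (simp only: of_real_eq_iff)
qed

text \<open>At a = 1 the power weight is 1, and T_i sends the exponential to its negative, so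
  integration by parts leaves exactly the face x_i = 0. There the factors |0 - x_j|^(2 k) form a
  power weight with a - 1 = 2 k.\<close>

lemma selberg_one:
  assumes k: "k > 0" and I: "finite I" "i \<in> I"
  shows "selberg k I 1 = selberg k (I - {i}) (2 * k + 1)"
proof -
  let ?e = "\<lambda>x. complex_of_real (exp (- (\<Sum>i\<in>I. x i)))"
  have me: "?e \<in> borel_measurable (orthant I)"
    using measurable_orthant_exp[of "-1" I] by (intro measurable_complex_of_real) simp
  have "(\<integral>x. - ?e x * of_real (weight k I x) \<partial>orthant I) = - (\<integral>x. ?e (x(i := 0)) * of_real (weight k I (x(i := 0))) \<partial>orthant (I - {i}))"
  proof (rule orthant_ibp[OF k I, where \<epsilon> = 1 and C = 1 and F = ?e and G = "\<lambda>x. - ?e x"])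
    fix x assume "x \<in> space (orthant I)" "inj_on x I"
    have "(\<Sum>j\<in>I - {i}. (?e x - ?e (x \<circ> swp i j)) / of_real (x i - x j)) = 0"
      using sum_swp[OF I(2), of _ x] by (intro sum.neutral) (auto simp del: comp_apply)
    then show "((\<lambda>t. ?e (x(i := t))) has_vector_derivative (- ?e x - of_real k * (\<Sum>j\<in>I - {i}. (?e x - ?e (x \<circ> swp i j)) / of_real (x i - x j)))) (at (x i))"
      using has_vector_derivative_exp_sum[OF I, of x] by simp
  qed (use me continuous_exp_sum[OF I] in auto)
  moreover have "(\<integral>x. - ?e x * of_real (weight k I x) \<partial>orthant I) = - of_real (selberg k I 1)"
  proof -
    have "power_weight 1 I x = 1" if "x \<in> space (orthant I)" for x
      unfolding power_weight_def using orthant_pos[OF that] by (intro prod.neutral) force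
    then have "of_real (selberg k I 1) = (\<integral>x. ?e x * of_real (weight k I x) \<partial>orthant I)"
      unfolding of_real_selberg by (intro Bochner_Integration.integral_cong) auto
    then show ?thesis by simp
  qed
  moreover have "(\<integral>x. ?e (x(i := 0)) * of_real (weight k I (x(i := 0))) \<partial>orthant (I - {i})) = of_real (selberg k (I - {i}) (2 * k + 1))"
    unfolding of_real_selberg
  proof (intro Bochner_Integration.integral_cong refl)
    fix x assume x: "x \<in> space (orthant (I - {i}))"
    have "(\<Sum>l\<in>I. (x(i := 0)) l) = (\<Sum>l\<in>I - {i}. x l)"
      using I by (subst sum.remove[of _ i]) (auto intro!: sum.cong)
    moreover have "(\<Prod>j\<in>I - {i}. \<bar>0 - x j\<bar> powr (2 * k)) = power_weight (2 * k + 1) (I - {i}) x"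
      unfolding power_weight_def by (intro prod.cong refl) (simp add: abs_of_pos orthant_pos[OF x])
    ultimately show "?e (x(i := 0)) * of_real (weight k I (x(i := 0))) = of_real (power_weight (2 * k + 1) (I - {i}) x) * of_real (exp (- (\<Sum>i\<in>I - {i}. x i))) * of_real (weight k (I - {i}) x)"
      unfolding weight_fun_upd[OF I] by simp
  qed
  ultimately show ?thesis by simp
qed

lemma selberg_nonneg: "selberg k I a \<ge> 0"
  unfolding selberg_def by (intro Bochner_Integration.integral_nonneg) (simp add: power_weight_nonneg weight_nonneg)

text \<open>The power weight is positive on the orthant, so the integrand has the same zeros for all
  exponents. Vanishing of one integral would force the integrand to be 0 almost everywhere for every
  exponent.\<close>

lemma selberg_pos:
  assumes "k \<ge> 0" "finite I" "a > 0" "b > 0" "selberg k I b > 0"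
  shows "selberg k I a > 0"
proof (rule ccontr)
  assume "\<not> selberg k I a > 0"
  then have "selberg k I a = 0" using selberg_nonneg[of k I a] by simp
  then have "AE x in orthant I. power_weight a I x * exp (- (\<Sum>i\<in>I. x i)) * weight k I x = 0"
    unfolding selberg_def by (subst (asm) integral_nonneg_eq_0_iff_AE[OF integrable_selberg[OF assms(1-3)]]) (simp_all add: power_weight_nonneg weight_nonneg)
  then have "AE x in orthant I. power_weight b I x * exp (- (\<Sum>i\<in>I. x i)) * weight k I x = 0"
  proof (rule AE_mp, intro AE_I2 impI)
    fix x assume x: "x \<in> space (orthant I)" and z: "power_weight a I x * exp (- (\<Sum>i\<in>I. x i)) * weight k I x = 0"
    have "power_weight a I x > 0" unfolding power_weight_def using orthant_pos[OF x] by (intro prod_pos ballI) (metis less_irrefl powr_gt_zero)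
    then show "power_weight b I x * exp (- (\<Sum>i\<in>I. x i)) * weight k I x = 0" using z by auto
  qed
  then have "selberg k I b = 0" unfolding selberg_def by (rule integral_eq_zero_AE)
  then show False using assms(5) by simp
qed

text \<open>This is Hoelder's inequality, obtained from Young's inequality applied pointwise to the
  power weights normalized by their integrals; \<open>K\<close> is the resulting bound.\<close>

lemma selberg_log_convex:
  assumes "k \<ge> 0" "finite I" and pos: "\<And>a. a > 0 \<Longrightarrow> selberg k I a > 0"
  shows "convex_on {1..} (\<lambda>a. ln (selberg k I a))"
proof (rule convex_onI)
  fix t x y :: real assume t: "0 < t" "t < 1" and xy: "x \<in> {1..}" "y \<in> {1..}"
  let ?z = "(1 - t) * x + t * y"
  let ?f = "\<lambda>a x. power_weight a I x * exp (- (\<Sum>i\<in>I. x i)) * weight k I x"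
  have "(1 - t) * x > 0" "t * y > 0" using t xy by auto
  then have z: "?z > 0" by linarith
  have c: "selberg k I x > 0" "selberg k I y > 0" "selberg k I ?z > 0" using pos xy z by auto
  define K where "K = selberg k I x powr (1 - t) * selberg k I y powr t"
  have K: "K > 0" using c by (simp add: K_def)
  have "selberg k I ?z \<le> (\<integral>u. K * ((1 - t) / selberg k I x * ?f x u + t / selberg k I y * ?f y u) \<partial>orthant I)"
    unfolding selberg_def[of k I ?z]
  proof (rule integral_mono)
    show "integrable (orthant I) (?f ?z)" by (rule integrable_selberg[OF assms(1,2) z])
    show "integrable (orthant I) (\<lambda>u. K * ((1 - t) / selberg k I x * ?f x u + t / selberg k I y * ?f y u))"
      using xy by (intro integrable_mult_right Bochner_Integration.integrable_add integrable_selberg assms) auto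
    fix u assume u: "u \<in> space (orthant I)"
    let ?A = "power_weight x I u / selberg k I x" and ?B = "power_weight y I u / selberg k I y"
    have pw: "power_weight a I u > 0" for a unfolding power_weight_def using orthant_pos[OF u] by (intro prod_pos ballI) (metis less_irrefl powr_gt_zero)
    have pr: "(\<Prod>l\<in>I. g l) powr s = (\<Prod>l\<in>I. g l powr s)" if "\<And>l. l \<in> I \<Longrightarrow> g l \<ge> 0" for g :: "'a \<Rightarrow> real" and s
      using that assms(2) by (simp add: prod_powr_distrib)
    have "power_weight ?z I u = power_weight x I u powr (1 - t) * power_weight y I u powr t"
    proof -
      have "power_weight x I u powr (1 - t) = (\<Prod>l\<in>I. (u l powr (x - 1)) powr (1 - t))"
        "power_weight y I u powr t = (\<Prod>l\<in>I. (u l powr (y - 1)) powr t)"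
        unfolding power_weight_def by (rule pr; simp)+
      then show ?thesis
        unfolding power_weight_def[of ?z] by (simp only: prod.distrib[symmetric]) (intro prod.cong refl, simp add: powr_powr algebra_simps flip: powr_add)
    qed
    also have "\<dots> = K * (?A powr (1 - t) * ?B powr t)"
      using c pw[of x] pw[of y] by (simp add: K_def powr_divide)
    also have "\<dots> \<le> K * ((1 - t) * ?A + t * ?B)"
      using Youngs_inequality_0[of "1 - t" t ?A ?B] t c pw[of x] pw[of y] K by (intro mult_left_mono) auto
    finally have "?f ?z u \<le> K * ((1 - t) * ?A + t * ?B) * (exp (- (\<Sum>i\<in>I. u i)) * weight k I u)"
      unfolding mult.assoc[of "power_weight ?z I u"] by (rule mult_right_mono) (simp add: weight_nonneg)
    also have "\<dots> = K * ((1 - t) / selberg k I x * ?f x u + t / selberg k I y * ?f y u)" by (simp add: algebra_simps)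
    finally show "?f ?z u \<le> K * ((1 - t) / selberg k I x * ?f x u + t / selberg k I y * ?f y u)" .
  qed
  also have "\<dots> = K * ((1 - t) / selberg k I x * selberg k I x + t / selberg k I y * selberg k I y)"
  proof -
    have i: "integrable (orthant I) (?f x)" "integrable (orthant I) (?f y)" using xy by (auto intro!: integrable_selberg assms)
    show ?thesis unfolding integral_mult_right_zero
      by (subst Bochner_Integration.integral_add) (use i in \<open>auto simp: selberg_def\<close>)
  qed
  also have "\<dots> = K" using c by simp
  finally have "ln (selberg k I ?z) \<le> ln K" using c(3) K by simp
  also have "ln K = (1 - t) * ln (selberg k I x) + t * ln (selberg k I y)"
    using c by (simp add: K_def ln_mult ln_powr)
  finally show "ln (selberg k I ((1 - t) *\<^sub>R x + t *\<^sub>R y)) \<le> (1 - t) * ln (selberg k I x) + t * ln (selberg k I y)" by simp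
qed simp

lemma ln_increment_tendsto: "c \<ge> 0 \<Longrightarrow> (\<lambda>n. ln (real n + 2 + c) - ln (real n + 1 + c)) \<longlonglongrightarrow> 0"
proof (rule tendsto_sandwich[OF _ _ tendsto_const LIMSEQ_inverse_real_of_nat])
  assume c: "c \<ge> 0"
  show "eventually (\<lambda>n. 0 \<le> ln (real n + 2 + c) - ln (real n + 1 + c)) sequentially" using c by simp
  show "eventually (\<lambda>n. ln (real n + 2 + c) - ln (real n + 1 + c) \<le> inverse (real (Suc n))) sequentially"
  proof (rule always_eventually, rule allI)
    fix n
    have "ln (y + 1) - ln y = ln (1 + 1 / y)" if "y > 0" for y :: real
    proof -
      have "y + 1 = y * (1 + 1 / y)" using that by (simp add: distrib_left)
      then have "ln (y + 1) = ln (y * (1 + 1 / y))" by (rule arg_cong)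
      also have "\<dots> = ln y + ln (1 + 1 / y)" using that by (intro ln_mult_pos) (auto intro: add_pos_pos)
      finally show ?thesis by simp
    qed
    from this[of "real n + 1 + c"] have "ln (real n + 2 + c) - ln (real n + 1 + c) = ln (1 + 1 / (real n + 1 + c))"
      using c by (simp add: algebra_simps)
    also have "\<dots> \<le> 1 / (real n + 1 + c)" using c by (intro ln_add_one_self_le_self) auto
    also have "\<dots> \<le> 1 / (real n + 1)" using c by (intro divide_left_mono) auto
    finally show "ln (real n + 2 + c) - ln (real n + 1 + c) \<le> inverse (real (Suc n))" by (simp add: inverse_eq_divide add.commute)
  qed
qed

text \<open>The logarithm of the integral and the sum of ln Gamma(a + k m) are both convex and have
  the same increments, by \<open>selberg_add_one\<close> and the functional equation of Gamma.
  \<open>convex_periodic_difference\<close> fixes the dependence on a up to the value at 1.\<close>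

lemma selberg_ratio:
  assumes k: "k > 0" and I: "finite I" and pos: "selberg k I 1 > 0" and a: "a \<ge> 1"
  shows "selberg k I a = selberg k I 1 / (\<Prod>m<card I. Gamma (1 + k * real m)) * (\<Prod>m<card I. Gamma (a + k * real m))"
proof -
  let ?u = "\<lambda>a. ln (selberg k I a)" and ?v = "\<lambda>a. \<Sum>m<card I. ln (Gamma (a + k * real m))"
  let ?h = "\<lambda>a. \<Sum>m<card I. ln (a + k * real m)"
  have pos': "selberg k I a > 0" if "a > 0" for a
    by (rule selberg_pos[OF _ I that zero_less_one pos]) (use k in simp)
  have gp: "a + k * real m > 0" if "a \<ge> 1" for a m using that k by (simp add: add_pos_nonneg)
  have "?u a - ?v a = ?u 1 - ?v 1"
  proof (rule convex_periodic_difference[where h = ?h])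
    show "convex_on {1..} ?u" using k I pos' by (intro selberg_log_convex) auto
    show "convex_on {1..} ?v"
    proof (rule convex_onI)
      fix t x y :: real assume t: "0 < t" "t < 1" and xy: "x \<in> {1..}" "y \<in> {1..}"
      have "ln (Gamma ((1 - t) *\<^sub>R x + t *\<^sub>R y + k * real m)) \<le> (1 - t) * ln (Gamma (x + k * real m)) + t * ln (Gamma (y + k * real m))" for m
      proof -
        have e: "(1 - t) *\<^sub>R x + t *\<^sub>R y + k * real m = (1 - t) *\<^sub>R (x + k * real m) + t *\<^sub>R (y + k * real m)"
          by (simp add: algebra_simps)
        show ?thesis unfolding e using convex_onD[OF log_convex_Gamma_real, of t "x + k * real m" "y + k * real m"] t xy gp
          by (simp add: comp_def)
      qed
      then have "?v ((1 - t) *\<^sub>R x + t *\<^sub>R y) \<le> (\<Sum>m<card I. (1 - t) * ln (Gamma (x + k * real m)) + t * ln (Gamma (y + k * real m)))"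
        by (rule sum_mono)
      then show "?v ((1 - t) *\<^sub>R x + t *\<^sub>R y) \<le> (1 - t) * ?v x + t * ?v y" by (simp add: sum.distrib sum_distrib_left)
    qed simp
    show "?u (x + 1) = ?u x + ?h x" if "x \<ge> 1" for x
    proof -
      have "ln (\<Prod>m<card I. x + k * real m) = ?h x"
        by (intro ln_prod) (simp_all add: gp[OF that] less_imp_neq[OF gp[OF that], symmetric])
      moreover have "(\<Prod>m<card I. x + k * real m) > 0" using gp[OF that] by (intro prod_pos) auto
      ultimately show ?thesis
        unfolding selberg_add_one[OF k I that] using ln_mult_pos[of "\<Prod>m<card I. x + k * real m" "selberg k I x"] pos'[of x] that by simp
    qed
    show "?v (x + 1) = ?v x + ?h x" if "x \<ge> 1" for x
    proof -
      have "ln (Gamma (x + 1 + k * real m)) = ln (Gamma (x + k * real m)) + ln (x + k * real m)" for m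
      proof -
        have "Gamma (x + 1 + k * real m) = (x + k * real m) * Gamma (x + k * real m)"
          using Gamma_plus1[of "x + k * real m"] gp[OF that, of m] nonpos_Ints_nonpos[of "x + k * real m"] by (force simp: algebra_simps)
        then show ?thesis using ln_mult_pos[OF gp[OF that, of m] Gamma_real_pos[OF gp[OF that, of m]]] by simp
      qed
      then show ?thesis by (simp add: sum.distrib)
    qed
    have "(\<lambda>n. \<Sum>m<card I. ln (real n + 2 + k * real m) - ln (real n + 1 + k * real m)) \<longlonglongrightarrow> (\<Sum>m<card I. 0)"
      using k by (intro tendsto_sum ln_increment_tendsto) auto
    then show "(\<lambda>n. ?h (real n + 2) - ?h (real n + 1)) \<longlonglongrightarrow> 0" by (simp add: sum_subtractf)
  qed (rule a)
  then have "?u a = ?u 1 - ?v 1 + ?v a" by simp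
  have ev: "exp (?v x) = (\<Prod>m<card I. Gamma (x + k * real m))" if "x \<ge> 1" for x
    using gp[OF that] by (simp add: exp_sum Gamma_real_pos)
  have "selberg k I a = exp (?u a)" using pos'[of a] a by simp
  also have "\<dots> = exp (?u 1 - ?v 1 + ?v a)" by (simp only: \<open>?u a = ?u 1 - ?v 1 + ?v a\<close>)
  also have "\<dots> = selberg k I 1 / exp (?v 1) * exp (?v a)" using pos by (simp add: exp_add exp_diff)
  finally show ?thesis unfolding ev[OF order_refl] ev[OF a] .
qed

text \<open>\<open>selberg_one\<close> expresses the value at a = 1 by the integral with one index
  fewer at 2 k + 1, known by induction; \<open>selberg_ratio\<close> then reaches all other
  a.\<close>

lemma selberg_formula:
  assumes k: "k > 0" and "finite I" and "a \<ge> 1"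
  shows "selberg k I a = (\<Prod>j=1..card I. Gamma (1 + real j * k) / Gamma (1 + k)) * (\<Prod>m<card I. Gamma (a + k * real m))"
  using assms(2,3)
proof (induction I arbitrary: a)
  case empty
  interpret f: finite_measure "orthant {}" unfolding orthant_def by rule (simp add: space_PiM)
  show ?case by (simp add: selberg_def power_weight_def weight_def orthant_def space_PiM measure_def)
next
  case (insert i J)
  let ?I = "insert i J"
  let ?R = "\<lambda>n. \<Prod>j=1..n. Gamma (1 + real j * k) / Gamma (1 + k)"
  have "selberg k ?I 1 = selberg k J (2 * k + 1)" using selberg_one[OF k, of ?I i] insert.hyps by simp
  also have "\<dots> = ?R (card J) * (\<Prod>m<card J. Gamma (2 * k + 1 + k * real m))" using k by (intro insert.IH) auto
  \<comment> \<open>Since 2 k + 1 + k m = 1 + k (m + 2), this product lacks the factors Gamma(1) = 1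
    and Gamma(1 + k) of the full one. The quotient left over is the new factor of
    \<open>d_n\<close>.\<close>
  also have "(\<Prod>m<card J. Gamma (2 * k + 1 + k * real m)) = (\<Prod>m<Suc (card J). Gamma (1 + k * real m)) * Gamma (1 + real (Suc (card J)) * k) / Gamma (1 + k)"
  proof -
    have "(\<Prod>m<Suc (card J). Gamma (1 + k * real m)) * Gamma (1 + real (Suc (card J)) * k) = (\<Prod>m<Suc (Suc (card J)). Gamma (1 + k * real m))"
      by (simp add: mult.commute)
    also have "\<dots> = Gamma 1 * (Gamma (1 + k) * (\<Prod>m<card J. Gamma (1 + k * real (Suc (Suc m)))))"
      by (simp only: prod.lessThan_Suc_shift) simp
    finally have "(\<Prod>m<Suc (card J). Gamma (1 + k * real m)) * Gamma (1 + real (Suc (card J)) * k)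
      = Gamma 1 * (Gamma (1 + k) * (\<Prod>m<card J. Gamma (1 + k * real (Suc (Suc m)))))" .
    moreover have "(\<Prod>m<card J. Gamma (1 + k * real (Suc (Suc m)))) = (\<Prod>m<card J. Gamma (2 * k + 1 + k * real m))"
      by (intro prod.cong refl arg_cong[where f = Gamma]) (simp add: algebra_simps)
    moreover have "Gamma (1 + k) \<noteq> 0" using Gamma_real_pos[of "1 + k"] k by linarith
    ultimately show ?thesis by simp
  qed
  also have "?R (card J) * ((\<Prod>m<Suc (card J). Gamma (1 + k * real m)) * Gamma (1 + real (Suc (card J)) * k) / Gamma (1 + k))
     = ?R (Suc (card J)) * (\<Prod>m<Suc (card J). Gamma (1 + k * real m))" by (simp add: mult_ac)
  finally have one: "selberg k ?I 1 = ?R (card ?I) * (\<Prod>m<card ?I. Gamma (1 + k * real m))" using insert.hyps by simp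
  have gpos: "(\<Prod>m<card ?I. Gamma (1 + k * real m)) > 0" using k by (intro prod_pos ballI Gamma_real_pos) (simp add: add_pos_nonneg)
  have "?R (card ?I) > 0" using k by (intro prod_pos ballI divide_pos_pos Gamma_real_pos) (simp_all add: add_pos_nonneg)
  \<comment> \<open>The explicit value at 1 supplies the positivity that
    \<open>selberg_ratio\<close> assumes.\<close>
  then have "selberg k ?I 1 > 0" unfolding one using gpos by simp
  moreover have "finite ?I" using insert.hyps by simp
  ultimately have "selberg k ?I a = selberg k ?I 1 / (\<Prod>m<card ?I. Gamma (1 + k * real m)) * (\<Prod>m<card ?I. Gamma (a + k * real m))"
    using k insert.prems by (intro selberg_ratio)
  moreover have "r * p / p * q = r * q" if "p > 0" for p q r :: real using that by simp
  ultimately show ?case unfolding one using gpos by (simp only:)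
qed

section \<open>The Laplace transform\<close>

text \<open>Domination is asked of f alone: Cauchy's estimate on circles of radius r / 2 bounds the
  derivative, hence the difference quotients, by 2 g / r. Dominated convergence then applies along
  sequences, and f' is measurable as a limit of quotients.\<close>

lemma holomorphic_integral:
  fixes f f' :: "'a \<Rightarrow> complex \<Rightarrow> complex"
  assumes der: "\<And>x \<zeta>. x \<in> space M \<Longrightarrow> \<zeta> \<in> cball \<zeta>0 r \<Longrightarrow> (f x has_field_derivative f' x \<zeta>) (at \<zeta>)"
    and meas: "\<And>\<zeta>. \<zeta> \<in> cball \<zeta>0 r \<Longrightarrow> (\<lambda>x. f x \<zeta>) \<in> borel_measurable M"
    and bound: "\<And>x \<zeta>. x \<in> space M \<Longrightarrow> \<zeta> \<in> cball \<zeta>0 r \<Longrightarrow> norm (f x \<zeta>) \<le> g x"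
    and g: "integrable M g" and "r > 0"
  shows "integrable M (\<lambda>x. f' x \<zeta>0)"
    and "((\<lambda>\<zeta>. \<integral>x. f x \<zeta> \<partial>M) has_field_derivative (\<integral>x. f' x \<zeta>0 \<partial>M)) (at \<zeta>0)"
proof -
  have int: "integrable M (\<lambda>x. f x \<zeta>)" if "\<zeta> \<in> cball \<zeta>0 r" for \<zeta>
    by (rule Bochner_Integration.integrable_bound[OF g meas[OF that]])
       (use bound[OF _ that] in \<open>auto intro!: AE_I2 order_trans[OF _ abs_ge_self]\<close>)
  have lip: "norm (f x \<zeta> - f x \<zeta>0) \<le> (2 * g x / r) * norm (\<zeta> - \<zeta>0)" if x: "x \<in> space M" and \<zeta>: "\<zeta> \<in> cball \<zeta>0 (r / 2)" for x \<zeta>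
  proof -
    have hol: "f x holomorphic_on cball \<zeta>0 r"
      unfolding holomorphic_on_def field_differentiable_def
      using der[OF x] by (meson has_field_derivative_at_within)
    show ?thesis
    proof (rule field_differentiable_bound[where S = "cball \<zeta>0 (r/2)" and f' = "f' x"])
      fix w assume w: "w \<in> cball \<zeta>0 (r / 2)"
      then have wr: "w \<in> cball \<zeta>0 r" using \<open>r > 0\<close> by (auto intro: order_trans)
      show "(f x has_field_derivative f' x w) (at w within cball \<zeta>0 (r / 2))"
        using der[OF x wr] by (rule has_field_derivative_at_within)
      have sub: "cball w (r / 2) \<subseteq> cball \<zeta>0 r"
      proof
        fix v assume "v \<in> cball w (r / 2)"
        then show "v \<in> cball \<zeta>0 r" using w dist_triangle[of \<zeta>0 v w] by (auto simp: dist_commute)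
      qed
      have "norm ((deriv ^^ 1) (f x) w) \<le> fact 1 * g x / (r / 2) ^ 1"
      proof (rule Cauchy_inequality)
        show "f x holomorphic_on ball w (r / 2)" using hol sub ball_subset_cball by (meson holomorphic_on_subset)
        show "continuous_on (cball w (r / 2)) (f x)" using holomorphic_on_imp_continuous_on[OF holomorphic_on_subset[OF hol sub]] .
        fix v assume "norm (w - v) = r / 2"
        then have "v \<in> cball w (r / 2)" by (simp add: dist_norm)
        then show "norm (f x v) \<le> g x" using bound[OF x] sub by blast
      qed (use \<open>r > 0\<close> in simp)
      then show "norm (f' x w) \<le> 2 * g x / r" using DERIV_imp_deriv[OF der[OF x wr]] by (simp add: field_simps)
    qed (use \<zeta> \<open>r > 0\<close> in auto)
  qed
  have lim: "((\<lambda>n. (f x (X n) - f x \<zeta>0) / (X n - \<zeta>0)) \<longlonglongrightarrow> f' x \<zeta>0)" if "x \<in> space M" "\<forall>n. X n \<noteq> \<zeta>0" "X \<longlonglongrightarrow> \<zeta>0" for x X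
  proof -
    have "((\<lambda>\<zeta>. (f x \<zeta> - f x \<zeta>0) / (\<zeta> - \<zeta>0)) \<longlongrightarrow> f' x \<zeta>0) (at \<zeta>0)"
      using der[OF that(1), of \<zeta>0] \<open>r > 0\<close> by (simp add: has_field_derivative_iff)
    then show ?thesis using that(2,3) unfolding tendsto_at_iff_sequentially comp_def by auto
  qed
  have G: "integrable M (\<lambda>x. 2 * g x / r)" using g by simp
  have key: "integrable M (\<lambda>x. f' x \<zeta>0) \<and> (\<lambda>n. ((\<integral>x. f x (X n) \<partial>M) - (\<integral>x. f x \<zeta>0 \<partial>M)) / (X n - \<zeta>0)) \<longlonglongrightarrow> (\<integral>x. f' x \<zeta>0 \<partial>M)"
    if X: "\<forall>n. X n \<noteq> \<zeta>0" "X \<longlonglongrightarrow> \<zeta>0" and Xr: "\<And>n. X n \<in> cball \<zeta>0 (r / 2)" for X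
  proof -
    have Xr': "X n \<in> cball \<zeta>0 r" for n using Xr[of n] \<open>r > 0\<close> by auto
    let ?s = "\<lambda>n x. (f x (X n) - f x \<zeta>0) / (X n - \<zeta>0)"
    have ms: "?s n \<in> borel_measurable M" for n
      using \<open>r > 0\<close> by (intro borel_measurable_divide borel_measurable_diff meas Xr' borel_measurable_const) auto
    have l: "AE x in M. (\<lambda>n. ?s n x) \<longlonglongrightarrow> f' x \<zeta>0" using lim X by auto
    have b: "AE x in M. norm (?s n x) \<le> 2 * g x / r" for n
    proof (rule AE_I2)
      fix x assume "x \<in> space M"
      from lip[OF this Xr[of n]] show "norm (?s n x) \<le> 2 * g x / r"
        using X(1) by (simp add: norm_divide divide_le_eq)
    qed
    have mf': "(\<lambda>x. f' x \<zeta>0) \<in> borel_measurable M"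
      by (rule borel_measurable_LIMSEQ_metric[where f = ?s, OF ms]) (rule lim[OF _ X])
    have "integrable M (\<lambda>x. f' x \<zeta>0)" by (rule integrable_dominated_convergence[OF mf' ms G l b])
    moreover have "(\<lambda>n. integral\<^sup>L M (?s n)) \<longlonglongrightarrow> (\<integral>x. f' x \<zeta>0 \<partial>M)" by (rule integral_dominated_convergence[OF mf' ms G l b])
    moreover have "integral\<^sup>L M (?s n) = ((\<integral>x. f x (X n) \<partial>M) - (\<integral>x. f x \<zeta>0 \<partial>M)) / (X n - \<zeta>0)" for n
      using int[OF Xr'[of n]] int[of \<zeta>0] \<open>r > 0\<close> by simp
    ultimately show ?thesis by (simp only: simp_thms)
  qed
  \<comment> \<open>One concrete sequence is enough to extract integrability of the
    derivative.\<close>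
  have "(\<lambda>n. \<zeta>0 + of_real (r / 2 * inverse (real (Suc n)))) \<longlonglongrightarrow> \<zeta>0 + of_real (r / 2 * 0)"
    by (intro tendsto_intros LIMSEQ_inverse_real_of_nat)
  moreover have "\<zeta>0 + of_real (r / 2 * inverse (real (Suc n))) \<in> cball \<zeta>0 (r / 2)" for n
    using \<open>r > 0\<close> by (auto simp: dist_norm norm_mult norm_inverse norm_divide divide_simps simp flip: of_real_add of_real_mult)
  ultimately show "integrable M (\<lambda>x. f' x \<zeta>0)"
    using key[of "\<lambda>n. \<zeta>0 + of_real (r / 2 * inverse (real (Suc n)))"] \<open>r > 0\<close> by (simp del: of_nat_Suc)
  show "((\<lambda>\<zeta>. \<integral>x. f x \<zeta> \<partial>M) has_field_derivative (\<integral>x. f' x \<zeta>0 \<partial>M)) (at \<zeta>0)"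
    unfolding has_field_derivative_iff tendsto_at_iff_sequentially comp_def
  proof (intro allI impI)
    fix X assume X: "\<forall>n. X n \<in> UNIV - {\<zeta>0}" "X \<longlonglongrightarrow> \<zeta>0"
    have "eventually (\<lambda>n. X n \<in> ball \<zeta>0 (r / 2)) sequentially"
      using X(2) \<open>r > 0\<close> by (intro topological_tendstoD) auto
    then obtain N where N: "\<And>n. n \<ge> N \<Longrightarrow> X n \<in> ball \<zeta>0 (r / 2)" by (auto simp: eventually_sequentially)
    let ?Q = "\<lambda>n. ((\<integral>x. f x (X n) \<partial>M) - (\<integral>x. f x \<zeta>0 \<partial>M)) / (X n - \<zeta>0)"
    have XN: "X (n + N) \<in> cball \<zeta>0 (r / 2)" for n using subsetD[OF ball_subset_cball N[of "n + N"]] by simp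
    have "\<forall>n. X (n + N) \<noteq> \<zeta>0" using X(1) by simp
    from key[OF this LIMSEQ_ignore_initial_segment[OF X(2)] XN] have "(\<lambda>n. ?Q (n + N)) \<longlonglongrightarrow> (\<integral>x. f' x \<zeta>0 \<partial>M)" by (rule conjunct2)
    then show "?Q \<longlonglongrightarrow> (\<integral>x. f' x \<zeta>0 \<partial>M)" by (rule LIMSEQ_offset)
  qed
qed

text \<open>Allowing composition with \<open>\<pi>\<close> keeps the induction closed under the
  recursion; the kernel is then a pointwise limit of measurable partial sums.\<close>

lemma measurable_kernel:
  fixes y :: "'n::finite \<Rightarrow> complex"
  assumes "k > 0"
  shows "(\<lambda>x. kernel k (\<lambda>i. of_real (x i)) y) \<in> borel_measurable (orthant UNIV)"
proof -
  have "(\<lambda>x. hom_kernel k m (\<lambda>i. of_real (x (\<pi> i))) y) \<in> borel_measurable (orthant UNIV)" for m and \<pi> :: "'n \<Rightarrow> 'n"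
  proof (induction m arbitrary: \<pi>)
    case (Suc m)
    have "(\<lambda>x. hom_kernel k m ((\<lambda>i. of_real (x (\<pi> i))) \<circ> \<tau>) y) \<in> borel_measurable (orthant UNIV)" for \<tau>
      using Suc[of "\<pi> \<circ> \<tau>"] by (simp add: comp_def)
    moreover have "(\<lambda>x. pairing ((\<lambda>i. of_real (x (\<pi> i))) \<circ> \<tau>) y) \<in> borel_measurable (orthant UNIV)" for \<tau>
      unfolding pairing_def comp_def
      by (intro borel_measurable_sum borel_measurable_times borel_measurable_const measurable_complex_of_real measurable_orthant_component) auto
    ultimately show ?case unfolding hom_kernel.simps
      by (intro borel_measurable_sum borel_measurable_times borel_measurable_const)
  qed simp
  from this[of _ "\<lambda>i. i"] have m: "(\<lambda>x. hom_kernel k m (\<lambda>i. of_real (x i)) y) \<in> borel_measurable (orthant UNIV)" for m .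
  show ?thesis
  proof (rule borel_measurable_LIMSEQ_metric)
    show "(\<lambda>x. \<Sum>m<n. hom_kernel k m (\<lambda>i. of_real (x i)) y) \<in> borel_measurable (orthant UNIV)" for n
      by (intro borel_measurable_sum m)
    show "(\<lambda>n. \<Sum>m<n. hom_kernel k m (\<lambda>i. of_real (x i)) y) \<longlonglongrightarrow> kernel k (\<lambda>i. of_real (x i)) y" for x
      using kernel_sums[OF assms] unfolding sums_def .
  qed
qed

section \<open>The Laplace integral and its first moments for real exponents\<close>

definition laplace_integral :: "real \<Rightarrow> real \<Rightarrow> ('n::finite \<Rightarrow> complex) \<Rightarrow> complex" where
  "laplace_integral k a z = (\<integral>x. of_real (power_weight a UNIV x) * kernel k (\<lambda>i. of_real (x i)) (\<lambda>i. - z i) * of_real (weight k UNIV x) \<partial>orthant UNIV)"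

definition laplace_moment :: "real \<Rightarrow> real \<Rightarrow> 'n::finite \<Rightarrow> ('n \<Rightarrow> complex) \<Rightarrow> complex" where
  "laplace_moment k a i z = (\<integral>x. of_real (power_weight a UNIV x) * (of_real (x i) * kernel k (\<lambda>i. of_real (x i)) (\<lambda>i. - z i)) * of_real (weight k UNIV x) \<partial>orthant UNIV)"

context
  fixes k :: real
  assumes k: "k > 0"
begin

lemma kernel_decay':
  fixes z :: "'n::finite \<Rightarrow> complex"
  assumes "x \<in> space (orthant UNIV)" "\<And>i. Re (z i) \<ge> \<epsilon>"
  shows "norm (kernel k (\<lambda>i. of_real (x i)) (\<lambda>i. - z i)) \<le> sqrt (fact CARD('n)) * exp (- \<epsilon> * (\<Sum>i\<in>UNIV. x i))"
  using assms orthant_pos[OF assms(1)] by (intro kernel_decay k) (auto intro: less_imp_le)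

lemma ex_Re_bound:
  fixes z :: "'n::finite \<Rightarrow> complex"
  assumes "\<And>i. Re (z i) > 0"
  shows "\<exists>\<epsilon>>0. \<forall>i. Re (z i) \<ge> \<epsilon>"
  using assms by (intro exI[of _ "Min (range (\<lambda>i. Re (z i)))"]) auto

text \<open>In the variable x the operator T_i multiplies the kernel by - z_i, so
  \<open>dunkl_ibp_power\<close> applies with \<Psi> = - z_i \<Phi>. Its constant a + k (n - 1) is
  mu.\<close>

lemma laplace_moment_eq:
  fixes z :: "'n::finite \<Rightarrow> complex"
  assumes a: "a \<ge> 1" and z: "\<And>i. Re (z i) > 0"
  shows "z i * laplace_moment k a i z = of_real (a + k * (real CARD('n) - 1)) * laplace_integral k a z"
proof -
  obtain \<epsilon> where \<epsilon>: "\<epsilon> > 0" "\<And>i. Re (z i) \<ge> \<epsilon>" using ex_Re_bound[of z, OF z] by (elim exE conjE) auto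
  let ?\<Phi> = "\<lambda>x. kernel k (\<lambda>i. complex_of_real (x i)) (\<lambda>i. - z i)"
  let ?C = "sqrt (fact CARD('n)) * (1 + norm (z i))"
  have "of_real (a + k * (real (card (UNIV :: 'n set)) - 1)) * (\<integral>x. of_real (power_weight a UNIV x) * ?\<Phi> x * of_real (weight k UNIV x) \<partial>orthant UNIV)
    = - (\<integral>x. of_real (power_weight a UNIV x) * (of_real (x i) * (- z i * ?\<Phi> x)) * of_real (weight k UNIV x) \<partial>orthant UNIV)"
  proof (rule dunkl_ibp_power[OF k finite UNIV_I \<epsilon>(1) a, where C = ?C])
    show m: "?\<Phi> \<in> borel_measurable (orthant UNIV)" by (rule measurable_kernel[OF k])
    show "(\<lambda>x. - z i * ?\<Phi> x) \<in> borel_measurable (orthant UNIV)" by (intro borel_measurable_times borel_measurable_const m)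
  next
    fix x :: "'n \<Rightarrow> real" assume x: "x \<in> space (orthant UNIV)"
    let ?D = "sqrt (fact CARD('n)) * exp (- \<epsilon> * (\<Sum>i\<in>UNIV. x i))"
    have b: "norm (?\<Phi> x) \<le> ?D" by (rule kernel_decay'[OF x \<epsilon>(2)])
    have D: "?D \<ge> 0" by simp
    have "norm (- z i * ?\<Phi> x) \<le> norm (z i) * ?D" unfolding norm_mult norm_minus_cancel using b by (intro mult_left_mono) auto
    also have "\<dots> \<le> (1 + norm (z i)) * ?D" using D by (intro mult_right_mono) auto
    also have "\<dots> = ?C * exp (- \<epsilon> * (\<Sum>i\<in>UNIV. x i))" by (simp only: mult_ac)
    finally show "norm (- z i * ?\<Phi> x) \<le> ?C * exp (- \<epsilon> * (\<Sum>i\<in>UNIV. x i))" .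
    have "1 * ?D \<le> (1 + norm (z i)) * ?D" using D by (intro mult_right_mono) auto
    also have "\<dots> = ?C * exp (- \<epsilon> * (\<Sum>i\<in>UNIV. x i))" by (simp only: mult_ac)
    finally show "norm (?\<Phi> x) \<le> ?C * exp (- \<epsilon> * (\<Sum>i\<in>UNIV. x i))" using b by linarith
  next
    fix x :: "'n \<Rightarrow> real"
    have "((\<lambda>t. ?\<Phi> (x(i := t))) has_vector_derivative cpartial i (\<lambda>x. kernel k x (\<lambda>i. - z i)) (\<lambda>l. of_real ((x(i := s)) l))) (at s)" for s
      using kernel_real_coordinate_derivative[OF k, of "x(i := s)" i "\<lambda>i. - z i"] by simp
    then show "continuous_on {0..} (\<lambda>t. ?\<Phi> (x(i := t)))"
      using has_vector_derivative_continuous continuous_at_imp_continuous_on by blast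
  next
    fix x :: "'n \<Rightarrow> real" assume inj: "inj_on x UNIV"
    have "inj (\<lambda>i. complex_of_real (x i))" using inj by (auto simp: inj_def)
    from cdunkl_kernel[OF k this, of i "\<lambda>i. - z i"]
    have "cpartial i (\<lambda>x. kernel k x (\<lambda>i. - z i)) (\<lambda>i. of_real (x i)) =
       - z i * ?\<Phi> x - of_real k * (\<Sum>j\<in>UNIV. (?\<Phi> x - ?\<Phi> (x \<circ> swp i j)) / of_real (x i - x j))"
      by (simp add: cdunkl_def comp_def algebra_simps)
    also have "(\<Sum>j\<in>UNIV. (?\<Phi> x - ?\<Phi> (x \<circ> swp i j)) / of_real (x i - x j)) = (\<Sum>j\<in>UNIV - {i}. (?\<Phi> x - ?\<Phi> (x \<circ> swp i j)) / of_real (x i - x j))"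
      by (subst sum.remove[of _ i]) auto
    finally show "((\<lambda>t. ?\<Phi> (x(i := t))) has_vector_derivative (- z i * ?\<Phi> x - of_real k * (\<Sum>j\<in>UNIV - {i}. (?\<Phi> x - ?\<Phi> (x \<circ> swp i j)) / of_real (x i - x j)))) (at (x i))"
      using kernel_real_coordinate_derivative[OF k, of x i "\<lambda>i. - z i"] by (simp only:)
  qed
  moreover have "(\<integral>x. of_real (power_weight a UNIV x) * (of_real (x i) * (- z i * ?\<Phi> x)) * of_real (weight k UNIV x) \<partial>orthant UNIV)
    = (\<integral>x. - z i * (of_real (power_weight a UNIV x) * (of_real (x i) * ?\<Phi> x) * of_real (weight k UNIV x)) \<partial>orthant UNIV)"
    by (intro Bochner_Integration.integral_cong refl) (simp only: mult_ac)
  ultimately show ?thesis by (simp add: laplace_moment_def laplace_integral_def)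
qed

text \<open>The swap moves from z to x, where measure, power and weight are invariant.\<close>

lemma laplace_integral_swp:
  fixes z :: "'n::finite \<Rightarrow> complex"
  shows "laplace_integral k a (z \<circ> swp i j) = laplace_integral k a z"
proof -
  let ?f = "\<lambda>x. of_real (power_weight a UNIV x) * kernel k (\<lambda>i. of_real (x i)) (\<lambda>i. - z i) * complex_of_real (weight k UNIV x)"
  have "kernel k (\<lambda>i. of_real (x i)) (\<lambda>l. - (z \<circ> swp i j) l) = kernel k (\<lambda>l. of_real ((x \<circ> swp i j) l)) (\<lambda>i. - z i)" for x
    using kernel_swp_left[OF k, of "\<lambda>i. of_real (x i)" i j "\<lambda>i. - z i"] by (simp add: comp_def)
  then have "laplace_integral k a (z \<circ> swp i j) = (\<integral>x. ?f (x \<circ> swp i j) \<partial>orthant UNIV)"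
    unfolding laplace_integral_def using power_weight_swp[of i UNIV j a] weight_swp[of UNIV i j k] by (simp only: UNIV_I finite)
  also have "\<dots> = laplace_integral k a z"
    unfolding laplace_integral_def
    by (rule integral_orthant_swp) (auto intro!: borel_measurable_times measurable_complex_of_real measurable_power_weight measurable_weight measurable_kernel k)
  finally show ?thesis .
qed

lemma integrable_laplace:
  fixes z :: "'n::finite \<Rightarrow> complex"
  assumes "a > 0" and z: "\<And>i. Re (z i) > 0"
  shows "integrable (orthant UNIV) (\<lambda>x. of_real (power_weight a UNIV x) * kernel k (\<lambda>i. of_real (x i)) (\<lambda>i. - z i) * of_real (weight k UNIV x))"
proof -
  obtain \<epsilon> where \<epsilon>: "\<epsilon> > 0" "\<And>i. Re (z i) \<ge> \<epsilon>" using ex_Re_bound[of z, OF z] by (elim exE conjE) auto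
  show ?thesis
  proof (rule integrable_weighted[where a = a and \<epsilon> = \<epsilon> and C = "sqrt (fact CARD('n))"])
    show "(\<lambda>x. of_real (power_weight a UNIV x) * kernel k (\<lambda>i. of_real (x i)) (\<lambda>i. - z i)) \<in> borel_measurable (orthant UNIV)"
      by (intro borel_measurable_times measurable_complex_of_real measurable_power_weight measurable_kernel k)
    fix x :: "'n \<Rightarrow> real" assume x: "x \<in> space (orthant UNIV)"
    show "norm (of_real (power_weight a UNIV x) * kernel k (\<lambda>i. of_real (x i)) (\<lambda>i. - z i)) \<le> sqrt (fact CARD('n)) * (power_weight a UNIV x * exp (- \<epsilon> * (\<Sum>i\<in>UNIV. x i)))"
      using mult_left_mono[OF kernel_decay'[OF x \<epsilon>(2)] power_weight_nonneg[of a UNIV x]] by (simp add: norm_mult power_weight_nonneg mult_ac)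
  qed (use k assms \<epsilon> in auto)
qed


lemma integrable_moment:
  fixes z :: "'n::finite \<Rightarrow> complex"
  assumes "a > 0" and z: "\<And>i. Re (z i) > 0"
  shows "integrable (orthant UNIV) (\<lambda>x. of_real (power_weight a UNIV x) * (of_real (x i) * kernel k (\<lambda>i. of_real (x i)) (\<lambda>i. - z i)) * of_real (weight k UNIV x))"
proof -
  obtain \<epsilon> where \<epsilon>: "\<epsilon> > 0" "\<And>i. Re (z i) \<ge> \<epsilon>" using ex_Re_bound[of z, OF z] by (elim exE conjE) auto
  obtain D where D: "D > 0" "\<And>x. x \<in> space (orthant (UNIV :: 'n set)) \<Longrightarrow> (1 + (\<Sum>i\<in>UNIV. x i)) powr 1 \<le> D * exp (\<epsilon> / 2 * (\<Sum>i\<in>UNIV. x i))"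
    using poly_exp_bound[of 1 "\<epsilon> / 2" "UNIV :: 'n set"] \<epsilon>(1) by auto
  let ?c = "sqrt (fact CARD('n))"
  show ?thesis
  proof (rule integrable_weighted[where a = a and \<epsilon> = "\<epsilon> / 2" and C = "D * ?c"])
    show "(\<lambda>x. of_real (power_weight a UNIV x) * (of_real (x i) * kernel k (\<lambda>i. of_real (x i)) (\<lambda>i. - z i))) \<in> borel_measurable (orthant UNIV)"
      by (intro borel_measurable_times measurable_complex_of_real measurable_power_weight measurable_kernel measurable_orthant_component k UNIV_I)
    fix x :: "'n \<Rightarrow> real" assume x: "x \<in> space (orthant UNIV)"
    let ?S = "\<Sum>i\<in>UNIV. x i"
    have "x i \<le> D * exp (\<epsilon> / 2 * ?S)" using D(2)[OF x] orthant_le_sum[OF finite x UNIV_I, of i] orthant_sum_nonneg[OF x] by simp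
    then have "norm (of_real (x i) * kernel k (\<lambda>i. of_real (x i)) (\<lambda>i. - z i)) \<le> (D * exp (\<epsilon> / 2 * ?S)) * (?c * exp (- \<epsilon> * ?S))"
      unfolding norm_mult using orthant_pos[OF x UNIV_I, of i] D(1) by (intro mult_mono kernel_decay'[OF x \<epsilon>(2)]) auto
    also have "\<dots> = D * ?c * (exp (\<epsilon> / 2 * ?S) * exp (- \<epsilon> * ?S))" by (simp only: mult_ac)
    also have "exp (\<epsilon> / 2 * ?S) * exp (- \<epsilon> * ?S) = exp (- (\<epsilon> / 2) * ?S)" by (simp flip: exp_add)
    finally have "norm (of_real (x i) * kernel k (\<lambda>i. of_real (x i)) (\<lambda>i. - z i)) \<le> D * ?c * exp (- (\<epsilon> / 2) * ?S)" .
    from mult_left_mono[OF this power_weight_nonneg[of a UNIV x]]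
    show "norm (of_real (power_weight a UNIV x) * (of_real (x i) * kernel k (\<lambda>i. of_real (x i)) (\<lambda>i. - z i))) \<le> D * ?c * (power_weight a UNIV x * exp (- (\<epsilon> / 2) * ?S))"
      by (simp add: norm_mult power_weight_nonneg mult_ac)
  qed (use k assms \<epsilon> in auto)
qed

text \<open>By symmetry of the kernel, T_i in the spectral variable multiplies it by x_i. Solving
  for the partial derivative brings in difference quotients in z, which vanish after integration
  because \<open>laplace_integral\<close> is symmetric. The resulting formula is claimed for
  distinct coordinates only; mere existence of the derivative everywhere gives continuity at
  collisions.\<close>

lemma laplace_integral_line_derivative:
  fixes p v :: "'n::finite \<Rightarrow> complex"
  assumes a: "a > 0" and p: "\<And>i. Re (p i + t * v i) > 0"
  shows "\<exists>D. ((\<lambda>\<zeta>. laplace_integral k a (\<lambda>i. p i + \<zeta> * v i)) has_field_derivative D) (at t) \<and>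
    (inj (\<lambda>i. p i + t * v i) \<longrightarrow> D = - (\<Sum>i\<in>UNIV. v i * laplace_moment k a i (\<lambda>i. p i + t * v i)))"
proof -
  let ?w = "\<lambda>\<zeta> i. p i + \<zeta> * v i"
  let ?r = "\<lambda>x :: 'n \<Rightarrow> real. \<lambda>i. complex_of_real (x i)"
  obtain \<epsilon> where \<epsilon>: "\<epsilon> > 0" "\<And>i. Re (?w t i) \<ge> \<epsilon>" using ex_Re_bound[of "?w t", OF p] by (elim exE conjE) auto
  obtain V where V: "\<forall>i. norm (v i) \<le> V" using finite_bound_ex by blast
  then have "V \<ge> 0" by (meson norm_ge_zero order_trans)
  \<comment> \<open>Within distance r of t each real part changes by at most r V <= \<epsilon> / 2,
    so all these points share the decay rate \<epsilon> / 2.\<close>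
  define r where "r = \<epsilon> / (2 * (V + 1))"
  have r: "r > 0" using \<epsilon> \<open>V \<ge> 0\<close> by (simp add: r_def)
  have near: "Re (?w \<zeta> i) \<ge> \<epsilon> / 2" if "\<zeta> \<in> cball t r" for \<zeta> i
  proof -
    have "norm ((\<zeta> - t) * v i) \<le> r * V" unfolding norm_mult
      using that V r by (intro mult_mono) (auto simp: dist_norm norm_minus_commute)
    also have "\<dots> \<le> \<epsilon> / 2" using \<open>V \<ge> 0\<close> \<epsilon>(1) by (simp add: r_def field_simps)
    finally have "\<bar>Re ((\<zeta> - t) * v i)\<bar> \<le> \<epsilon> / 2" using abs_Re_le_cmod order_trans by blast
    moreover have "Re (?w \<zeta> i) = Re (?w t i) + Re ((\<zeta> - t) * v i)" by (simp add: algebra_simps)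
    ultimately show ?thesis using \<epsilon>(2)[of i] by linarith
  qed
  let ?A = "\<lambda>x. of_real (power_weight a UNIV x) :: complex" and ?W = "\<lambda>x. of_real (weight k UNIV x) :: complex"
  define K' where "K' x \<zeta> = (\<Sum>i\<in>UNIV. cpartial i (\<lambda>u. kernel k u (?r x)) (\<lambda>i. - ?w \<zeta> i) * (- v i))" for x \<zeta>
  define f where "f x \<zeta> = ?A x * kernel k (?r x) (\<lambda>i. - ?w \<zeta> i) * ?W x" for x \<zeta>
  define f' where "f' x \<zeta> = ?A x * K' x \<zeta> * ?W x" for x \<zeta>
  have der: "(f x has_field_derivative f' x \<zeta>) (at \<zeta>)" for x \<zeta>
  proof -
    have "((\<lambda>\<zeta>. kernel k (\<lambda>i. - p i + \<zeta> * (- v i)) (?r x)) has_field_derivative K' x \<zeta>) (at \<zeta>)"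
      using kernel_line_derivative[OF k, of "\<lambda>i. - p i" "\<lambda>i. - v i" "?r x" \<zeta>] by (simp add: K'_def)
    then have "((\<lambda>\<zeta>. kernel k (?r x) (\<lambda>i. - ?w \<zeta> i)) has_field_derivative K' x \<zeta>) (at \<zeta>)"
      by (simp add: kernel_commute[OF k, of "?r x"])
    from DERIV_cmult_right[OF DERIV_cmult[OF this, of "?A x"], of "?W x"] show ?thesis
      unfolding f_def f'_def .
  qed
  let ?g = "\<lambda>x :: 'n \<Rightarrow> real. norm (complex_of_real (sqrt (fact CARD('n)) * (power_weight a UNIV x * exp (- (\<epsilon> / 2) * (\<Sum>i\<in>UNIV. x i)))) * ?W x)"
  have "integrable (orthant UNIV) ?g"
    by (intro integrable_norm integrable_weighted[where a = a and \<epsilon> = "\<epsilon> / 2" and C = "sqrt (fact CARD('n))"] borel_measurable_times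
        measurable_complex_of_real borel_measurable_const measurable_power_weight measurable_orthant_exp)
       (use k a \<epsilon> in \<open>auto simp: norm_mult power_weight_nonneg\<close>)
  moreover have "norm (f x \<zeta>) \<le> ?g x" if x: "x \<in> space (orthant UNIV)" and \<zeta>: "\<zeta> \<in> cball t r" for x \<zeta>
  proof -
    have "norm (kernel k (?r x) (\<lambda>i. - ?w \<zeta> i)) \<le> sqrt (fact CARD('n)) * exp (- (\<epsilon> / 2) * (\<Sum>i\<in>UNIV. x i))"
      by (rule kernel_decay'[OF x near[OF \<zeta>]])
    from mult_left_mono[OF this power_weight_nonneg[of a UNIV x]]
    have "norm (?A x * kernel k (?r x) (\<lambda>i. - ?w \<zeta> i)) \<le> norm (complex_of_real (sqrt (fact CARD('n)) * (power_weight a UNIV x * exp (- (\<epsilon> / 2) * (\<Sum>i\<in>UNIV. x i)))))"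
      by (simp add: norm_mult power_weight_nonneg mult_ac)
    then show ?thesis unfolding f_def norm_mult[of _ "?W x"] by (intro mult_right_mono) auto
  qed
  moreover have "(\<lambda>x. f x \<zeta>) \<in> borel_measurable (orthant UNIV)" for \<zeta>
    unfolding f_def by (intro borel_measurable_times measurable_complex_of_real measurable_power_weight measurable_kernel measurable_weight k)
  ultimately have D: "((\<lambda>\<zeta>. \<integral>x. f x \<zeta> \<partial>orthant UNIV) has_field_derivative (\<integral>x. f' x t \<partial>orthant UNIV)) (at t)"
    by (intro holomorphic_integral(2)[where r = r and g = ?g] der r) auto
  have "(\<integral>x. f' x t \<partial>orthant UNIV) = - (\<Sum>i\<in>UNIV. v i * laplace_moment k a i (?w t))" if inj: "inj (?w t)"
  proof -
    let ?y = "\<lambda>i. - ?w t i"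
    let ?F = "\<lambda>z x. ?A x * kernel k (?r x) (\<lambda>i. - z i) * ?W x"
    let ?M = "\<lambda>i x. ?A x * (of_real (x i) * kernel k (?r x) ?y) * ?W x"
    have injy: "inj ?y"
    proof (rule injI)
      fix a b assume "- ?w t a = - ?w t b"
      then have "?w t a = ?w t b" by (simp only: neg_equal_iff_equal)
      then show "a = b" by (rule injD[OF inj])
    qed
    have psw: "Re ((?w t \<circ> swp i j) l) > 0" for i j l using p by simp
    have "f' x t = (\<Sum>i\<in>UNIV. - v i * (?M i x - of_real k * (\<Sum>j\<in>UNIV. (?F (?w t) x - ?F (?w t \<circ> swp i j) x) / (?y i - ?y j))))" for x
    proof -
      have c: "cpartial i (\<lambda>u. kernel k u (?r x)) ?y = of_real (x i) * kernel k (?r x) ?y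
         - of_real k * (\<Sum>j\<in>UNIV. (kernel k (?r x) ?y - kernel k (?r x) (\<lambda>l. - (?w t \<circ> swp i j) l)) / (?y i - ?y j))" for i
      proof -
        have e: "(?y \<circ> swp i j) = (\<lambda>l. - (?w t \<circ> swp i j) l)" for j by (simp add: comp_def)
        show ?thesis using cdunkl_kernel[OF k injy, of i "?r x"]
          unfolding cdunkl_def e kernel_commute[OF k, of _ "?r x"] by (simp only: eq_diff_eq)
      qed
      have alg: "A * (c * (- b)) * W = - b * (A * c * W)" for A b c W :: complex by simp
      have "f' x t = (\<Sum>i\<in>UNIV. - v i * (?A x * cpartial i (\<lambda>u. kernel k u (?r x)) ?y * ?W x))"
        unfolding f'_def K'_def sum_distrib_left sum_distrib_right alg ..
      also have "\<dots> = (\<Sum>i\<in>UNIV. - v i * (?M i x - of_real k * (\<Sum>j\<in>UNIV. (?F (?w t) x - ?F (?w t \<circ> swp i j) x) / (?y i - ?y j))))"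
      proof (intro sum.cong refl arg_cong2[where f = "(*)"])
        fix i
        have "?A x * (X - of_real k * (\<Sum>j\<in>UNIV. (Y - Z j) / d j)) * ?W x
          = ?A x * X * ?W x - of_real k * (\<Sum>j\<in>UNIV. (?A x * Y * ?W x - ?A x * Z j * ?W x) / d j)" for X Y :: complex and Z d :: "'n \<Rightarrow> complex"
        proof -
          have "?A x * (X - of_real k * S) * ?W x = ?A x * X * ?W x - of_real k * (?A x * ?W x * S)" for S :: complex
            by (simp add: algebra_simps)
          moreover have "?A x * ?W x * (\<Sum>j\<in>UNIV. (Y - Z j) / d j) = (\<Sum>j\<in>UNIV. (?A x * Y * ?W x - ?A x * Z j * ?W x) / d j)"
            unfolding sum_distrib_left by (intro sum.cong refl) (simp add: algebra_simps diff_divide_distrib)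
          ultimately show ?thesis by simp
        qed
        then show "?A x * cpartial i (\<lambda>u. kernel k u (?r x)) ?y * ?W x = ?M i x - of_real k * (\<Sum>j\<in>UNIV. (?F (?w t) x - ?F (?w t \<circ> swp i j) x) / (?y i - ?y j))"
          unfolding c .
      qed
      finally show ?thesis .
    qed
    then have "(\<integral>x. f' x t \<partial>orthant UNIV) = (\<integral>x. (\<Sum>i\<in>UNIV. - v i * (?M i x - of_real k * (\<Sum>j\<in>UNIV. (?F (?w t) x - ?F (?w t \<circ> swp i j) x) / (?y i - ?y j)))) \<partial>orthant UNIV)"
      by (simp only:)
    also have "\<dots> = (\<Sum>i\<in>UNIV. - v i * (laplace_moment k a i (?w t) - of_real k * (\<Sum>j\<in>UNIV. (laplace_integral k a (?w t) - laplace_integral k a (?w t \<circ> swp i j)) / (?y i - ?y j))))"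
    proof -
      have h: "has_bochner_integral (orthant UNIV) (?M i) (laplace_moment k a i (?w t))" for i
        unfolding laplace_moment_def by (rule has_bochner_integral_integrable[OF integrable_moment[OF a p]])
      have h1: "has_bochner_integral (orthant UNIV) (?F (?w t)) (laplace_integral k a (?w t))"
        unfolding laplace_integral_def by (rule has_bochner_integral_integrable[OF integrable_laplace[OF a p]])
      have h2: "has_bochner_integral (orthant UNIV) (?F (?w t \<circ> swp i j)) (laplace_integral k a (?w t \<circ> swp i j))" for i j
        unfolding laplace_integral_def by (rule has_bochner_integral_integrable[OF integrable_laplace[OF a psw]])
      show ?thesis
        by (rule has_bochner_integral_integral_eq)
           (intro has_bochner_integral_sum has_bochner_integral_mult_right has_bochner_integral_diff has_bochner_integral_divide h h1 h2)
    qed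
    also have "\<dots> = - (\<Sum>i\<in>UNIV. v i * laplace_moment k a i (?w t))" unfolding laplace_integral_swp by (simp add: sum_negf)
    finally show ?thesis .
  qed
  moreover have "(\<lambda>\<zeta>. \<integral>x. f x \<zeta> \<partial>orthant UNIV) = (\<lambda>\<zeta>. laplace_integral k a (?w \<zeta>))" unfolding f_def laplace_integral_def ..
  ultimately show ?thesis using D by auto
qed

text \<open>A pair of coordinates meeting at two times would agree along the whole line, in
  particular at q, which is the point for t = 1.\<close>

lemma finite_line_collisions:
  fixes p q :: "'n::finite \<Rightarrow> complex"
  assumes "inj q"
  shows "finite {t :: real. \<not> inj (\<lambda>i. p i + of_real t * (q i - p i))}"
proof -
  let ?A = "\<lambda>i j. {t :: real. p i + of_real t * (q i - p i) = p j + of_real t * (q j - p j)}"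
  have "finite (?A i j)" if "i \<noteq> j" for i j
  proof -
    have "q i \<noteq> q j" using assms that by (auto dest: injD)
    have "s = t" if "s \<in> ?A i j" "t \<in> ?A i j" for s t
    proof (rule ccontr)
      assume "s \<noteq> t"
      define B where "B = (q i - p i) - (q j - p j)"
      have st: "p i - p j + of_real s * B = 0" "p i - p j + of_real t * B = 0" using that by (auto simp: B_def algebra_simps)
      have "of_real (s - t) * B = (p i - p j + of_real s * B) - (p i - p j + of_real t * B)" by (simp add: algebra_simps)
      then have "of_real (s - t) * B = 0" unfolding st by simp
      then have "B = 0" using \<open>s \<noteq> t\<close> by simp
      then show False using st \<open>q i \<noteq> q j\<close> by (simp add: B_def)
    qed
    then have "?A i j \<subseteq> {SOME t. t \<in> ?A i j}" by (metis (no_types, lifting) singletonI someI subsetI)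
    then show ?thesis by (rule finite_subset) simp
  qed
  then have "finite (\<Union>ij\<in>{ij. fst ij \<noteq> snd ij}. ?A (fst ij) (snd ij))" by (intro finite_UN_I) auto
  then show ?thesis by (rule finite_subset[rotated]) (auto simp: inj_def, blast)
qed

text \<open>Along the segment z_i M_i = \<mu> F turns the derivative of F into - \<mu> F times the
  sum of v_i / z_i, which cancels the logarithmic derivative of the product of powers. Continuity
  bridges the finitely many collision times. Only q is assumed to have distinct coordinates, so p
  may be (1, ..., 1).\<close>

lemma laplace_integral_path:
  fixes p q :: "'n::finite \<Rightarrow> complex"
  assumes a: "a \<ge> 1" and p: "\<And>i. Re (p i) > 0" and q: "\<And>i. Re (q i) > 0" and "inj q"
  defines "\<mu> \<equiv> complex_of_real (a + k * (real CARD('n) - 1))"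
  shows "laplace_integral k a q * (\<Prod>i\<in>UNIV. q i powr \<mu>) = laplace_integral k a p * (\<Prod>i\<in>UNIV. p i powr \<mu>)"
proof -
  let ?v = "\<lambda>i. q i - p i"
  let ?w = "\<lambda>\<zeta> i. p i + \<zeta> * ?v i"
  define \<psi> where "\<psi> \<zeta> = laplace_integral k a (?w \<zeta>) * (\<Prod>i\<in>UNIV. ?w \<zeta> i powr \<mu>)" for \<zeta>
  have w: "Re (?w (of_real t) i) > 0" if "t \<in> {0..1}" for t i
  proof -
    have "Re (?w (of_real t) i) = (1 - t) * Re (p i) + t * Re (q i)" by (simp add: algebra_simps)
    also have "\<dots> > 0"
    proof (cases "t = 0")
      case False
      then have "t * Re (q i) > 0" "(1 - t) * Re (p i) \<ge> 0" using that p[of i] q[of i] by auto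
      then show ?thesis by linarith
    qed (use p in simp)
    finally show ?thesis .
  qed
  have der: "\<exists>D. ((\<lambda>t. \<psi> (of_real t)) has_vector_derivative D) (at t within {0..1}) \<and> (inj (?w (of_real t)) \<longrightarrow> D = 0)"
    if t: "t \<in> {0..1}" for t :: real
  proof -
    let ?t = "complex_of_real t"
    obtain D where D: "((\<lambda>\<zeta>. laplace_integral k a (?w \<zeta>)) has_field_derivative D) (at ?t)"
      and Di: "inj (?w ?t) \<Longrightarrow> D = - (\<Sum>i\<in>UNIV. ?v i * laplace_moment k a i (?w ?t))"
      using laplace_integral_line_derivative[of a p ?t ?v] a w[OF t] by auto
    have P: "((\<lambda>\<zeta>. \<Prod>i\<in>UNIV. ?w \<zeta> i powr \<mu>) has_field_derivative (\<Prod>i\<in>UNIV. ?w ?t i powr \<mu>) * (\<Sum>i\<in>UNIV. \<mu> * ?v i / ?w ?t i)) (at ?t)"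
    proof (rule DERIV_prod_log[where l = "\<lambda>i \<zeta>. \<mu> * ?v i / ?w \<zeta> i"])
      fix i
      have nz: "?w ?t i \<noteq> 0" using w[OF t, of i] by (metis less_irrefl zero_complex.simps(1))
      have "?w ?t i \<notin> \<real>\<^sub>\<le>\<^sub>0" using w[OF t, of i] complex_nonpos_Reals_iff by auto
      then have "((\<lambda>\<zeta>. ?w \<zeta> i powr \<mu>) has_field_derivative \<mu> * ?w ?t i powr (\<mu> - 1) * ?v i) (at ?t)"
        by (auto intro!: derivative_eq_intros)
      moreover have "?w ?t i powr (\<mu> - 1) = ?w ?t i powr \<mu> / ?w ?t i" using powr_diff[of "?w ?t i" \<mu> 1] nz by simp
      ultimately show "((\<lambda>\<zeta>. ?w \<zeta> i powr \<mu>) has_field_derivative ?w ?t i powr \<mu> * (\<mu> * ?v i / ?w ?t i)) (at ?t)"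
        by (simp add: mult_ac)
    qed simp
    have D0: "(\<psi> has_field_derivative D * (\<Prod>i\<in>UNIV. ?w ?t i powr \<mu>) + (\<Prod>i\<in>UNIV. ?w ?t i powr \<mu>) * (\<Sum>i\<in>UNIV. \<mu> * ?v i / ?w ?t i) * laplace_integral k a (?w ?t)) (at ?t)" (is "(_ has_field_derivative ?D) _")
      unfolding \<psi>_def by (rule DERIV_mult[OF D P])
    have "?D = 0" if "inj (?w ?t)"
    proof -
      have "laplace_moment k a i (?w ?t) = \<mu> / ?w ?t i * laplace_integral k a (?w ?t)" for i
      proof -
        have "?w ?t i \<noteq> 0" using w[OF t, of i] by (metis less_irrefl zero_complex.simps(1))
        moreover have "m = u / c * l" if "c \<noteq> 0" "c * m = u * l" for c m u l :: complex
          using that by (simp add: field_simps)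
        ultimately show ?thesis unfolding \<mu>_def using laplace_moment_eq[OF a, where z = "?w ?t" and i = i, OF w[OF t]] by blast
      qed
      then have "D = - ((\<Sum>i\<in>UNIV. \<mu> * ?v i / ?w ?t i) * laplace_integral k a (?w ?t))"
        unfolding Di[OF that] sum_distrib_right by (simp add: mult_ac)
      then show ?thesis by (simp only:) (simp add: mult_ac)
    qed
    then show ?thesis using has_vector_derivative_real_field[OF D0] has_vector_derivative_at_within by blast
  qed
  have "\<psi> (of_real 1) = \<psi> (of_real 0)"
  proof (rule has_derivative_zero_unique_strong_interval[where f = "\<lambda>t. \<psi> (of_real t)" and a = 0 and b = 1 and x = 1])
    show "finite {t :: real. \<not> inj (?w (of_real t))}" by (rule finite_line_collisions[OF \<open>inj q\<close>])
    show "continuous_on {0..1} (\<lambda>t. \<psi> (of_real t))"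
      unfolding continuous_on_eq_continuous_within using der has_vector_derivative_continuous by blast
    fix t :: real assume "t \<in> {0..1} - {t. \<not> inj (?w (of_real t))}"
    then have "((\<lambda>t. \<psi> (of_real t)) has_vector_derivative 0) (at t within {0..1})" using der[of t] by auto
    then show "((\<lambda>t. \<psi> (of_real t)) has_derivative (\<lambda>h. 0)) (at t within {0..1})" by (simp add: has_vector_derivative_def)
  qed auto
  then show ?thesis by (simp add: \<psi>_def)
qed

text \<open>Both z and (1, ..., 1) are joined to one auxiliary point q with distinct coordinates. At
  (1, ..., 1) the kernel is the exponential of minus the sum of the x_i, and the integral is
  \<open>selberg\<close>.\<close>

lemma laplace_integral_real:
  fixes z :: "'n::finite \<Rightarrow> complex"
  assumes a: "a \<ge> 1" and z: "\<And>i. Re (z i) > 0"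
  shows "laplace_integral k a z = of_real (selberg k (UNIV :: 'n set) a) * (\<Prod>i\<in>UNIV. z i powr - complex_of_real (a + k * (real CARD('n) - 1)))"
proof -
  let ?\<mu> = "complex_of_real (a + k * (real CARD('n) - 1))"
  obtain v :: "'n \<Rightarrow> real" where v: "inj v" "\<And>i. v i \<ge> 0" using ex_inj_nonneg by auto
  define q where "q i = complex_of_real (1 + v i)" for i
  have q: "inj q" "\<And>i. Re (q i) > 0" using v by (auto simp: q_def inj_def add_pos_nonneg)
  have "laplace_integral k a z * (\<Prod>i\<in>UNIV. z i powr ?\<mu>) = laplace_integral k a (\<lambda>i :: 'n. 1) * (\<Prod>i\<in>(UNIV :: 'n set). 1 powr ?\<mu>)"
    using laplace_integral_path[OF a z q(2) q(1)] laplace_integral_path[OF a _ q(2) q(1), of "\<lambda>i :: 'n. 1"] by simp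
  also have "\<dots> = of_real (selberg k (UNIV :: 'n set) a)"
    unfolding of_real_selberg laplace_integral_def kernel_const[OF k, of _ "- 1"]
    by (simp flip: exp_of_real of_real_sum)
  finally have L: "laplace_integral k a z * (\<Prod>i\<in>UNIV. z i powr ?\<mu>) = of_real (selberg k (UNIV :: 'n set) a)" .
  have "z i powr ?\<mu> * z i powr - ?\<mu> = 1" for i
  proof -
    have "z i \<noteq> 0" using z[of i] by (metis less_irrefl zero_complex.simps(1))
    moreover have "u powr m * u powr - m = 1" if "u \<noteq> 0" for u m :: complex using that by (simp add: powr_minus)
    ultimately show ?thesis by blast
  qed
  then have "(\<Prod>i\<in>UNIV. z i powr ?\<mu>) * (\<Prod>i\<in>UNIV. z i powr - ?\<mu>) = 1" unfolding prod.distrib[symmetric] by simp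
  then show ?thesis unfolding L[symmetric] by (simp add: mult.assoc)
qed

end

section \<open>Complex exponents by analytic continuation\<close>

definition laplace_density :: "real \<Rightarrow> ('n::finite \<Rightarrow> complex) \<Rightarrow> complex \<Rightarrow> ('n \<Rightarrow> real) \<Rightarrow> complex" where
  "laplace_density k z s x = kernel k (\<lambda>i. of_real (x i)) (\<lambda>i. - z i) * of_real (\<Prod>i\<in>UNIV. x i) powr (s - 1) * of_real (weight k UNIV x)"

lemma norm_prod_powr:
  assumes "x \<in> space (orthant (UNIV :: 'n::finite set))"
  shows "norm (complex_of_real (\<Prod>i\<in>UNIV. x i) powr (s - 1)) = power_weight (Re s) UNIV x"
proof -
  have "x i > 0" for i using orthant_pos[OF assms] by simp
  then have "(\<Prod>i\<in>UNIV. x i) > 0" by (intro prod_pos) auto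
  moreover have "norm (complex_of_real d powr (s - 1)) = d powr (Re s - 1)" if "d > 0" for d
    using that by (subst norm_powr_real_powr) auto
  ultimately have "norm (complex_of_real (\<Prod>i\<in>UNIV. x i) powr (s - 1)) = (\<Prod>i\<in>UNIV. x i) powr (Re s - 1)" by blast
  also have "\<dots> = power_weight (Re s) UNIV x"
    unfolding power_weight_def by (rule prod_powr_distrib)
  finally show ?thesis .
qed

lemma measurable_laplace_density:
  assumes "k > 0"
  shows "laplace_density k z s \<in> borel_measurable (orthant UNIV)"
proof -
  have "(\<lambda>u. complex_of_real u powr (s - 1)) \<in> borel_measurable (borel :: real measure)" by measurable
  then have "(\<lambda>x. complex_of_real (\<Prod>i\<in>UNIV. x i) powr (s - 1)) \<in> borel_measurable (orthant (UNIV :: 'a set))"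
    by (rule measurable_compose[rotated]) (intro borel_measurable_prod measurable_orthant_component UNIV_I)
  then show ?thesis unfolding laplace_density_def
    by (intro borel_measurable_times measurable_kernel measurable_complex_of_real measurable_weight assms)
qed

text \<open>The power of D is monotone in its exponent, increasing for D >= 1 and decreasing for D
  <= 1, so one of the two ends dominates. This provides a single majorant for a vertical strip of
  exponents.\<close>

lemma power_weight_interval:
  fixes x :: "'n::finite \<Rightarrow> real"
  assumes "x \<in> space (orthant UNIV)" "l \<le> s" "s \<le> u"
  shows "power_weight s UNIV x \<le> power_weight l UNIV x + power_weight u UNIV x"
proof -
  have pos: "x i > 0" for i using orthant_pos[OF assms(1)] by simp
  define D where "D = (\<Prod>i\<in>UNIV. x i)"
  have D: "D > 0" unfolding D_def using pos by (intro prod_pos) auto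
  have e: "power_weight r UNIV x = D powr (r - 1)" for r
    unfolding power_weight_def D_def by (rule prod_powr_distrib[symmetric])
  show ?thesis
  proof (cases "D \<ge> 1")
    case True
    then have "D powr (s - 1) \<le> D powr (u - 1)" using assms by (intro powr_mono) auto
    then show ?thesis unfolding e using powr_ge_zero[of D "l - 1"] by linarith
  next
    case False
    then have "D powr (s - 1) \<le> D powr (l - 1)" using D assms by (intro powr_mono') auto
    then show ?thesis unfolding e using powr_ge_zero[of D "u - 1"] by linarith
  qed
qed

lemma laplace_density_dominated:
  fixes z :: "'n::finite \<Rightarrow> complex"
  assumes k: "k > 0" and z: "\<And>i. Re (z i) > 0" and "0 < l" "l \<le> u"
  shows "\<exists>g. integrable (orthant UNIV) g \<and> (\<forall>x\<in>space (orthant UNIV). \<forall>s. l \<le> Re s \<longrightarrow> Re s \<le> u \<longrightarrow> norm (laplace_density k z s x) \<le> g x)"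
proof -
  let ?f = "\<lambda>a x. of_real (power_weight a UNIV x) * kernel k (\<lambda>i. of_real (x i)) (\<lambda>i. - z i) * of_real (weight k UNIV x)"
  have "integrable (orthant UNIV) (\<lambda>x. norm (?f l x) + norm (?f u x))"
    using assms by (intro Bochner_Integration.integrable_add integrable_norm integrable_laplace) auto
  moreover have "norm (laplace_density k z s x) \<le> norm (?f l x) + norm (?f u x)"
    if x: "x \<in> space (orthant UNIV)" and s: "l \<le> Re s" "Re s \<le> u" for x s
  proof -
    let ?N = "norm (kernel k (\<lambda>i. of_real (x i)) (\<lambda>i. - z i)) * weight k UNIV x"
    have "norm (laplace_density k z s x) = power_weight (Re s) UNIV x * ?N"
      unfolding laplace_density_def norm_mult norm_prod_powr[OF x] by (simp add: weight_nonneg)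
    also have "\<dots> \<le> (power_weight l UNIV x + power_weight u UNIV x) * ?N"
      by (intro mult_right_mono power_weight_interval x s mult_nonneg_nonneg weight_nonneg) simp
    also have "\<dots> = norm (?f l x) + norm (?f u x)"
      by (simp add: norm_mult power_weight_nonneg weight_nonneg algebra_simps)
    finally show ?thesis .
  qed
  ultimately show ?thesis by (intro exI[of _ "\<lambda>x. norm (?f l x) + norm (?f u x)"]) auto
qed

lemma integrable_laplace_density:
  fixes z :: "'n::finite \<Rightarrow> complex"
  assumes k: "k > 0" and z: "\<And>i. Re (z i) > 0" and "Re s > 0"
  shows "integrable (orthant UNIV) (laplace_density k z s)"
proof -
  obtain g where g: "integrable (orthant (UNIV :: 'n set)) g" "\<forall>x\<in>space (orthant UNIV). \<forall>t. Re s \<le> Re t \<longrightarrow> Re t \<le> Re s \<longrightarrow> norm (laplace_density k z t x) \<le> g x"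
    using laplace_density_dominated[where z = z, OF k z \<open>Re s > 0\<close> order_refl] by (elim exE conjE)
  show ?thesis
    by (rule Bochner_Integration.integrable_bound[OF g(1) measurable_laplace_density[OF k]])
       (use g(2) in \<open>auto intro!: AE_I2 order_trans[OF _ abs_ge_self]\<close>)
qed

lemma laplace_density_integral_holomorphic:
  fixes z :: "'n::finite \<Rightarrow> complex"
  assumes k: "k > 0" and z: "\<And>i. Re (z i) > 0"
  shows "(\<lambda>s. \<integral>x. laplace_density k z s x \<partial>orthant UNIV) holomorphic_on {s. Re s > 0}"
proof -
  have "\<exists>D. ((\<lambda>s. \<integral>x. laplace_density k z s x \<partial>orthant UNIV) has_field_derivative D) (at s0)" if "Re s0 > 0" for s0
  proof -
    \<comment> \<open>The disc of radius r about s0 stays in the strip from r to Re s0 + r, away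
      from the imaginary axis.\<close>
    define r where "r = Re s0 / 2"
    have r: "r > 0" "r \<le> Re s0 + r" using that by (auto simp: r_def)
    obtain g where g: "integrable (orthant (UNIV :: 'n set)) g"
      "\<forall>x\<in>space (orthant UNIV). \<forall>s. r \<le> Re s \<longrightarrow> Re s \<le> Re s0 + r \<longrightarrow> norm (laplace_density k z s x) \<le> g x"
      using laplace_density_dominated[where z = z, OF k z r] by (elim exE conjE)
    have near: "r \<le> Re s" "Re s \<le> Re s0 + r" if "s \<in> cball s0 r" for s
      using that abs_Re_le_cmod[of "s - s0"] by (auto simp: dist_norm norm_minus_commute r_def)
    have "((\<lambda>s. \<integral>x. laplace_density k z s x \<partial>orthant UNIV) has_field_derivative
        (\<integral>x. (\<lambda>x s. laplace_density k z s x * of_real (ln (\<Prod>i\<in>UNIV. x i))) x s0 \<partial>orthant UNIV)) (at s0)"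
    proof (rule holomorphic_integral(2)[where f = "\<lambda>x s. laplace_density k z s x" and r = r and g = g])
      fix x :: "'n \<Rightarrow> real" and s assume x: "x \<in> space (orthant UNIV)" and s: "s \<in> cball s0 r"
      have D: "(\<Prod>i\<in>UNIV. x i) > 0" using orthant_pos[OF x] by (intro prod_pos) auto
      show "((\<lambda>s. laplace_density k z s x) has_field_derivative laplace_density k z s x * of_real (ln (\<Prod>i\<in>UNIV. x i))) (at s)"
      proof -
        have pw: "complex_of_real (\<Prod>i\<in>UNIV. x i) powr (t - 1) = exp ((t - 1) * of_real (ln (\<Prod>i\<in>UNIV. x i)))" for t
        proof -
          have "complex_of_real d powr (t - 1) = exp ((t - 1) * of_real (ln d))" if "d > 0" for d
            using that by (simp add: powr_def Ln_of_real)
          then show ?thesis using D by blast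
        qed
        show ?thesis unfolding laplace_density_def pw
          by (rule derivative_eq_intros refl | simp)+
      qed
      show "norm (laplace_density k z s x) \<le> g x" using g(2) x near[OF s] by blast
    qed (use g r measurable_laplace_density[OF k] in auto)
    then show ?thesis by blast
  qed
  then show ?thesis unfolding holomorphic_on_def field_differentiable_def
    using has_field_derivative_at_within by blast
qed

text \<open>Both sides are holomorphic in s on the right half-plane and agree for real s from 1 on.\<close>

lemma laplace_density_integral:
  fixes z :: "'n::finite \<Rightarrow> complex"
  assumes k: "k > 0" and z: "\<And>i. Re (z i) > 0" and s: "Re s > 0"
  shows "(\<integral>x. laplace_density k z s x \<partial>orthant UNIV) = of_real (\<Prod>j=1..CARD('n). Gamma (1 + real j * k) / Gamma (1 + k))
     * (\<Prod>m<CARD('n). Gamma (s + of_real (k * real m))) * (\<Prod>i\<in>UNIV. z i powr - (s + of_real (k * (real CARD('n) - 1))))"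
proof -
  let ?R = "complex_of_real (\<Prod>j=1..CARD('n). Gamma (1 + real j * k) / Gamma (1 + k))"
  let ?r = "\<lambda>s. ?R * (\<Prod>m<CARD('n). Gamma (s + of_real (k * real m))) * (\<Prod>i\<in>UNIV. z i powr - (s + of_real (k * (real CARD('n) - 1))))"
  let ?l = "\<lambda>s. \<integral>x. laplace_density k z s x \<partial>orthant UNIV"
  have "?l s - ?r s = 0"
  proof (rule analytic_continuation[where S = "{s. Re s > 0}" and U = "complex_of_real ` {1..}" and \<xi> = 1 and f = "\<lambda>s. ?l s - ?r s"])
    have Gh: "(\<lambda>s. Gamma (s + of_real (k * real m))) holomorphic_on {s. Re s > 0}" for m
    proof (intro holomorphic_intros)
      fix s assume "s \<in> {s. Re s > 0}"
      then have "Re (s + of_real (k * real m)) > 0" using k by (simp add: add_pos_nonneg)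
      moreover have "Re w \<le> 0" if "w \<in> \<int>\<^sub>\<le>\<^sub>0" for w :: complex using that by (elim nonpos_Ints_cases) simp
      ultimately show "s + of_real (k * real m) \<notin> \<int>\<^sub>\<le>\<^sub>0" by fastforce
    qed
    have Zh: "(\<lambda>s. z i powr - (s + of_real (k * (real CARD('n) - 1)))) holomorphic_on {s. Re s > 0}" for i
    proof -
      have "z i \<noteq> 0" using z[of i] by (metis less_irrefl zero_complex.simps(1))
      then show ?thesis unfolding powr_def by (simp only: if_False) (intro holomorphic_intros)
    qed
    show "(\<lambda>s. ?l s - ?r s) holomorphic_on {s. Re s > 0}"
      by (intro holomorphic_on_diff laplace_density_integral_holomorphic k z holomorphic_on_mult holomorphic_on_const holomorphic_on_prod Gh Zh)
    show "open {s. Re s > 0}" by (rule open_halfspace_Re_gt)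
    show "connected {s. Re s > 0}" by (intro convex_connected convex_halfspace_Re_gt)
    show "complex_of_real ` {1..} \<subseteq> {s. Re s > 0}" by auto
    \<comment> \<open>The points 1 + 1 / (n + 1) of the half-line where the formula is known
      accumulate at 1, inside the half-plane.\<close>
    show "1 islimpt complex_of_real ` {1..}"
      unfolding islimpt_sequential
    proof (intro exI conjI allI)
      show "complex_of_real (1 + inverse (real (Suc n))) \<in> complex_of_real ` {1..} - {1}" for n
      proof -
        have "1 + inverse (real (Suc n)) \<in> {1..}" "complex_of_real (1 + inverse (real (Suc n))) \<noteq> 1" by (auto simp: complex_eq_iff)
        then show ?thesis by blast
      qed
      have "(\<lambda>n. complex_of_real (1 + inverse (real (Suc n)))) \<longlonglongrightarrow> complex_of_real (1 + 0)"
        by (intro tendsto_intros LIMSEQ_inverse_real_of_nat)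
      then show "(\<lambda>n. complex_of_real (1 + inverse (real (Suc n)))) \<longlonglongrightarrow> 1" by simp
    qed
    fix s assume "s \<in> complex_of_real ` {1..}"
    then obtain a where a: "a \<ge> 1" "s = of_real a" by auto
    have "?l s = laplace_integral k a z"
      unfolding laplace_integral_def a(2)
    proof (intro Bochner_Integration.integral_cong refl)
      fix x :: "'n \<Rightarrow> real" assume x: "x \<in> space (orthant UNIV)"
      have "x i > 0" for i using orthant_pos[OF x] by simp
      then have "(\<Prod>i\<in>UNIV. x i) > 0" by (intro prod_pos) auto
      then have "complex_of_real (\<Prod>i\<in>UNIV. x i) powr (of_real a - 1) = of_real ((\<Prod>i\<in>UNIV. x i) powr (a - 1))"
        using powr_of_real[of "\<Prod>i\<in>UNIV. x i" "a - 1"] by simp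
      also have "(\<Prod>i\<in>UNIV. x i) powr (a - 1) = power_weight a UNIV x"
        unfolding power_weight_def by (rule prod_powr_distrib)
      finally show "laplace_density k z (of_real a) x = of_real (power_weight a UNIV x) * kernel k (\<lambda>i. of_real (x i)) (\<lambda>i. - z i) * of_real (weight k UNIV x)"
        unfolding laplace_density_def by (simp only: mult_ac)
    qed
    also have "\<dots> = ?R * complex_of_real (\<Prod>m<CARD('n). Gamma (a + k * real m)) * (\<Prod>i\<in>UNIV. z i powr - complex_of_real (a + k * (real CARD('n) - 1)))"
      using laplace_integral_real[OF k a(1), of z, OF z] selberg_formula[OF k finite a(1), of "UNIV :: 'n set"]
      by (simp only: of_real_mult)
    also have "complex_of_real (\<Prod>m<CARD('n). Gamma (a + k * real m)) = (\<Prod>m<CARD('n). Gamma (s + of_real (k * real m)))"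
      unfolding of_real_prod a(2) by (intro prod.cong refl) (simp only: Gamma_complex_of_real[symmetric] of_real_add)
    also have "(\<Prod>i\<in>UNIV. z i powr - complex_of_real (a + k * (real CARD('n) - 1))) = (\<Prod>i\<in>UNIV. z i powr - (s + of_real (k * (real CARD('n) - 1))))"
      unfolding a(2) of_real_add ..
    finally show "?l s - ?r s = 0" by simp
  qed (use s in auto)
  then show ?thesis by simp
qed

section \<open>Transfer to Lebesgue measure on vectors\<close>

lemma measurable_vec_lambda: "(vec_lambda :: ('n::finite \<Rightarrow> real) \<Rightarrow> real ^ 'n) \<in> borel_measurable (PiM UNIV (\<lambda>_. lborel))"
proof (rule borel_measurable_euclidean_space[THEN iffD2], rule ballI)
  fix b :: "real ^ 'n" assume "b \<in> Basis"
  then obtain j where b: "b = axis j 1" by (auto simp: Basis_vec_def)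
  have "(\<lambda>x. x j) \<in> borel_measurable (PiM UNIV (\<lambda>_ :: 'n. lborel :: real measure))"
    using measurable_component_singleton[of j UNIV "\<lambda>_ :: 'n. lborel :: real measure"] by simp
  then show "(\<lambda>x. vec_lambda x \<bullet> b) \<in> borel_measurable (PiM UNIV (\<lambda>_. lborel))"
    by (simp add: b inner_axis)
qed

lemma emeasure_distr_vec_lambda:
  fixes A :: "'n::finite \<Rightarrow> real set"
  assumes A: "\<And>i. A i \<in> sets borel" and "{x :: real ^ 'n. \<forall>i. x $ i \<in> A i} \<in> sets borel"
  shows "emeasure (distr (PiM UNIV (\<lambda>_. lborel)) borel vec_lambda) {x :: real ^ 'n. \<forall>i. x $ i \<in> A i} = (\<Prod>i\<in>UNIV. emeasure lborel (A i))"
proof -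
  interpret product_sigma_finite "\<lambda>_ :: 'n. lborel :: real measure" by standard
  have "vec_lambda -` {x :: real ^ 'n. \<forall>i. x $ i \<in> A i} \<inter> space (PiM UNIV (\<lambda>_. lborel)) = PiE UNIV A"
    by (auto simp: space_PiM PiE_def Pi_def)
  then show ?thesis
    using assms by (subst emeasure_distr[OF measurable_vec_lambda]) (auto simp: emeasure_PiM)
qed

text \<open>Lebesgue measure is determined by its values on boxes, where both measures give the
  product of the side lengths.\<close>

lemma lborel_cart_eq: "lborel = distr (PiM UNIV (\<lambda>_ :: 'n::finite. lborel :: real measure)) borel vec_lambda"
proof (rule lborel_eqI)
  fix l u :: "real ^ 'n" assume lu: "\<And>b. b \<in> Basis \<Longrightarrow> l \<bullet> b \<le> u \<bullet> b"
  have le: "l $ i \<le> u $ i" for i using lu[of "axis i 1"] by (simp add: inner_axis)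
  have box: "box l u = {x. \<forall>i. x $ i \<in> {l $ i<..<u $ i}}" by (auto simp: mem_box_cart)
  have "emeasure (distr (PiM UNIV (\<lambda>_ :: 'n. lborel :: real measure)) borel vec_lambda) (box l u) = (\<Prod>i\<in>UNIV. emeasure lborel {l $ i<..<u $ i})"
    unfolding box by (rule emeasure_distr_vec_lambda) (use open_box[of l u] in \<open>auto simp: box[symmetric]\<close>)
  also have "\<dots> = ennreal (\<Prod>i\<in>UNIV. u $ i - l $ i)" using le by (simp add: prod_ennreal)
  also have "(\<Prod>i\<in>UNIV. u $ i - l $ i) = (\<Prod>b\<in>Basis. (u - l) \<bullet> b)"
  proof -
    have B: "(Basis :: (real ^ 'n) set) = range (\<lambda>i. axis i 1)" by (auto simp: Basis_vec_def)
    have "inj (\<lambda>i :: 'n. axis i (1 :: real))" by (rule injI) (simp add: axis_eq_axis)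
    then show ?thesis unfolding B by (simp add: prod.reindex inner_axis)
  qed
  finally show "emeasure (distr (PiM UNIV (\<lambda>_ :: 'n. lborel :: real measure)) borel vec_lambda) (box l u) = (\<Prod>b\<in>Basis. (u - l) \<bullet> b)" .
qed simp

definition positive_cone :: "(real ^ 'n) set" where
  "positive_cone = {x. \<forall>i. x $ i > 0}"

lemma sets_cart_product:
  fixes A :: "'n::finite \<Rightarrow> real set"
  assumes "\<And>i. A i \<in> sets borel"
  shows "{x :: real ^ 'n. \<forall>i. x $ i \<in> A i} \<in> sets borel"
proof -
  have "(\<lambda>x :: real ^ 'n. x $ i) \<in> borel_measurable borel" for i
    by (intro borel_measurable_continuous_onI continuous_intros)
  then have "(\<lambda>x :: real ^ 'n. x $ i) -` A i \<in> sets borel" for i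
    using measurable_sets[of "\<lambda>x :: real ^ 'n. x $ i" borel borel "A i"] assms by simp
  then have "(\<Inter>i\<in>UNIV. (\<lambda>x :: real ^ 'n. x $ i) -` A i) \<in> sets borel" by (intro sets.finite_INT) auto
  moreover have "(\<Inter>i\<in>UNIV. (\<lambda>x :: real ^ 'n. x $ i) -` A i) = {x. \<forall>i. x $ i \<in> A i}" by auto
  ultimately show ?thesis by simp
qed

lemma positive_cone_sets: "(positive_cone :: (real ^ 'n::finite) set) \<in> sets borel"
  using sets_cart_product[of "\<lambda>_ :: 'n. {0<..}"] by (simp add: positive_cone_def)

lemma measurable_vec_nth_orthant:
  "(\<lambda>x i. x $ i) \<in> measurable (restrict_space lborel (positive_cone :: (real ^ 'n::finite) set)) (orthant UNIV)"
  unfolding orthant_def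
proof (rule measurable_PiM_single')
  fix i :: 'n
  have "(\<lambda>x :: real ^ 'n. x $ i) \<in> borel_measurable borel" by (intro borel_measurable_continuous_onI continuous_intros)
  then have "(\<lambda>x :: real ^ 'n. x $ i) \<in> measurable (restrict_space lborel positive_cone) lborel"
    by (intro measurable_restrict_space1) simp
  then show "(\<lambda>x :: real ^ 'n. x $ i) \<in> measurable (restrict_space lborel positive_cone) pos_line"
    unfolding pos_line_def by (intro measurable_restrict_space2) (auto simp: space_restrict_space positive_cone_def)
next
  show "(\<lambda>x i. x $ i) \<in> space (restrict_space lborel (positive_cone :: (real ^ 'n) set)) \<rightarrow> (\<Pi>\<^sub>E i\<in>UNIV. space pos_line)"
    by (auto simp: space_restrict_space positive_cone_def)
qed

text \<open>A product measure is determined by rectangles, and a rectangle inside the positive cone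
  has the measure it has in the whole space.\<close>

lemma orthant_eq_distr:
  "distr (restrict_space lborel (positive_cone :: (real ^ 'n::finite) set)) (orthant UNIV) (\<lambda>x i. x $ i) = orthant UNIV"
proof -
  let ?R = "restrict_space lborel (positive_cone :: (real ^ 'n) set)"
  have "distr ?R (orthant UNIV) (\<lambda>x i. x $ i) = PiM UNIV (\<lambda>_. pos_line)"
  proof (rule pos_prod.PiM_eqI)
    fix A :: "'n \<Rightarrow> real set" assume "\<And>i. i \<in> UNIV \<Longrightarrow> A i \<in> sets pos_line"
    then have Ap: "A i \<in> sets pos_line" for i by simp
    then have A: "A i \<in> sets borel" "A i \<subseteq> {0<..}" for i
      unfolding pos_line_def by (simp_all add: sets_restrict_space_iff)
    let ?B = "{x :: real ^ 'n. \<forall>i. x $ i \<in> A i}"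
    have Bp: "?B \<subseteq> positive_cone" using A(2) by (auto simp: positive_cone_def)
    have "PiE UNIV A \<in> sets (orthant UNIV)" unfolding orthant_def using Ap by (intro sets_PiM_I_finite) auto
    then have "emeasure (distr ?R (orthant UNIV) (\<lambda>x i. x $ i)) (PiE UNIV A) = emeasure ?R ((\<lambda>x i. x $ i) -` PiE UNIV A \<inter> space ?R)"
      by (rule emeasure_distr[OF measurable_vec_nth_orthant])
    also have "(\<lambda>x i. x $ i) -` PiE UNIV A \<inter> space ?R = ?B" using Bp by (auto simp: space_restrict_space PiE_def Pi_def)
    also have "emeasure ?R ?B = emeasure lborel ?B"
      using Bp positive_cone_sets by (intro emeasure_restrict_space) auto
    also have "\<dots> = (\<Prod>i\<in>UNIV. emeasure lborel (A i))"
      by (subst lborel_cart_eq) (rule emeasure_distr_vec_lambda[OF A(1) sets_cart_product[OF A(1)]])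
    also have "\<dots> = (\<Prod>i\<in>UNIV. emeasure pos_line (A i))"
      unfolding pos_line_def using A(2) by (intro prod.cong refl emeasure_restrict_space[symmetric]) auto
    finally show "emeasure (distr ?R (orthant UNIV) (\<lambda>x i. x $ i)) (PiE UNIV A) = (\<Prod>i\<in>UNIV. emeasure pos_line (A i))" .
  qed (auto simp: orthant_def)
  then show ?thesis by (simp add: orthant_def)
qed

text \<open>The ordered pairs split into i < j and j < i. The two halves are equal, and each factor
  meets its mirror image to give the exponent 2 k.\<close>

lemma omega_k_eq_weight:
  fixes x :: "real ^ 'n::{finite,linorder}"
  shows "omega_k k x = weight k UNIV (\<lambda>i. x $ i)"
proof -
  let ?A = "{p :: 'n \<times> 'n. fst p < snd p}" and ?B = "{p :: 'n \<times> 'n. snd p < fst p}"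
  let ?g = "\<lambda>p. \<bar>x $ fst p - x $ snd p\<bar> powr k"
  have "weight k UNIV (\<lambda>i. x $ i) = prod ?g {p \<in> UNIV \<times> UNIV. fst p \<noteq> snd p}"
    unfolding weight_def by (rule prod_off_diagonal[OF finite])
  also have "{p \<in> UNIV \<times> UNIV. fst p \<noteq> snd p} = ?A \<union> ?B" by (auto simp: neq_iff)
  also have "prod ?g (?A \<union> ?B) = prod ?g ?A * prod ?g ?B" by (rule prod.union_disjoint) auto
  also have "prod ?g ?B = prod ?g ?A"
    by (rule prod.reindex_bij_witness[of _ prod.swap prod.swap]) (auto simp: abs_minus_commute)
  also have "prod ?g ?A * prod ?g ?A = (\<Prod>p\<in>?A. \<bar>x $ fst p - x $ snd p\<bar> powr (2 * k))"
    unfolding prod.distrib[symmetric] powr_add[symmetric] mult_2 ..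
  finally show ?thesis unfolding omega_k_def by (simp add: case_prod_unfold)
qed

theorem theorem5p2:
  fixes k :: real and \<mu> :: complex and z :: "complex ^ ('n::{finite,linorder})"
  assumes "k > 0"
    and "Re \<mu> > k * (real CARD('n) - 1)"
    and "\<forall>i. Re (z $ i) > 0"
  shows "set_integrable lborel {x. \<forall>i. x $ i > 0}
           (\<lambda>x. dunkl_kernel_A k (- x) z
                 * (of_real (D_real x) powr (\<mu> - of_real (k * (real CARD('n) - 1)) - 1))
                 * of_real (omega_k k x))
       \<and> (LINT x : {x. \<forall>i. x $ i > 0} | lborel.
             dunkl_kernel_A k (- x) z
             * (of_real (D_real x) powr (\<mu> - of_real (k * (real CARD('n) - 1)) - 1))
             * of_real (omega_k k x))
         = of_real (d_n CARD('n) k) * Gamma_n CARD('n) \<mu> k * D_cpow z (- \<mu>)"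
proof -
  \<comment> \<open>This s = mu - mu_0 continues the real exponent a, and the hypothesis on mu is
    exactly Re s > 0.\<close>
  define s where "s = \<mu> - of_real (k * (real CARD('n) - 1))"
  have s: "Re s > 0" using assms(2) by (simp add: s_def)
  have z: "Re (z $ i) > 0" for i using assms(3) by blast
  let ?h = "laplace_density k (\<lambda>i. z $ i) s"
  let ?R = "restrict_space lborel (positive_cone :: (real, 'n) vec set)"
  have pc: "positive_cone \<inter> space lborel \<in> sets (lborel :: (real, 'n) vec measure)" using positive_cone_sets by simp
  \<comment> \<open>Homogeneity of the parts in either variable moves the minus sign from x to
    z.\<close>
  have f: "dunkl_kernel_A k (- x) z * (of_real (D_real x) powr (s - 1)) * of_real (omega_k k x) = ?h (\<lambda>i. x $ i)" for x
    using kernel_minus_left[OF assms(1), of "\<lambda>i. of_real (x $ i)" "\<lambda>i. z $ i"]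
    by (simp add: laplace_density_def dunkl_kernel_A_eq[OF assms(1)] D_real_def omega_k_eq_weight)
  have "integrable (orthant UNIV) ?h" by (rule integrable_laplace_density[OF assms(1) z s])
  then have "integrable ?R (\<lambda>x. ?h (\<lambda>i. x $ i))"
    using integrable_distr_eq[OF measurable_vec_nth_orthant measurable_laplace_density[OF assms(1)], of "\<lambda>i. z $ i" s]
    unfolding orthant_eq_distr by blast
  then have int: "set_integrable lborel positive_cone (\<lambda>x. ?h (\<lambda>i. x $ i))"
    unfolding set_integrable_def integrable_restrict_space[OF pc] .
  have "(LINT x : positive_cone | lborel. ?h (\<lambda>i. x $ i)) = (\<integral>x. ?h (\<lambda>i. x $ i) \<partial>?R)"
    unfolding set_lebesgue_integral_def integral_restrict_space[OF pc] ..
  also have "\<dots> = (\<integral>x. ?h x \<partial>orthant UNIV)"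
    using integral_distr[OF measurable_vec_nth_orthant measurable_laplace_density[OF assms(1), of "\<lambda>i. z $ i" s]]
    unfolding orthant_eq_distr by (rule sym)
  also have "\<dots> = of_real (\<Prod>j=1..CARD('n). Gamma (1 + real j * k) / Gamma (1 + k))
     * (\<Prod>m<CARD('n). Gamma (s + of_real (k * real m))) * (\<Prod>i\<in>UNIV. z $ i powr - (s + of_real (k * (real CARD('n) - 1))))"
    by (rule laplace_density_integral[OF assms(1) z s])
  \<comment> \<open>With j = n - m one has s + k m = mu - k (j - 1).\<close>
  also have "(\<Prod>m<CARD('n). Gamma (s + of_real (k * real m))) = Gamma_n CARD('n) \<mu> k"
    unfolding Gamma_n_def
    by (rule prod.reindex_bij_witness[of _ "\<lambda>j. CARD('n) - j" "\<lambda>m. CARD('n) - m"])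
       (auto simp: s_def of_nat_diff algebra_simps)
  also have "(\<Prod>i\<in>UNIV. z $ i powr - (s + of_real (k * (real CARD('n) - 1)))) = D_cpow z (- \<mu>)"
    by (simp add: D_cpow_def s_def)
  also have "(\<Prod>j=1..CARD('n). Gamma (1 + real j * k) / Gamma (1 + k)) = d_n CARD('n) k" by (simp add: d_n_def)
  finally have val: "(LINT x : positive_cone | lborel. ?h (\<lambda>i. x $ i)) = of_real (d_n CARD('n) k) * Gamma_n CARD('n) \<mu> k * D_cpow z (- \<mu>)" .
  show ?thesis
    unfolding s_def[symmetric] f positive_cone_def[symmetric] using int val by blast
qed

end
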